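(* Let $n\ge1$, let $\psi:[0,\infty)\to[0,\infty)$ be an increasing (not necessarily continuous) function such that $$\int_0^\infty\frac{\psi(x)}{1+x^2}\,dx=\infty,$$ and let $\mu$ be a complex (finite) Borel measure on $\mathbb{R}^n$ satisfying $$\int_{\mathbb{R}^n}e^{\psi(|x|)}\,d|\mu|(x)<\infty.$$ Then for any set $\Lambda=\Lambda_1\times\cdots\times\Lambda_n\subset\mathbb{R}^n$, where each $\Lambda_j\subset\mathbb{R}$ is a closed set of positive Lebesgue measure, the space $\Phi_\Lambda(\mathbb{R}^n)$ is dense in $L^p(\mathbb{R}^n,|\mu|)$ for $1\le p<\infty$.
   Context: $|x|$ is the Euclidean norm and $x\cdot y$ the Euclidean inner product on $\mathbb{R}^n$. "Increasing" means $x\le y\Rightarrow\psi(x)\le\psi(y)$. $|\mu|$ is the total variation measure of $\mu$. For $\Lambda\subset\mathbb{R}^n$, $\Phi_\Lambda(\mathbb{R}^n)$ is the complex linear span of $\{e_\lambda:\lambda\in\Lambda\}$, where $e_\lambda(x)=e^{-i\lambda\cdot x}$ for $x\in\mathbb{R}^n$. *)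

theory Defs
  imports "HOL-Analysis.Analysis" "HOL-Library.Function_Algebras"
begin

section \<open>Complex measures and total variation\<close>

text \<open>A complex measure is a countably additive complex-valued set function on the
  \<open>\<sigma>\<close>-algebra of a measurable space; only \<open>sets M\<close> matters, not the measure carried by \<open>M\<close>, and the
  values of \<open>\<mu>\<close> outside \<open>sets M\<close> are irrelevant. Taking all \<open>A i\<close> empty gives \<open>\<mu> {} = 0\<close>.\<close>

definition complex_measure :: "'a measure \<Rightarrow> ('a set \<Rightarrow> complex) \<Rightarrow> bool" where
  "complex_measure M \<mu> \<longleftrightarrow>
     (\<forall>A :: nat \<Rightarrow> 'a set. range A \<subseteq> sets M \<longrightarrow> disjoint_family A \<longrightarrow>
        (\<lambda>i. \<mu> (A i)) sums \<mu> (\<Union>i. A i))"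

definition measurable_partitions :: "'a measure \<Rightarrow> 'a set \<Rightarrow> (nat \<Rightarrow> 'a set) set" where
  "measurable_partitions M E = {A. range A \<subseteq> sets M \<and> disjoint_family A \<and> (\<Union>i. A i) = E}"

definition variation :: "'a measure \<Rightarrow> ('a set \<Rightarrow> complex) \<Rightarrow> 'a set \<Rightarrow> ennreal" where
  "variation M \<mu> E = (SUP A\<in>measurable_partitions M E. \<Sum>i. ennreal (norm (\<mu> (A i))))"

text \<open>The constant \<open>measure_of\<close> yields the null measure unless the given set function is a measure;
  the lemma \<open>emeasure_total_variation\<close> below excludes this case.\<close>

definition total_variation :: "'a measure \<Rightarrow> ('a set \<Rightarrow> complex) \<Rightarrow> 'a measure" where
  "total_variation M \<mu> = measure_of (space M) (sets M) (variation M \<mu>)"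

lemma space_total_variation [simp]: "space (total_variation M \<mu>) = space M"
  by (simp add: total_variation_def)

lemma sets_total_variation [simp, measurable_cong]: "sets (total_variation M \<mu>) = sets M"
  by (simp add: total_variation_def)

lemma complex_measure_empty:
  assumes "complex_measure M \<mu>"
  shows "\<mu> {} = 0"
proof -
  have "(\<lambda>i::nat. \<mu> {}) sums \<mu> {}"
    using assms[unfolded complex_measure_def, rule_format, of "\<lambda>_. {}"]
    by (simp add: disjoint_family_on_def)
  then have "(\<lambda>i::nat. \<mu> {}) \<longlonglongrightarrow> 0"
    by (intro summable_LIMSEQ_zero) (rule sums_summable)
  then show ?thesis by (simp add: LIMSEQ_const_iff)
qed

lemma variation_empty:
  assumes "complex_measure M \<mu>"
  shows "variation M \<mu> {} = 0"
proof -
  have "(\<Sum>i. ennreal (norm (\<mu> (A i)))) = 0" if "A \<in> measurable_partitions M {}" for A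
  proof -
    have "A i = {}" for i using that by (auto simp: measurable_partitions_def)
    then show ?thesis using complex_measure_empty[OF assms] by simp
  qed
  then have "variation M \<mu> {} \<le> 0"
    unfolding variation_def by (intro SUP_least) (simp only: order.refl)
  then show ?thesis by simp
qed

lemma partition_single:
  "E \<in> sets M \<Longrightarrow> (\<lambda>i. if i = 0 then E else {}) \<in> measurable_partitions M E"
  by (auto simp: measurable_partitions_def disjoint_family_on_def split: if_splits)

lemma variation_superadd:
  assumes E: "E \<in> sets M" and F: "F \<in> sets M" and EF: "E \<inter> F = {}"
  shows "variation M \<mu> E + variation M \<mu> F \<le> variation M \<mu> (E \<union> F)"
proof -
  have *: "(\<Sum>i. ennreal (norm (\<mu> (A i)))) + (\<Sum>i. ennreal (norm (\<mu> (B i))))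
             \<le> variation M \<mu> (E \<union> F)"
    if A: "A \<in> measurable_partitions M E" and B: "B \<in> measurable_partitions M F" for A B
  proof -
    define C where "C = (\<lambda>i. if even i then A (i div 2) else B (i div 2))"
    have AE: "A i \<subseteq> E" and BF: "B i \<subseteq> F" for i
      using A B by (auto simp: measurable_partitions_def)
    have disj: "C i \<inter> C j = {}" if "i \<noteq> j" for i j
    proof (cases "even i = even j")
      case True
      then have "i div 2 \<noteq> j div 2" using that by (metis even_two_times_div_two odd_two_times_div_two_succ)
      then show ?thesis using A B True
        by (auto simp: C_def measurable_partitions_def disjoint_family_on_def)
    next
      case False
      then show ?thesis using AE[of "i div 2"] BF[of "i div 2"] AE[of "j div 2"] BF[of "j div 2"] EF
        by (auto simp: C_def)
    qed
    have "(\<Union>i. C i) = (\<Union>i. A i) \<union> (\<Union>i. B i)"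
    proof
      show "(\<Union>i. C i) \<subseteq> (\<Union>i. A i) \<union> (\<Union>i. B i)"
        by (auto simp: C_def split: if_splits)
      have "A i = C (2 * i)" "B i = C (2 * i + 1)" for i
        by (simp_all add: C_def)
      then show "(\<Union>i. A i) \<union> (\<Union>i. B i) \<subseteq> (\<Union>i. C i)"
        by blast
    qed
    then have C: "C \<in> measurable_partitions M (E \<union> F)"
      using A B disj by (auto simp: measurable_partitions_def disjoint_family_on_def C_def)
    have fin: "(\<Sum>i<N. ennreal (norm (\<mu> (A i)))) + (\<Sum>i<N. ennreal (norm (\<mu> (B i))))
            = (\<Sum>i<2*N. ennreal (norm (\<mu> (C i))))" for N
      by (induction N) (simp_all add: C_def algebra_simps)
    have "(\<Sum>i. ennreal (norm (\<mu> (A i)))) + (\<Sum>i. ennreal (norm (\<mu> (B i))))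
            = (\<Sum>i. ennreal (norm (\<mu> (A i))) + ennreal (norm (\<mu> (B i))))"
      by (rule suminf_add) (auto intro: summableI)
    also have "\<dots> \<le> (\<Sum>i. ennreal (norm (\<mu> (C i))))"
    proof (rule suminf_le_const)
      fix N
      show "(\<Sum>i<N. ennreal (norm (\<mu> (A i))) + ennreal (norm (\<mu> (B i))))
              \<le> (\<Sum>i. ennreal (norm (\<mu> (C i))))"
        unfolding sum.distrib fin by (rule sum_le_suminf) auto
    qed auto
    also have "\<dots> \<le> variation M \<mu> (E \<union> F)"
      unfolding variation_def by (rule SUP_upper[OF C])
    finally show ?thesis .
  qed
  have neE: "measurable_partitions M E \<noteq> {}" and neF: "measurable_partitions M F \<noteq> {}"
    using partition_single E F by blast+
  have "variation M \<mu> E + variation M \<mu> F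
      = (SUP A\<in>measurable_partitions M E. (SUP B\<in>measurable_partitions M F.
          (\<Sum>i. ennreal (norm (\<mu> (A i)))) + (\<Sum>i. ennreal (norm (\<mu> (B i))))))"
    unfolding variation_def
    by (simp add: ennreal_SUP_add_left[OF neE] ennreal_SUP_add_right[OF neF, symmetric])
  also have "\<dots> \<le> variation M \<mu> (E \<union> F)"
    by (intro SUP_least *)
  finally show ?thesis .
qed

lemma norm_le_suminf_ennreal:
  assumes "f sums (s :: complex)"
  shows "ennreal (norm s) \<le> (\<Sum>i. ennreal (norm (f i)))"
proof (rule LIMSEQ_le_const2)
  show "(\<lambda>n. ennreal (norm (\<Sum>i<n. f i))) \<longlonglongrightarrow> ennreal (norm s)"
    using assms unfolding sums_def by (intro tendsto_intros)
  have "ennreal (norm (\<Sum>i<n. f i)) \<le> (\<Sum>i. ennreal (norm (f i)))" for n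
  proof -
    have "ennreal (norm (\<Sum>i<n. f i)) \<le> ennreal (\<Sum>i<n. norm (f i))"
      by (intro ennreal_leI norm_sum)
    also have "\<dots> = (\<Sum>i<n. ennreal (norm (f i)))" by simp
    also have "\<dots> \<le> (\<Sum>i. ennreal (norm (f i)))" by (rule sum_le_suminf) auto
    finally show ?thesis .
  qed
  then show "\<exists>N. \<forall>n\<ge>N. ennreal (norm (\<Sum>i<n. f i)) \<le> (\<Sum>i. ennreal (norm (f i)))" by blast
qed

lemma suminf_swap_ennreal:
  fixes f :: "nat \<Rightarrow> nat \<Rightarrow> ennreal"
  shows "(\<Sum>i. \<Sum>j. f i j) = (\<Sum>j. \<Sum>i. f i j)"
  using nn_integral_suminf[of "\<lambda>i j. f i j" "count_space (UNIV::nat set)"]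
  by (simp add: nn_integral_count_space_nat)

lemma variation_countably_additive:
  assumes \<mu>: "complex_measure M \<mu>"
  shows "countably_additive (sets M) (variation M \<mu>)"
  unfolding countably_additive_def
proof (intro allI impI antisym)
  fix E :: "nat \<Rightarrow> 'a set"
  assume E: "range E \<subseteq> sets M" and disj: "disjoint_family E" and U: "(\<Union>i. E i) \<in> sets M"
  have Ei: "E i \<in> sets M" for i using E by auto
  have fin: "(\<Sum>i<n. variation M \<mu> (E i)) \<le> variation M \<mu> (\<Union>i<n. E i)" for n
  proof (induction n)
    case (Suc n)
    have "(\<Union>i<n. E i) \<inter> E n = {}"
    proof -
      have "E i \<inter> E n = {}" if "i < n" for i
        using disj that by (auto simp: disjoint_family_on_def)
      then show ?thesis by auto
    qed
    then have "variation M \<mu> (\<Union>i<n. E i) + variation M \<mu> (E n) \<le> variation M \<mu> ((\<Union>i<n. E i) \<union> E n)"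
      using Ei by (intro variation_superadd) auto
    also have "(\<Union>i<n. E i) \<union> E n = (\<Union>i<Suc n. E i)"
      by (auto simp: lessThan_Suc)
    finally show ?case using Suc by (auto intro: order_trans add_right_mono)
  qed (simp add: variation_empty[OF \<mu>])
  show "(\<Sum>i. variation M \<mu> (E i)) \<le> variation M \<mu> (\<Union>i. E i)"
  proof (rule suminf_le_const)
    fix n
    have "variation M \<mu> (\<Union>i<n. E i) \<le> variation M \<mu> (\<Union>i<n. E i) + variation M \<mu> ((\<Union>i. E i) - (\<Union>i<n. E i))"
      by simp
    also have "\<dots> \<le> variation M \<mu> ((\<Union>i<n. E i) \<union> ((\<Union>i. E i) - (\<Union>i<n. E i)))"
      using Ei U by (intro variation_superadd) auto
    also have "(\<Union>i<n. E i) \<union> ((\<Union>i. E i) - (\<Union>i<n. E i)) = (\<Union>i. E i)" by auto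
    finally show "(\<Sum>i<n. variation M \<mu> (E i)) \<le> variation M \<mu> (\<Union>i. E i)"
      using fin order_trans by blast
  qed auto
  show "variation M \<mu> (\<Union>i. E i) \<le> (\<Sum>i. variation M \<mu> (E i))"
    unfolding variation_def[of M \<mu> "\<Union>i. E i"]
  proof (rule SUP_least)
    fix B assume B: "B \<in> measurable_partitions M (\<Union>i. E i)"
    then have Bj: "B j \<in> sets M" and BU: "(\<Union>j. B j) = (\<Union>i. E i)" and Bd: "disjoint_family B" for j
      by (auto simp: measurable_partitions_def)
    have 1: "ennreal (norm (\<mu> (B j))) \<le> (\<Sum>i. ennreal (norm (\<mu> (B j \<inter> E i))))" for j
    proof (rule norm_le_suminf_ennreal)
      have "(\<lambda>i. \<mu> (B j \<inter> E i)) sums \<mu> (\<Union>i. B j \<inter> E i)"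
      proof (rule \<mu>[unfolded complex_measure_def, rule_format])
        show "range (\<lambda>i. B j \<inter> E i) \<subseteq> sets M" using Bj Ei by auto
        show "disjoint_family (\<lambda>i. B j \<inter> E i)" using disj by (fastforce simp: disjoint_family_on_def)
      qed
      also have "(\<Union>i. B j \<inter> E i) = B j" using BU by auto
      finally show "(\<lambda>i. \<mu> (B j \<inter> E i)) sums \<mu> (B j)" .
    qed
    have 2: "(\<Sum>j. ennreal (norm (\<mu> (B j \<inter> E i)))) \<le> variation M \<mu> (E i)" for i
    proof -
      have "disjoint_family (\<lambda>j. B j \<inter> E i)" using Bd by (fastforce simp: disjoint_family_on_def)
      moreover have "(\<Union>j. B j \<inter> E i) = E i" using BU by blast
      ultimately have "(\<lambda>j. B j \<inter> E i) \<in> measurable_partitions M (E i)"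
        using Bj Ei by (auto simp: measurable_partitions_def)
      then show ?thesis unfolding variation_def by (rule SUP_upper)
    qed
    have "(\<Sum>j. ennreal (norm (\<mu> (B j)))) \<le> (\<Sum>j. \<Sum>i. ennreal (norm (\<mu> (B j \<inter> E i))))"
      by (intro suminf_le 1) auto
    also have "\<dots> = (\<Sum>i. \<Sum>j. ennreal (norm (\<mu> (B j \<inter> E i))))"
      by (rule suminf_swap_ennreal)
    also have "\<dots> \<le> (\<Sum>i. variation M \<mu> (E i))"
      by (intro suminf_le 2) auto
    finally show "(\<Sum>j. ennreal (norm (\<mu> (B j)))) \<le> (\<Sum>i. variation M \<mu> (E i))" .
  qed
qed

lemma emeasure_total_variation:
  assumes "complex_measure M \<mu>" "E \<in> sets M"
  shows "emeasure (total_variation M \<mu>) E = variation M \<mu> E"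
  unfolding total_variation_def
  using assms variation_countably_additive[OF assms(1)] variation_empty[OF assms(1)]
  by (intro emeasure_measure_of_sigma) (auto simp: positive_def sets.sigma_algebra_axioms)


section \<open>Density in \<open>L\<^sup>p\<close>\<close>

text \<open>\<open>L\<^sup>p\<close> is represented by functions instead of almost-everywhere classes, so \<open>Lp_norm\<close>
  is a seminorm; density is insensitive to this.\<close>

definition Lp_space :: "real \<Rightarrow> 'a measure \<Rightarrow> ('a \<Rightarrow> complex) set" where
  "Lp_space p M = {f \<in> borel_measurable M. integrable M (\<lambda>x. norm (f x) powr p)}"

definition Lp_norm :: "real \<Rightarrow> 'a measure \<Rightarrow> ('a \<Rightarrow> complex) \<Rightarrow> real" where
  "Lp_norm p M f = (\<integral>x. norm (f x) powr p \<partial>M) powr (1 / p)"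

definition dense_in_Lp :: "real \<Rightarrow> 'a measure \<Rightarrow> ('a \<Rightarrow> complex) set \<Rightarrow> bool" where
  "dense_in_Lp p M S \<longleftrightarrow>
     S \<subseteq> Lp_space p M \<and>
     (\<forall>f\<in>Lp_space p M. \<forall>\<epsilon>>0. \<exists>g\<in>S. Lp_norm p M (\<lambda>x. f x - g x) < \<epsilon>)"


section \<open>Spaces of exponential sums\<close>

definition expo :: "real ^ 'n \<Rightarrow> real ^ 'n \<Rightarrow> complex" where
  "expo l x = exp (- (\<i> * complex_of_real (l \<bullet> x)))"

lemma module_complex_fun: "module (\<lambda>(c::complex) (f :: 'a \<Rightarrow> complex) x. c * f x)"
  by standard (auto simp: fun_eq_iff algebra_simps)

text \<open>The unqualified \<open>span\<close> is the real span, hence the explicit complex scalar multiplication.\<close>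

definition exp_space :: "(real ^ 'n) set \<Rightarrow> (real ^ 'n \<Rightarrow> complex) set" where
  "exp_space L = module.span (\<lambda>(c::complex) f x. c * f x) (expo ` L)"

end

theory Submission
  imports Defs "HOL-Probability.Probability" "HOL-Complex_Analysis.Complex_Analysis"
begin

text \<open>
  One variable: let \<open>F\<close> be the Fourier transform of a complex measure whose tails are bounded by
  \<open>exp (- \<phi>)\<close>, where we may assume \<open>\<phi> x \<le> x\<close>, and let \<open>F\<close> vanish on a set \<open>E\<close> of positive measure that
  has positive lower density at \<open>0\<close> from the right. Cutting the measure off at \<open>T\<close> changes \<open>F\<close> by
  \<open>O(exp (- \<phi> T))\<close> on the real line and makes it entire of exponential type \<open>T\<close>; by Jensen's inequality in
  the half-plane it is \<open>O(exp (- c \<phi> T))\<close> on a segment of the imaginary axis. The bounded analytic function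
  \<open>\<Phi> z = \<integral> exp (i z x) F x / (x + i)\<^sup>2 dx\<close> (integral over \<open>x \<ge> 0\<close>) is therefore
  \<open>O(exp (- c \<phi> (t / 2)))\<close> at real \<open>t\<close>: take \<open>T = t / 2\<close> and rotate the contour to the imaginary axis. As
  \<open>\<integral> \<phi> t / (1 + t\<^sup>2) dt\<close> diverges, Jensen's inequality gives \<open>\<Phi> = 0\<close>, so \<open>F\<close> vanishes on the half-line, and
  by reflection everywhere.

  Density: it suffices to treat even exponents \<open>2 m\<close>. There, a nearest point exists by Clarkson's
  inequality, and if the distance were positive, its residual would give a nonzero density annihilating all
  exponentials. Applying the one-variable result in each coordinate turns the exponentials one by
  one into indicators of arbitrary Borel sets, which forces the density to vanish.
\<close>

section \<open>Fourier transforms in a half-plane\<close>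

text \<open>Positive measure of the zero set is too coarse for the estimate on the imaginary axis:
  the harmonic measure of \<open>E \<inter> [0, y]\<close> seen from \<open>\<i> y\<close> must stay
  bounded below as \<open>y\<close> tends to 0, and a point of lower density supplies this. Away
  from 0 the bound \<open>\<phi> x \<le> x\<close> takes over: there the decay
  \<open>exp (- T y)\<close> of the rotated kernel alone beats \<open>exp (- c \<phi> T)\<close>.
  Half of \<open>t\<close> goes to each task: one factor \<open>exp (\<i> T x)\<close> makes the
  cut-off transform bounded in the upper half-plane, the other decays along the imaginary axis.
  Dividing by \<open>(x + \<i>)\<^sup>2\<close> makes the integrals converge without a pole in the
  half-plane. For even exponents \<open>|z|^(2 m)\<close> is a power of a quadratic form, so the
  parallelogram law and the convexity of \<open>u^m\<close> give Clarkson's inequality and the first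
  variation at the nearest point. The residual \<open>h\<close> yields the density
  \<open>|h|^(2 m - 2) cnj h\<close>, which lies only in the conjugate Lebesgue space; hence the
  weight is split, and the one-variable result is applied to \<open>\<psi> / (2 m)\<close>, whose
  logarithmic integral still diverges.\<close>

lemma continuous_on_integral_dominated:
  fixes f :: "'b::metric_space \<Rightarrow> 'a \<Rightarrow> 'c::{banach, second_countable_topology}"
  assumes meas: "\<And>z. z \<in> S \<Longrightarrow> f z \<in> borel_measurable M"
    and w: "integrable M w"
    and bound: "\<And>z x. z \<in> S \<Longrightarrow> x \<in> space M \<Longrightarrow> norm (f z x) \<le> w x"
    and cont: "\<And>x. x \<in> space M \<Longrightarrow> continuous_on S (\<lambda>z. f z x)"
  shows "continuous_on S (\<lambda>z. \<integral>x. f z x \<partial>M)"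
  unfolding continuous_on_sequentially
proof (intro allI ballI impI)
  fix u a assume a: "a \<in> S" and u: "(\<forall>n. u n \<in> S) \<and> u \<longlonglongrightarrow> a"
  show "((\<lambda>z. \<integral>x. f z x \<partial>M) \<circ> u) \<longlonglongrightarrow> (\<integral>x. f a x \<partial>M)"
    unfolding comp_def
  proof (rule integral_dominated_convergence[OF _ _ w])
    show "AE x in M. (\<lambda>n. f (u n) x) \<longlonglongrightarrow> f a x"
    proof (rule AE_I2)
      fix x assume "x \<in> space M"
      from cont[OF this] a u show "(\<lambda>n. f (u n) x) \<longlonglongrightarrow> f a x"
        unfolding continuous_on_sequentially comp_def by blast
    qed
  qed (use a u meas bound in auto)
qed

lemma fourier_integral_continuous:
  fixes H :: "'a \<Rightarrow> complex" and X :: "'a \<Rightarrow> real"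
  assumes H: "integrable M H" and X [measurable]: "X \<in> borel_measurable M"
  shows "continuous_on UNIV (\<lambda>t::real. \<integral>x. exp (\<i> * t * X x) * H x \<partial>M)"
proof (rule continuous_on_integral_dominated[where w = "\<lambda>x. norm (H x)"])
  have [measurable]: "H \<in> borel_measurable M" using H by auto
  show "(\<lambda>x. exp (\<i> * complex_of_real t * X x) * H x) \<in> borel_measurable M" for t by measurable
qed (use H in \<open>auto simp: norm_mult intro!: continuous_intros\<close>)

lemma norm_exp_diff_one: "norm (exp w - 1) \<le> norm w * exp (norm w)" for w :: complex
proof -
  have "norm (exp w - 1) \<le> exp \<bar>Re w\<bar> * norm w"
    using Taylor_exp[of w 0] by simp
  also have "\<dots> \<le> exp (norm w) * norm w"
    by (intro mult_right_mono) (auto simp: abs_Re_le_cmod)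
  finally show ?thesis by (simp add: mult.commute)
qed

text \<open>\<open>X\<close> is a function on an arbitrary measure space, so that one development
  covers the cut-off measures (with \<open>X\<close> shifted to be nonnegative) and Lebesgue measure
  on the half-line. The sign of \<open>X\<close> keeps the kernel bounded by 1 in the closed upper
  half-plane.\<close>

locale half_plane_transform =
  fixes M :: "'a measure" and X :: "'a \<Rightarrow> real" and H :: "'a \<Rightarrow> complex"
  assumes H: "integrable M H" and X [measurable]: "X \<in> borel_measurable M"
    and X_nonneg: "\<And>x. x \<in> space M \<Longrightarrow> 0 \<le> X x"
begin

definition G :: "complex \<Rightarrow> complex" where
  "G z = (\<integral>x. exp (\<i> * z * X x) * H x \<partial>M)"

lemma H_measurable [measurable]: "H \<in> borel_measurable M"
  using H by auto

lemma norm_kernel: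
  assumes "0 \<le> Im z" "x \<in> space M"
  shows "norm (exp (\<i> * z * X x) * H x) \<le> norm (H x)"
proof -
  have "0 \<le> Im z * X x" using assms X_nonneg by simp
  then have "norm (exp (\<i> * z * X x)) \<le> 1" by simp
  then show ?thesis unfolding norm_mult by (rule mult_left_le_one_le[rotated 2]) auto
qed

lemma norm_G:
  assumes "0 \<le> Im z"
  shows "norm (G z) \<le> (\<integral>x. norm (H x) \<partial>M)"
  unfolding G_def
  using norm_kernel[OF assms] H
  by (intro order_trans[OF integral_norm_bound integral_mono']) auto

lemma continuous_G: "continuous_on {z. 0 \<le> Im z} G"
  unfolding G_def
proof (rule continuous_on_integral_dominated[where w = "\<lambda>x. norm (H x)"])
  show "(\<lambda>x. exp (\<i> * z * X x) * H x) \<in> borel_measurable M" for z by measurable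
qed (use H norm_kernel in \<open>auto intro!: continuous_intros\<close>)

lemma has_field_derivative_G:
  assumes z: "0 < Im z"
  shows "(G has_field_derivative (\<integral>x. \<i> * X x * exp (\<i> * z * X x) * H x \<partial>M)) (at z)"
  unfolding has_field_derivative_iff tendsto_at_iff_sequentially
proof (intro allI impI)
  fix u :: "nat \<Rightarrow> complex"
  assume ne: "\<forall>i. u i \<in> UNIV - {z}" and lim: "u \<longlonglongrightarrow> z"
  \<comment> \<open>For increments of size at most \<open>s\<close>, the difference quotient costs a
    factor \<open>X x * exp (s * X x)\<close>, while the kernel at \<open>z\<close> supplies
    \<open>exp (- 2 * s * X x)\<close>. What remains is at most \<open>1 / s\<close>, uniformly in
    \<open>x\<close>.\<close>
  define s where "s = Im z / 2"
  have s: "s > 0" using z by (simp add: s_def)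
  obtain N where N: "\<And>n. n \<ge> N \<Longrightarrow> dist (u n) z < s"
    using lim s unfolding lim_sequentially by blast
  let ?q = "\<lambda>n x. (exp (\<i> * u n * X x) * H x - exp (\<i> * z * X x) * H x) / (u n - z)"
  have int: "integrable M (\<lambda>x. exp (\<i> * w * X x) * H x)" if "0 \<le> Im w" for w
    by (rule Bochner_Integration.integrable_bound[OF H]) (use norm_kernel that in auto)
  have upos: "0 \<le> Im (u n)" if "n \<ge> N" for n
    using N[OF that] abs_Im_le_cmod[of "u n - z"] z by (simp add: dist_norm s_def)
  have lim': "(\<lambda>n. \<integral>x. ?q (n + N) x \<partial>M) \<longlonglongrightarrow> (\<integral>x. \<i> * X x * exp (\<i> * z * X x) * H x \<partial>M)"
  proof (rule integral_dominated_convergence[where w = "\<lambda>x. norm (H x) / s"])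
    show "integrable M (\<lambda>x. norm (H x) / s)" using H by auto
    show "AE x in M. (\<lambda>n. ?q (n + N) x) \<longlonglongrightarrow> \<i> * X x * exp (\<i> * z * X x) * H x"
    proof (rule AE_I2)
      fix x
      have "((\<lambda>w. exp (\<i> * w * X x) * H x) has_field_derivative \<i> * X x * exp (\<i> * z * X x) * H x) (at z)"
        by (auto intro!: derivative_eq_intros)
      then have "(\<lambda>n. ?q n x) \<longlonglongrightarrow> \<i> * X x * exp (\<i> * z * X x) * H x"
        unfolding has_field_derivative_iff tendsto_at_iff_sequentially comp_def using ne lim by blast
      then show "(\<lambda>n. ?q (n + N) x) \<longlonglongrightarrow> \<i> * X x * exp (\<i> * z * X x) * H x"
        by (rule LIMSEQ_ignore_initial_segment)
    qed
    fix n
    let ?h = "u (n + N) - z"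
    have h: "norm ?h \<le> s" "?h \<noteq> 0" using N[of "n + N"] ne by (auto simp: dist_norm)
    show "AE x in M. norm (?q (n + N) x) \<le> norm (H x) / s"
    proof (rule AE_I2)
      fix x assume x: "x \<in> space M"
      have X0: "0 \<le> X x" using X_nonneg x by simp
      have "exp (\<i> * u (n + N) * X x) * H x - exp (\<i> * z * X x) * H x
          = exp (\<i> * z * X x) * (exp (\<i> * ?h * X x) - 1) * H x"
        by (simp add: algebra_simps flip: exp_add)
      then have "norm (?q (n + N) x)
          = exp (- (Im z * X x)) * norm (exp (\<i> * ?h * X x) - 1) * norm (H x) / norm ?h"
        by (simp add: norm_mult norm_divide)
      also have "\<dots> \<le> exp (- (Im z * X x)) * (norm ?h * X x * exp (s * X x)) * norm (H x) / norm ?h"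
      proof -
        have "norm (exp (\<i> * ?h * X x) - 1) \<le> norm (\<i> * ?h * X x) * exp (norm (\<i> * ?h * X x))"
          using norm_exp_diff_one .
        also have "\<dots> \<le> norm ?h * X x * exp (s * X x)"
          using X0 h s by (auto simp: norm_mult intro!: mult_mono)
        finally show ?thesis by (intro divide_right_mono mult_right_mono mult_left_mono) auto
      qed
      also have "\<dots> = X x * exp (- (s * X x)) * norm (H x)"
        using h by (simp add: s_def field_simps flip: exp_add)
      also have "\<dots> \<le> 1 / s * norm (H x)"
      proof (intro mult_right_mono)
        have "s * X x \<le> exp (s * X x)" using exp_ge_add_one_self[of "s * X x"] by linarith
        then show "X x * exp (- (s * X x)) \<le> 1 / s"
          using s by (simp add: exp_minus field_simps)
      qed auto
      finally show "norm (?q (n + N) x) \<le> norm (H x) / s" by simp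
    qed
  qed measurable
  have "(\<integral>x. ?q (n + N) x \<partial>M) = (G (u (n + N)) - G z) / (u (n + N) - z)" for n
    unfolding G_def using int[of z] int[OF upos, of "n + N"] z by simp
  then have "(\<lambda>n. (G (u (n + N)) - G z) / (u (n + N) - z)) \<longlonglongrightarrow> (\<integral>x. \<i> * X x * exp (\<i> * z * X x) * H x \<partial>M)"
    using lim' by (simp only:)
  then show "((\<lambda>w. (G w - G z) / (w - z)) \<circ> u) \<longlonglongrightarrow> (\<integral>x. \<i> * X x * exp (\<i> * z * X x) * H x \<partial>M)"
    unfolding comp_def by (rule LIMSEQ_offset)
qed

lemma holomorphic_G: "G holomorphic_on {z. 0 < Im z}"
  using has_field_derivative_G by (auto simp: holomorphic_on_def field_differentiable_def intro: has_field_derivative_at_within)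

end

section \<open>Jensen's inequality\<close>

lemma integral_periodic_window:
  fixes U :: "real \<Rightarrow> real"
  assumes cont: "continuous_on UNIV U" and per: "\<And>t. U (t + 2 * pi) = U t" and \<theta>: "-pi \<le> \<theta>" "\<theta> \<le> pi"
  shows "integral {\<theta>..\<theta> + 2 * pi} U = integral {-pi..pi} U"
proof -
  have int: "U integrable_on {a..b}" for a b
    by (intro integrable_continuous_real continuous_on_subset[OF cont]) auto
  have "integral {-pi..\<theta>} (U \<circ> (\<lambda>x. x + 2 * pi)) = integral {-pi + 2 * pi..\<theta> + 2 * pi} U"
    by (intro integral_shift continuous_on_subset[OF cont]) auto
  then have shift: "integral {-pi..\<theta>} U = integral {pi..\<theta> + 2 * pi} U"
    by (simp add: comp_def per)
  have "integral {-pi..\<theta>} U + integral {\<theta>..pi} U = integral {-pi..pi} U"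
       "integral {\<theta>..pi} U + integral {pi..\<theta> + 2 * pi} U = integral {\<theta>..\<theta> + 2 * pi} U"
    using \<theta> by (intro Henstock_Kurzweil_Integration.integral_combine int; simp)+
  with shift show ?thesis by simp
qed

text \<open>By uniform continuity one step size serves all starting angles: on each subinterval
  \<open>U\<close> stays above its left value minus \<open>\<eta>\<close>. A single \<open>n\<close>
  for every \<open>\<theta>\<close> is what the maximum principle on a whole circle asks
  for.\<close>

lemma periodic_riemann_sum:
  fixes U :: "real \<Rightarrow> real"
  assumes cont: "continuous_on UNIV U" and per: "\<And>t. U (t + 2 * pi) = U t" and \<eta>: "\<eta> > 0"
  obtains n :: nat where "n > 0"
    "\<And>\<theta>. -pi \<le> \<theta> \<Longrightarrow> \<theta> \<le> pi \<Longrightarrow>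
       (\<Sum>j<n. U (\<theta> + 2 * pi * j / n)) \<le> n * (integral {-pi..pi} U / (2 * pi) + \<eta>)"
proof -
  have int: "U integrable_on {a..b}" for a b
    by (intro integrable_continuous_real continuous_on_subset[OF cont]) auto
  have "uniformly_continuous_on {-pi..3*pi} U"
    by (intro compact_uniformly_continuous continuous_on_subset[OF cont]) auto
  then obtain d where d: "d > 0"
    "\<And>s t. s \<in> {-pi..3*pi} \<Longrightarrow> t \<in> {-pi..3*pi} \<Longrightarrow> dist s t < d \<Longrightarrow> dist (U s) (U t) < \<eta>"
    unfolding uniformly_continuous_on_def using \<eta> by metis
  obtain n :: nat where n: "real n > 2 * pi / d" using reals_Archimedean2 by blast
  have n0: "n > 0" using n d(1) pi_gt_zero by (cases n) (auto simp: field_simps)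
  define h where "h = 2 * pi / n"
  have h: "h > 0" "h < d" "n * h = 2 * pi"
    using n n0 d(1) by (auto simp: h_def field_simps)
  have "(\<Sum>j<n. U (\<theta> + 2 * pi * j / n)) \<le> n * (integral {-pi..pi} U / (2 * pi) + \<eta>)"
    if \<theta>: "-pi \<le> \<theta>" "\<theta> \<le> pi" for \<theta>
  proof -
    have step: "h * (U (\<theta> + j * h) - \<eta>) \<le> integral {\<theta> + j * h..\<theta> + Suc j * h} U" if "j < n" for j
    proof -
      have jh: "0 \<le> j * h" "0 \<le> h * j" "Suc j * h \<le> 2 * pi"
        using that h mult_right_mono[of "real (Suc j)" "real n" h] by auto
      have "h * (U (\<theta> + j * h) - \<eta>) = integral {\<theta> + j * h..\<theta> + Suc j * h} (\<lambda>_. U (\<theta> + j * h) - \<eta>)"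
        using h by (simp add: algebra_simps)
      also have "\<dots> \<le> integral {\<theta> + j * h..\<theta> + Suc j * h} U"
      proof (rule integral_le)
        fix t assume t: "t \<in> {\<theta> + j * h..\<theta> + Suc j * h}"
        have "dist (U (\<theta> + j * h)) (U t) < \<eta>"
        proof (rule d(2))
          show "\<theta> + j * h \<in> {-pi..3*pi}" "t \<in> {-pi..3*pi}"
            using t \<theta> jh unfolding atLeastAtMost_iff by linarith+
          show "dist (\<theta> + j * h) t < d"
            using t h by (auto simp: dist_real_def algebra_simps)
        qed
        then show "U (\<theta> + j * h) - \<eta> \<le> U t" by (auto simp: dist_real_def)
      qed (auto simp: int)
      finally show ?thesis .
    qed
    have "(\<Sum>j<m. integral {\<theta> + j * h..\<theta> + Suc j * h} U) = integral {\<theta>..\<theta> + m * h} U" for m :: nat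
    proof (induction m)
      case (Suc m)
      have "integral {\<theta>..\<theta> + m * h} U + integral {\<theta> + m * h..\<theta> + Suc m * h} U = integral {\<theta>..\<theta> + Suc m * h} U"
        using h by (intro Henstock_Kurzweil_Integration.integral_combine int) (auto simp: algebra_simps)
      then show ?case using Suc by simp
    qed simp
    from this[of n] have "(\<Sum>j<n. integral {\<theta> + j * h..\<theta> + Suc j * h} U) = integral {-pi..pi} U"
      using integral_periodic_window[OF cont per \<theta>] h(3) by simp
    moreover have "(\<Sum>j<n. h * (U (\<theta> + j * h) - \<eta>)) \<le> (\<Sum>j<n. integral {\<theta> + j * h..\<theta> + Suc j * h} U)"
      by (intro sum_mono step) auto
    moreover have "(\<Sum>j<n. h * (U (\<theta> + j * h) - \<eta>)) = h * (\<Sum>j<n. U (\<theta> + j * h)) - 2 * pi * \<eta>"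
      using h(3) by (simp add: sum_distrib_left sum_subtractf right_diff_distrib mult.assoc flip: h(3))
    ultimately have "h * (\<Sum>j<n. U (\<theta> + j * h)) \<le> integral {-pi..pi} U + 2 * pi * \<eta>" by simp
    then show ?thesis
      using n0 by (simp add: h_def field_simps)
  qed
  with n0 that show thesis by blast
qed

text \<open>Subharmonicity of \<open>ln |f|\<close> by an averaging trick: the product of the rotates of \<open>f\<close> by the
  \<open>n\<close>-th roots of unity obeys the maximum principle, and the logarithm of its modulus on the
  circle is a Riemann sum of the integral.\<close>

lemma jensen_inequality_circle:
  fixes f :: "complex \<Rightarrow> complex" and r e :: real
  assumes hol: "f holomorphic_on ball 0 1" and r: "0 < r" "r < 1" and e: "e > 0"
  shows "norm (f 0) \<le> exp (integral {-pi..pi} (\<lambda>t. ln (max (norm (f (r * cis t))) e)) / (2 * pi))"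
proof (cases "f 0 = 0")
  case False
  \<comment> \<open>The floor \<open>e\<close> keeps the logarithm continuous across zeros of
    \<open>f\<close>; raising small values is harmless in an upper bound.\<close>
  define U where "U = (\<lambda>t. ln (max (norm (f (r * cis t))) e))"
  have "continuous_on UNIV (\<lambda>t. f (r * cis t))"
    by (rule continuous_on_compose2[OF holomorphic_on_imp_continuous_on[OF hol]])
       (use r in \<open>auto intro!: continuous_intros simp: norm_mult\<close>)
  then have cont: "continuous_on UNIV U"
    unfolding U_def using e by (intro continuous_intros) (auto simp: max_def)
  have per: "U (t + 2 * pi) = U t" for t
    by (simp add: U_def flip: cis_mult)
  have fU: "norm (f (r * cis t)) \<le> exp (U t)" for t
    using e unfolding U_def by (subst exp_ln) auto
  have "ln (norm (f 0)) \<le> integral {-pi..pi} U / (2 * pi) + \<eta>" if \<eta>: "\<eta> > 0" for \<eta>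
  proof -
    obtain n :: nat where n: "n > 0"
      "\<And>\<theta>. -pi \<le> \<theta> \<Longrightarrow> \<theta> \<le> pi \<Longrightarrow>
         (\<Sum>j<n. U (\<theta> + 2 * pi * j / n)) \<le> n * (integral {-pi..pi} U / (2 * pi) + \<eta>)"
      using periodic_riemann_sum[OF cont per \<eta>] by blast
    define P where "P = (\<lambda>z. \<Prod>j<n. f (z * cis (2 * pi * j / n)))"
    have holP: "P holomorphic_on ball 0 1"
      unfolding P_def
      by (intro holomorphic_intros holomorphic_on_compose_gen[OF _ hol, unfolded comp_def])
         (auto simp: norm_mult)
    have "norm (P 0) \<le> exp (n * (integral {-pi..pi} U / (2 * pi) + \<eta>))"
    proof (rule maximum_modulus_frontier[where f = P and S = "cball 0 r"])
      show "P holomorphic_on interior (cball 0 r)"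
        using r by (auto intro!: holomorphic_on_subset[OF holP])
      show "continuous_on (closure (cball 0 r)) P"
        using r by (auto intro!: continuous_on_subset[OF holomorphic_on_imp_continuous_on[OF holP]])
      fix z assume "z \<in> frontier (cball 0 r :: complex set)"
      then have "norm z = r" by (simp add: frontier_cball)
      then have z: "z = r * cis (Arg z)" using r rcis_cmod_Arg[of z] by (simp add: rcis_def)
      have "norm (P z) = (\<Prod>j<n. norm (f (r * cis (Arg z + 2 * pi * j / n))))"
        unfolding P_def prod_norm[symmetric]
        by (subst z, simp add: cis_mult mult.assoc)
      also have "\<dots> \<le> (\<Prod>j<n. exp (U (Arg z + 2 * pi * j / n)))"
        by (intro prod_mono conjI fU) auto
      also have "\<dots> = exp (\<Sum>j<n. U (Arg z + 2 * pi * j / n))"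
        by (simp add: exp_sum)
      also have "\<dots> \<le> exp (n * (integral {-pi..pi} U / (2 * pi) + \<eta>))"
        using n(2)[of "Arg z"] Arg_bounded[of z] by simp
      finally show "norm (P z) \<le> exp (n * (integral {-pi..pi} U / (2 * pi) + \<eta>))" .
    qed (use r in auto)
    then have "norm (f 0) ^ n \<le> exp (n * (integral {-pi..pi} U / (2 * pi) + \<eta>))"
      by (simp add: P_def norm_power)
    then have "ln (norm (f 0) ^ n) \<le> ln (exp (n * (integral {-pi..pi} U / (2 * pi) + \<eta>)))"
      using False by (subst ln_le_cancel_iff) auto
    then have "ln (norm (f 0) ^ n) \<le> n * (integral {-pi..pi} U / (2 * pi) + \<eta>)"
      by (simp only: ln_exp)
    then show ?thesis using n(1) False by (simp add: ln_realpow)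
  qed
  then have "ln (norm (f 0)) \<le> integral {-pi..pi} U / (2 * pi)"
    by (rule field_le_epsilon)
  then show ?thesis
    using False unfolding U_def by (metis exp_le_cancel_iff exp_ln zero_less_norm_iff)
qed auto

text \<open>The Cayley map \<open>cay\<close> sends the centre of the disc to
  \<open>\<i> * y\<close> and \<open>cis t\<close> to \<open>y * tan (t / 2)\<close>, so the
  inequality on circles turns into one with the Poisson kernel at \<open>\<i> * y\<close>. Circles
  of radius below 1 are pushed to the boundary by dominated convergence; \<open>C\<close> and the
  floor \<open>e\<close> bound the logarithm on both sides.\<close>

lemma jensen_inequality_half_plane:
  fixes G :: "complex \<Rightarrow> complex" and v :: "real \<Rightarrow> real" and C y K N :: real
  assumes hol: "G holomorphic_on {z. 0 < Im z}" and cont: "continuous_on {z. 0 \<le> Im z} G"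
    and bound: "\<And>z. 0 \<le> Im z \<Longrightarrow> norm (G z) \<le> C" and C: "C > 0"
    and v [measurable]: "v \<in> borel_measurable borel"
    and v_bounds: "\<And>t. 0 \<le> t \<Longrightarrow> t \<le> K \<Longrightarrow> 0 \<le> v t \<and> v t \<le> N"
    and decay: "\<And>t. 0 \<le> t \<Longrightarrow> t \<le> K \<Longrightarrow> norm (G (of_real t)) \<le> C * exp (- v t)"
    and y: "y > 0" and K: "K \<ge> 0"
  shows "norm (G (\<i> * y)) \<le> C * exp (- (LBINT t:{0..K}. v t * (y / (y\<^sup>2 + t\<^sup>2))) / pi)"
proof -
  \<comment> \<open>Since \<open>v\<close> is at most \<open>N\<close> on the interval, this floor
    never exceeds the decay majorant \<open>C * exp (- v t)\<close>, and it never exceeds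
    \<open>C\<close>; so it can be inserted into every boundary bound.\<close>
  define e where "e = C * exp (- N)"
  have e: "e > 0" "e \<le> C"
    using C v_bounds[of 0] K by (auto simp: e_def)
  define cay where "cay = (\<lambda>\<zeta>::complex. \<i> * y * (1 - \<zeta>) / (1 + \<zeta>))"
  have Im_cay: "Im (cay \<zeta>) = y * (1 - (norm \<zeta>)\<^sup>2) / (norm (1 + \<zeta>))\<^sup>2" if "1 + \<zeta> \<noteq> 0" for \<zeta>
    unfolding cay_def cmod_power2 by (simp add: Im_divide power2_eq_square algebra_simps)
  have ball: "0 < Im (cay \<zeta>)" "1 + \<zeta> \<noteq> 0" if "norm \<zeta> < 1" for \<zeta>
  proof -
    show nz: "1 + \<zeta> \<noteq> 0" using that by (metis add.inverse_unique norm_minus_cancel norm_one order_less_irrefl)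
    then show "0 < Im (cay \<zeta>)" using that y
      by (simp add: Im_cay power_less_one_iff abs_square_less_1)
  qed
  define f where "f = (\<lambda>\<zeta>. G (cay \<zeta>))"
  have holf: "f holomorphic_on ball 0 1"
    unfolding f_def
  proof (rule holomorphic_on_compose_gen[OF _ hol, unfolded comp_def])
    show "cay holomorphic_on ball 0 1"
      unfolding cay_def by (intro holomorphic_intros) (use ball(2) in auto)
  qed (use ball(1) in auto)
  \<comment> \<open>The angle sent to \<open>K\<close>. It stays below \<open>pi\<close>, which
    corresponds to the point at infinity; there no boundary value is available, hence the open
    interval of angles below.\<close>
  define b where "b = 2 * arctan (K / y)"
  have b: "0 \<le> b" "b < pi" using K y arctan_ubound[of "K / y"] by (auto simp: b_def)
  define L where "L = (\<lambda>t. ln (max (norm (G (of_real (y * tan (t / 2))))) e))"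
  define r :: "nat \<Rightarrow> real" where "r = (\<lambda>k. 1 - 1 / (real k + 2))"
  have r: "0 < r k" "r k < 1" for k by (auto simp: r_def field_simps)
  have rlim: "r \<longlonglongrightarrow> 1" unfolding r_def by real_asymp
  define q where "q = (\<lambda>k t. ln (max (norm (f (r k * cis t))) e))"
  have qint: "q k integrable_on {-pi<..<pi}" for k
  proof -
    have "continuous_on UNIV (\<lambda>t. f (r k * cis t))"
      by (rule continuous_on_compose2[OF holomorphic_on_imp_continuous_on[OF holf]])
         (use r[of k] in \<open>auto intro!: continuous_intros simp: norm_mult\<close>)
    then have "continuous_on UNIV (q k)"
      unfolding q_def using e by (intro continuous_intros) (auto simp: max_def)
    then have "q k integrable_on {-pi..pi}"
      by (rule integrable_continuous_real[OF continuous_on_subset]) auto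
    then show ?thesis by (simp add: integrable_on_open_interval_real)
  qed
  have qbound: "norm (q k t) \<le> \<bar>ln C\<bar> + \<bar>ln e\<bar>" for k t
  proof -
    have "norm (r k * cis t) < 1" using r[of k] by (simp add: norm_mult)
    then have "norm (f (r k * cis t)) \<le> C"
      unfolding f_def using ball(1) bound less_imp_le by blast
    then have "q k t \<le> ln C" "ln e \<le> q k t"
      using e by (auto simp: q_def)
    then show ?thesis by auto
  qed
  have qlim: "(\<lambda>k. q k t) \<longlonglongrightarrow> L t" if t: "t \<in> {-pi<..<pi}" for t
  proof -
    have c: "cos (t / 2) > 0" using t by (intro cos_gt_zero_pi) auto
    have tt: "cis t = cis (t / 2) * cis (t / 2)" by (simp add: cis_mult)
    have p1: "1 + cis t = 2 * cos (t / 2) * cis (t / 2)"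
    proof -
      have "cis (t/2) * (cis (t/2) + cnj (cis (t/2))) = cis t + 1"
        unfolding ring_distribs tt[symmetric] by (simp add: cis_cnj cis_mult)
      then show ?thesis by (simp add: complex_add_cnj mult_ac)
    qed
    have m1: "1 - cis t = - 2 * \<i> * sin (t / 2) * cis (t / 2)"
    proof -
      have "cis (t/2) * (cis (t/2) - cnj (cis (t/2))) = cis t - 1"
        unfolding ring_distribs tt[symmetric] by (simp add: cis_cnj cis_mult right_diff_distrib)
      then show ?thesis by (simp add: complex_diff_cnj mult_ac)
    qed
    have ne: "1 + cis t \<noteq> 0" using c by (simp add: p1)
    have cayt: "cay (cis t) = of_real (y * tan (t / 2))"
      unfolding cay_def p1 m1 using c by (simp add: tan_def field_simps)
    have "(\<lambda>k. cay (r k * cis t)) \<longlonglongrightarrow> cay (1 * cis t)"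
      unfolding cay_def using rlim ne
      by (intro tendsto_intros) (auto intro!: tendsto_eq_intros)
    then have "(\<lambda>k. cay (r k * cis t)) \<longlonglongrightarrow> of_real (y * tan (t / 2))" by (simp add: cayt)
    moreover have "0 \<le> Im (cay (r k * cis t))" for k
      using ball(1)[of "r k * cis t"] r[of k] by (simp add: norm_mult)
    ultimately have "(\<lambda>k. G (cay (r k * cis t))) \<longlonglongrightarrow> G (of_real (y * tan (t / 2)))"
      using continuous_on_tendsto_compose[OF cont, of "\<lambda>k. cay (r k * cis t)" _ sequentially] by simp
    then show ?thesis
      unfolding q_def L_def f_def using e by (intro tendsto_intros) (auto simp: max_def)
  qed
  have lim: "L integrable_on {-pi<..<pi}"
    "(\<lambda>k. integral {-pi<..<pi} (q k)) \<longlonglongrightarrow> integral {-pi<..<pi} L"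
    by (rule dominated_convergence[where f = q and h = "\<lambda>_. \<bar>ln C\<bar> + \<bar>ln e\<bar>"];
        use qint qbound qlim in \<open>auto simp: integrable_on_open_interval_real\<close>)+
  have "norm (G (\<i> * y)) \<le> exp (integral {-pi<..<pi} L / (2 * pi))"
  proof (rule LIMSEQ_le_const)
    show "(\<lambda>k. exp (integral {-pi<..<pi} (q k) / (2 * pi))) \<longlonglongrightarrow> exp (integral {-pi<..<pi} L / (2 * pi))"
      using lim(2) by (intro tendsto_intros) auto
    have "norm (f 0) \<le> exp (integral {-pi<..<pi} (q k) / (2 * pi))" for k
      using jensen_inequality_circle[OF holf r(1)[of k] r(2)[of k] e(1)]
      by (simp add: q_def integral_open_interval_real)
    then show "\<exists>N. \<forall>k\<ge>N. norm (G (\<i> * y)) \<le> exp (integral {-pi<..<pi} (q k) / (2 * pi))"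
      by (simp add: f_def cay_def)
  qed
  also have "\<dots> \<le> exp ((2 * pi * ln C - (LBINT t:{0..b}. v (y * tan (t / 2)))) / (2 * pi))"
  proof -
    \<comment> \<open>The logarithm of the boundary majorant: the decay is used on the arc over
      \<open>[0, K]\<close>, the global bound \<open>C\<close> elsewhere.\<close>
    define R where "R = (\<lambda>t. ln C - indicator {0..b} t * v (y * tan (t / 2)))"
    have tanb: "0 \<le> y * tan (t / 2)" "y * tan (t / 2) \<le> K" if "t \<in> {0..b}" for t
    proof -
      show "0 \<le> y * tan (t / 2)"
        using that b y by (intro mult_nonneg_nonneg tan_pos_pi2_le) auto
      have "tan (t / 2) \<le> tan (arctan (K / y))"
        using that b by (intro tan_mono_le) (auto simp: b_def arctan_ubound)
      then show "y * tan (t / 2) \<le> K" using y by (simp add: tan_arctan field_simps)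
    qed
    have vm [measurable]: "(\<lambda>t. v (y * tan (t / 2))) \<in> borel_measurable borel"
      unfolding tan_def by measurable
    have set0: "set_integrable lborel {0..b} (\<lambda>t. v (y * tan (t / 2)))"
      unfolding set_integrable_def
    proof (rule integrableI_bounded_set_indicator[where B = N])
      show "emeasure lborel {0..b} < \<infinity>" by (simp add: b)
      show "AE t\<in>{0..b} in lborel. norm (v (y * tan (t / 2))) \<le> N"
        using v_bounds tanb by auto
    qed auto
    have I: "integrable lborel (\<lambda>t. indicator {-pi..pi} t * ln C)"
      by (intro integrable_mult_left integrable_real_indicator) auto
    have eq: "indicator {-pi..pi} t *\<^sub>R R t
        = indicator {-pi..pi} t * ln C - indicator {0..b} t *\<^sub>R v (y * tan (t / 2))" for t
      using b by (auto simp: R_def indicator_def)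
    have setR: "set_integrable lborel {-pi..pi} R"
      using I set0 unfolding set_integrable_def eq by (rule Bochner_Integration.integrable_diff)
    have "integral {-pi..pi} R = (LBINT t:{-pi..pi}. R t)"
      using set_borel_integral_eq_integral(2)[OF setR] by simp
    also have "\<dots> = 2 * pi * ln C - (LBINT t:{0..b}. v (y * tan (t / 2)))"
      using I set0 unfolding set_lebesgue_integral_def eq set_integrable_def by simp
    finally have intR: "integral {-pi..pi} R = 2 * pi * ln C - (LBINT t:{0..b}. v (y * tan (t / 2)))" .
    have "integral {-pi<..<pi} L \<le> integral {-pi<..<pi} R"
    proof (rule integral_le)
      show "R integrable_on {-pi<..<pi}"
        using set_borel_integral_eq_integral(1)[OF setR] by (simp add: integrable_on_open_interval_real)
      fix t
      show "L t \<le> R t"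
      proof (cases "t \<in> {0..b}")
        case True
        then have "norm (G (of_real (y * tan (t / 2)))) \<le> C * exp (- v (y * tan (t / 2)))"
          by (intro decay tanb)
        moreover have "e \<le> C * exp (- v (y * tan (t / 2)))"
          using v_bounds[OF tanb[OF True]] C by (simp add: e_def)
        ultimately have "L t \<le> ln (C * exp (- v (y * tan (t / 2))))"
          unfolding L_def using e by (subst ln_le_cancel_iff) auto
        then show ?thesis using True C by (simp add: R_def ln_mult)
      next
        case False
        then show ?thesis using e C bound[of "of_real (y * tan (t / 2))"]
          by (simp add: R_def L_def)
      qed
    qed (fact lim(1))
    then show ?thesis
      using intR by (simp add: integral_open_interval_real divide_right_mono)
  qed
  \<comment> \<open>With \<open>s = y * tan (t / 2)\<close>, the angle element \<open>dt\<close>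
    becomes \<open>2 * y / (y^2 + s^2) ds\<close>.\<close>
  also have "(LBINT t:{0..b}. v (y * tan (t / 2))) = 2 * (LBINT t:{0..K}. v t * (y / (y\<^sup>2 + t\<^sup>2)))"
  proof -
    have cosp: "cos (t / 2) \<noteq> 0" if "t \<in> {0..b}" for t
      using that b cos_gt_zero_pi[of "t / 2"] by auto
    let ?g = "\<lambda>t. y * tan (t / 2)" and ?g' = "\<lambda>t. y / 2 * (1 + (tan (t / 2))\<^sup>2)"
    have gb: "?g 0 = 0" "?g b = K" using y by (auto simp: b_def tan_arctan)
    have "(LBINT t. v t * (y / (y\<^sup>2 + t\<^sup>2)) * indicator {?g 0..?g b} t)
        = (LBINT t. v (?g t) * (y / (y\<^sup>2 + (?g t)\<^sup>2)) * ?g' t * indicator {0..b} t)"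
    proof (rule integral_substitution)
      show "continuous_on {0..b} ?g'"
        using cosp by (intro continuous_intros) auto
      show "(?g has_real_derivative ?g' t) (at t)" if "t \<in> {0..b}" for t
      proof -
        have "(?g has_real_derivative y * (inverse ((cos (t / 2))\<^sup>2) * (1 / 2))) (at t)"
          by (rule DERIV_cmult, rule DERIV_chain2[of tan _ "\<lambda>t. t / 2", OF DERIV_tan[OF cosp[OF that]]])
             (auto intro!: derivative_eq_intros)
        then show ?thesis using tan_sec[OF cosp[OF that]] by (simp add: power_inverse)
      qed
      show "set_integrable lborel {?g 0..?g b} (\<lambda>t. v t * (y / (y\<^sup>2 + t\<^sup>2)))"
        unfolding gb set_integrable_def
      proof (rule integrableI_bounded_set_indicator[where B = "N * (1 / y)"])
        have "norm (v t * (y / (y\<^sup>2 + t\<^sup>2))) \<le> N * (1 / y)" if "t \<in> {0..K}" for t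
        proof -
          have "y / (y\<^sup>2 + t\<^sup>2) \<le> y / y\<^sup>2"
            using y by (intro divide_left_mono) (auto intro!: mult_pos_pos add_pos_nonneg)
          then have "y / (y\<^sup>2 + t\<^sup>2) \<le> 1 / y" using y by (simp add: power2_eq_square)
          then show ?thesis
            unfolding norm_mult using v_bounds[of t] that y by (intro mult_mono) auto
        qed
        then show "AE t\<in>{0..K} in lborel. norm (v t * (y / (y\<^sup>2 + t\<^sup>2))) \<le> N * (1 / y)" by auto
        show "emeasure lborel {0..K} < \<infinity>" by (simp add: K)
      qed auto
    qed (use y b in auto)
    also have "(\<lambda>t. v (?g t) * (y / (y\<^sup>2 + (?g t)\<^sup>2)) * ?g' t * indicator {0..b} t)
        = (\<lambda>t. v (?g t) / 2 * indicator {0..b} t)"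
    proof
      fix t
      have "v (?g t) * (y / (y\<^sup>2 + (?g t)\<^sup>2)) * ?g' t = v (?g t) / 2"
      proof -
        have "1 + (tan (t / 2))\<^sup>2 \<noteq> 0" using zero_le_power2[of "tan (t / 2)"] by linarith
        moreover have yg: "y\<^sup>2 + (?g t)\<^sup>2 = y\<^sup>2 * (1 + (tan (t / 2))\<^sup>2)" by (simp add: algebra_simps power_mult_distrib)
        ultimately show ?thesis using y unfolding yg
          by (simp del: distrib_left_numeral add: power2_eq_square)
      qed
      then show "v (?g t) * (y / (y\<^sup>2 + (?g t)\<^sup>2)) * ?g' t * indicator {0..b} t = v (?g t) / 2 * indicator {0..b} t"
        by (simp only:)
    qed
    finally show ?thesis
      unfolding gb set_lebesgue_integral_def by (simp add: mult_ac)
  qed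
  also have "exp ((2 * pi * ln C - 2 * (LBINT t:{0..K}. v t * (y / (y\<^sup>2 + t\<^sup>2)))) / (2 * pi))
     = C * exp (- (LBINT t:{0..K}. v t * (y / (y\<^sup>2 + t\<^sup>2))) / pi)"
  proof -
    have "(2 * pi * ln C - 2 * I) / (2 * pi) = ln C + - I / pi" for I
      by (simp add: field_simps)
    then show ?thesis using C by (simp only: exp_add exp_ln)
  qed
  finally show ?thesis .
qed

section \<open>Uniqueness of Fourier transforms\<close>

text \<open>The transform at \<open>t = 0\<close> shows that the positive and negative parts of
  \<open>g\<close> have the same mass. Normalised by it, their images under \<open>X\<close> are
  probability measures with equal characteristic functions, so they coincide by Levy's theorem. Mass
  0 is treated apart.\<close>

lemma real_transform_uniqueness:
  fixes g :: "'a \<Rightarrow> real" and X :: "'a \<Rightarrow> real"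
  assumes g: "integrable M g" and X [measurable]: "X \<in> borel_measurable M"
    and zero: "\<And>t::real. (\<integral>x. exp (\<i> * t * X x) * complex_of_real (g x) \<partial>M) = 0"
    and A: "A \<in> sets borel"
  shows "(\<integral>x. indicator A (X x) * g x \<partial>M) = 0"
proof -
  have [measurable]: "g \<in> borel_measurable M" "A \<in> sets borel" using g A by auto
  define gp where "gp = (\<lambda>x. max (g x) 0)"
  define gm where "gm = (\<lambda>x. max (- g x) 0)"
  have gpm: "integrable M gp" "integrable M gm" "g x = gp x - gm x" "0 \<le> gp x" "0 \<le> gm x" for x
    using g by (auto simp: gp_def gm_def)
  note [measurable] = borel_measurable_integrable[OF gpm(1)] borel_measurable_integrable[OF gpm(2)]
  define m where "m = (\<integral>x. gp x \<partial>M)"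
  have "(\<integral>x. complex_of_real (g x) \<partial>M) = 0" using zero[of 0] by simp
  then have "(\<integral>x. g x \<partial>M) = 0"
    unfolding integral_complex_of_real by simp
  then have m2: "m = (\<integral>x. gm x \<partial>M)" using gpm(1,2) unfolding gpm(3) m_def by simp
  have int_ind: "integrable M (\<lambda>x. indicator A (X x) * h x)" if "integrable M h" for h :: "'a \<Rightarrow> real"
    using that by (rule Bochner_Integration.integrable_bound) (use that in \<open>auto simp: indicator_def\<close>)
  show ?thesis
  proof (cases "m = 0")
    case True
    have "AE x in M. gp x = 0" "AE x in M. gm x = 0"
      using integral_nonneg_eq_0_iff_AE[OF gpm(1)] integral_nonneg_eq_0_iff_AE[OF gpm(2)] gpm(4,5) True m_def m2
      by auto
    then have "AE x in M. indicator A (X x) * g x = 0" by eventually_elim (simp add: gpm(3))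
    then show ?thesis by (subst integral_cong_AE[where g = "\<lambda>_. 0"]) auto
  next
    case False
    then have m: "m > 0" unfolding m_def using gpm(4) by (simp add: less_le)
    have dens: "real_distribution (distr (density M (\<lambda>x. h x / m)) borel X)
       \<and> char (distr (density M (\<lambda>x. h x / m)) borel X) t = (\<integral>x. exp (\<i> * t * X x) * h x \<partial>M) / m
       \<and> measure (distr (density M (\<lambda>x. h x / m)) borel X) A = (\<integral>x. indicator A (X x) * h x \<partial>M) / m"
      if h: "integrable M h" "\<And>x. 0 \<le> h x" "(\<integral>x. h x \<partial>M) = m" for h t
    proof -
      have [measurable]: "h \<in> borel_measurable M" using h by auto
      have "prob_space (density M (\<lambda>x. h x / m))"
      proof
        have "emeasure (density M (\<lambda>x. h x / m)) (space M) = (\<integral>\<^sup>+x. ennreal (h x / m) \<partial>M)"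
          by (subst emeasure_density) (auto intro!: nn_integral_cong simp: indicator_def)
        also have "\<dots> = ennreal (\<integral>x. h x / m \<partial>M)"
          using h m by (intro nn_integral_eq_integral) auto
        finally show "emeasure (density M (\<lambda>x. h x / m)) (space (density M (\<lambda>x. h x / m))) = 1"
          using h m by simp
      qed
      then have "prob_space (distr (density M (\<lambda>x. h x / m)) borel X)"
        by (intro prob_space.prob_space_distr) auto
      then have 1: "real_distribution (distr (density M (\<lambda>x. h x / m)) borel X)"
        by (intro real_distribution.intro real_distribution_axioms.intro) auto
      have 2: "char (distr (density M (\<lambda>x. h x / m)) borel X) t = (\<integral>x. exp (\<i> * t * X x) * h x \<partial>M) / m"
        using h m by (simp add: char_def integral_distr integral_density scaleR_conv_of_real mult_ac)
      have "measure (distr (density M (\<lambda>x. h x / m)) borel X) A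
          = (\<integral>z. indicator A z \<partial>distr (density M (\<lambda>x. h x / m)) borel X)"
        by simp
      also have "\<dots> = (\<integral>x. indicator A (X x) * h x \<partial>M) / m"
        using h m by (subst integral_distr) (auto simp: integral_density mult_ac)
      finally show ?thesis using 1 2 by blast
    qed
    note dp = dens[OF gpm(1) gpm(4) m_def[symmetric]] and dm = dens[OF gpm(2) gpm(5) m2[symmetric]]
    have int_exp: "integrable M (\<lambda>x. exp (\<i> * t * X x) * complex_of_real (h x))" if "integrable M h" for h :: "'a \<Rightarrow> real" and t :: real
      using that by (rule Bochner_Integration.integrable_bound) (use that in \<open>auto simp: norm_mult\<close>)
    have "(\<integral>x. exp (\<i> * t * X x) * gp x \<partial>M) = (\<integral>x. exp (\<i> * t * X x) * gm x \<partial>M)" for t :: real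
      using zero[of t] int_exp[OF gpm(1), of t] int_exp[OF gpm(2), of t] unfolding gpm(3)
      by (simp add: right_diff_distrib)
    then have "distr (density M (\<lambda>x. gp x / m)) borel X = distr (density M (\<lambda>x. gm x / m)) borel X"
      using dp dm by (intro Levy_uniqueness) (auto simp: fun_eq_iff)
    then have "(\<integral>x. indicator A (X x) * gp x \<partial>M) = (\<integral>x. indicator A (X x) * gm x \<partial>M)"
      using dp dm m by auto
    then show ?thesis
      using int_ind gpm(1,2) unfolding gpm(3) by (simp add: right_diff_distrib)
  qed
qed

text \<open>Conjugation turns the transform of \<open>H\<close> at \<open>- t\<close> into that of
  \<open>cnj H\<close> at \<open>t\<close>. Thus both vanish for all \<open>t\<close>, and so do the
  transforms of the real and imaginary parts.\<close>

lemma fourier_uniqueness: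
  fixes H :: "'a \<Rightarrow> complex" and X :: "'a \<Rightarrow> real"
  assumes H: "integrable M H" and X [measurable]: "X \<in> borel_measurable M"
    and zero: "\<And>t::real. (\<integral>x. exp (\<i> * t * X x) * H x \<partial>M) = 0"
    and A: "A \<in> sets borel"
  shows "(\<integral>x. indicator A (X x) * H x \<partial>M) = 0"
proof -
  have [measurable]: "H \<in> borel_measurable M" "A \<in> sets borel" using H A by auto
  have int_exp: "integrable M (\<lambda>x. exp (\<i> * t * X x) * h x)" if "integrable M h" for h :: "'a \<Rightarrow> complex" and t :: real
    using that by (rule Bochner_Integration.integrable_bound) (use that in \<open>auto simp: norm_mult\<close>)
  have zero': "(\<integral>x. exp (\<i> * t * X x) * cnj (H x) \<partial>M) = 0" for t :: real
  proof -
    have "(\<integral>x. exp (\<i> * t * X x) * cnj (H x) \<partial>M) = (\<integral>x. cnj (exp (\<i> * (- t) * X x) * H x) \<partial>M)"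
      by (simp add: exp_cnj)
    also have "\<dots> = 0" using zero[of "- t"] by (simp only: Bochner_Integration.integral_cnj) simp
    finally show ?thesis .
  qed
  have H': "integrable M (\<lambda>x. cnj (H x))" using H by simp
  have Re: "(\<integral>x. indicator A (X x) * Re (H x) \<partial>M) = 0"
  proof (rule real_transform_uniqueness[OF _ X _ A])
    show "(\<integral>x. exp (\<i> * t * X x) * complex_of_real (Re (H x)) \<partial>M) = 0" for t :: real
    proof -
      have "(\<integral>x. exp (\<i> * t * X x) * complex_of_real (Re (H x)) \<partial>M)
        = (\<integral>x. (exp (\<i> * t * X x) * H x + exp (\<i> * t * X x) * cnj (H x)) / 2 \<partial>M)"
        by (intro Bochner_Integration.integral_cong) (auto simp: complex_add_cnj simp flip: distrib_left)
      then show ?thesis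
        using zero[of t] zero'[of t] int_exp[OF H, of t] int_exp[OF H', of t] by simp
    qed
  qed (use H in auto)
  have Im: "(\<integral>x. indicator A (X x) * Im (H x) \<partial>M) = 0"
  proof (rule real_transform_uniqueness[OF _ X _ A])
    show "(\<integral>x. exp (\<i> * t * X x) * complex_of_real (Im (H x)) \<partial>M) = 0" for t :: real
    proof -
      have "(\<integral>x. exp (\<i> * t * X x) * complex_of_real (Im (H x)) \<partial>M)
        = (\<integral>x. (exp (\<i> * t * X x) * H x - exp (\<i> * t * X x) * cnj (H x)) / (2 * \<i>) \<partial>M)"
      proof (intro Bochner_Integration.integral_cong refl)
        show "exp (\<i> * t * X x) * complex_of_real (Im (H x))
          = (exp (\<i> * t * X x) * H x - exp (\<i> * t * X x) * cnj (H x)) / (2 * \<i>)" for x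
          unfolding right_diff_distrib[symmetric] complex_diff_cnj by (simp add: field_simps)
      qed
      then show ?thesis
        using zero[of t] zero'[of t] int_exp[OF H, of t] int_exp[OF H', of t] by simp
    qed
  qed (use H in auto)
  have int: "integrable M (\<lambda>x. indicator A (X x) * H x)"
    using H by (rule Bochner_Integration.integrable_bound) (auto simp: norm_mult indicator_def)
  have ind: "Re (indicator A u * w) = indicator A u * Re w" "Im (indicator A u * w) = indicator A u * Im w" for u w
    by (auto simp: indicator_def)
  show ?thesis
    using integral_Re[OF int, symmetric] integral_Im[OF int, symmetric] Re Im
    by (simp only: ind complex_eq_iff zero_complex.sel)
qed

lemma AE_zero_of_set_integrals:
  fixes H :: "'a \<Rightarrow> complex"
  assumes H: "integrable M H" and zero: "\<And>A. A \<in> sets M \<Longrightarrow> (\<integral>x. indicator A x * H x \<partial>M) = 0"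
  shows "AE x in M. H x = 0"
proof -
  have int: "integrable M (\<lambda>x. indicator A x * H x)" if [measurable]: "A \<in> sets M" for A
    using H by (rule Bochner_Integration.integrable_bound)
      (use H in \<open>auto simp: norm_mult indicator_def\<close>)
  have ind: "Re (indicator A u * w) = indicator A u * Re w" "Im (indicator A u * w) = indicator A u * Im w"
    for A and u :: 'a and w
    by (auto simp: indicator_def)
  have "(\<integral>x. indicator A x * Re (H x) \<partial>M) = 0" "(\<integral>x. indicator A x * Im (H x) \<partial>M) = 0" if "A \<in> sets M" for A
    using integral_Re[OF int[OF that]] integral_Im[OF int[OF that]] unfolding ind zero[OF that] by simp_all
  then have "AE x in M. Re (H x) = 0" "AE x in M. Im (H x) = 0"
    using H by (auto intro!: density_unique_real simp: set_lebesgue_integral_def)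
  then show ?thesis by eventually_elim (simp add: complex_eq_iff)
qed

text \<open>A nonzero value at \<open>t\<close> would persist on an interval to the right of
  \<open>t\<close>. Looking only to the right includes the endpoint 0.\<close>

lemma continuous_eq_0_AE_half_line:
  fixes F :: "real \<Rightarrow> complex"
  assumes cont: "continuous_on UNIV F" and ae: "AE x in lborel. 0 \<le> x \<longrightarrow> F x = 0" and t: "0 \<le> t"
  shows "F t = 0"
proof (rule ccontr)
  assume "F t \<noteq> 0"
  moreover have "isCont F t" using cont by (simp add: continuous_on_eq_continuous_at)
  ultimately obtain d where d: "d > 0" "\<And>x. dist t x < d \<Longrightarrow> F x \<noteq> 0"
    using continuous_at_avoid[of t F 0] by auto
  have "AE x in lborel. x \<notin> {t<..<t + d}"
    using ae by eventually_elim (use d t in \<open>auto simp: dist_real_def\<close>)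
  then have "emeasure lborel {t<..<t + d} = 0"
    by (subst (asm) AE_iff_measurable[where N = "{t<..<t + d}"]) auto
  then show False using d(1) by simp
qed

section \<open>Contour rotation\<close>

lemma set_integral_Icc_tendsto:
  fixes f :: "real \<Rightarrow> 'a::{banach, second_countable_topology}"
  assumes f: "set_integrable lborel {0..} f"
  shows "(\<lambda>n. LBINT x:{0..real n}. f x) \<longlonglongrightarrow> (LBINT x:{0..}. f x)"
  unfolding set_lebesgue_integral_def
proof (rule integral_dominated_convergence)
  show "integrable lborel (\<lambda>x. norm (indicat_real {0..} x *\<^sub>R f x))"
    using f unfolding set_integrable_def by (rule integrable_norm)
  show "(\<lambda>x. indicat_real {0..} x *\<^sub>R f x) \<in> borel_measurable lborel"
    using f unfolding set_integrable_def by auto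
  show "(\<lambda>x. indicat_real {0..real n} x *\<^sub>R f x) \<in> borel_measurable lborel" for n
    using set_integrable_subset[OF f, of "{0..real n}"] unfolding set_integrable_def by auto
  show "AE x in lborel. (\<lambda>n. indicat_real {0..real n} x *\<^sub>R f x) \<longlonglongrightarrow> indicat_real {0..} x *\<^sub>R f x"
  proof (rule AE_I2)
    fix x :: real
    obtain N where "x \<le> real N" using real_arch_simple by blast
    then have "\<forall>n\<ge>N. indicat_real {0..real n} x *\<^sub>R f x = indicat_real {0..} x *\<^sub>R f x"
      by (auto simp: indicator_def)
    then show "(\<lambda>n. indicat_real {0..real n} x *\<^sub>R f x) \<longlonglongrightarrow> indicat_real {0..} x *\<^sub>R f x"
      by (intro tendsto_eventually) (auto simp: eventually_sequentially)
  qed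
qed (auto simp: indicator_def)

text \<open>Cauchy's theorem on the triangle with vertices \<open>0\<close>, \<open>R\<close>,
  \<open>\<i> * R\<close>. On the hypotenuse \<open>|z|^2\<close> is at least
  \<open>R^2 / 2\<close>, its value at the midpoint, so a segment of length at most
  \<open>2 * R\<close> contributes at most \<open>4 * C / R\<close>. On the imaginary side
  \<open>1 / (1 + y)^2\<close> has integral at most 1, which gives exactly \<open>B\<close>.\<close>

lemma quadrant_rotation_bound:
  fixes Q :: "complex \<Rightarrow> complex" and B C :: real
  assumes cont: "continuous_on {z. 0 \<le> Re z \<and> 0 \<le> Im z} Q"
    and hol: "Q holomorphic_on {z. 0 < Re z \<and> 0 < Im z}"
    and bound: "\<And>z. 0 \<le> Re z \<Longrightarrow> 0 \<le> Im z \<Longrightarrow> norm (Q z) \<le> C / (norm (z + \<i>))\<^sup>2"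
    and axis: "\<And>y. 0 \<le> y \<Longrightarrow> norm (Q (\<i> * of_real y)) \<le> B / (1 + y)\<^sup>2"
  shows "norm (LBINT x:{0..}. Q (of_real x)) \<le> B"
proof -
  let ?S = "{z. 0 \<le> Re z \<and> 0 \<le> Im z}"
  have B0: "0 \<le> B" using order_trans[OF norm_ge_zero axis[of 0]] by simp
  have C0: "0 \<le> C" using order_trans[OF norm_ge_zero bound[of 0]] by simp
  have intS: "interior ?S \<subseteq> {z. 0 < Re z \<and> 0 < Im z}"
  proof
    fix z assume "z \<in> interior ?S"
    then obtain e where e: "e > 0" "ball z e \<subseteq> ?S" by (meson mem_interior)
    have "z - of_real (e / 2) \<in> ball z e" "z - \<i> * of_real (e / 2) \<in> ball z e"
      using e(1) by (auto simp: dist_norm norm_mult)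
    with e(2) have "z - of_real (e / 2) \<in> ?S" "z - \<i> * of_real (e / 2) \<in> ?S" by blast+
    then show "z \<in> {z. 0 < Re z \<and> 0 < Im z}" using e(1) by simp
  qed
  have conv: "convex ?S"
    by (simp only: Collect_conj_eq) (intro convex_Int convex_halfspace_Re_ge convex_halfspace_Im_ge)
  have cont_int: "(\<lambda>x. Q (of_real x)) integrable_on {0..R}" for R
    by (intro integrable_continuous_real continuous_on_compose2[OF cont]) (auto intro!: continuous_intros)
  have fin: "norm (integral {0..R} (\<lambda>x. Q (of_real x))) \<le> B + 4 * C / R" if R: "R > 0" for R :: real
  proof -
    let ?a = "0 :: complex" and ?b = "complex_of_real R" and ?c = "\<i> * complex_of_real R"
    have sub: "closed_segment u w \<subseteq> ?S" if "u \<in> ?S" "w \<in> ?S" for u w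
      using conv that by (simp add: closed_segment_subset)
    have S: "?a \<in> ?S" "?b \<in> ?S" "?c \<in> ?S" using R by auto
    have ci: "Q contour_integrable_on linepath u w" if "u \<in> ?S" "w \<in> ?S" for u w
      using continuous_on_subset[OF cont sub[OF that]] by (rule contour_integrable_continuous_linepath)
    have "(Q has_contour_integral 0) (linepath ?a ?b +++ linepath ?b ?c +++ linepath ?c ?a)"
    proof (rule Cauchy_theorem_convex[OF cont conv finite.emptyI])
      fix z assume "z \<in> interior ?S - {}"
      then have "z \<in> {z. 0 < Re z \<and> 0 < Im z}" using intS by auto
      moreover have "open {z. 0 < Re z \<and> 0 < Im z}"
        by (simp only: Collect_conj_eq) (intro open_Int open_halfspace_Re_gt open_halfspace_Im_gt)
      ultimately show "Q field_differentiable at z"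
        using hol holomorphic_on_imp_differentiable_at by blast
    qed (use S sub in \<open>auto simp: path_image_join simp del: mem_Collect_eq\<close>)
    then have "contour_integral (linepath ?a ?b) Q + (contour_integral (linepath ?b ?c) Q + contour_integral (linepath ?c ?a) Q) = 0"
      using ci[OF S(1,2)] ci[OF S(2,3)] ci[OF S(3,1)] by (auto dest!: contour_integral_unique)
    then have eq: "contour_integral (linepath ?a ?b) Q
       = contour_integral (linepath ?a ?c) Q - contour_integral (linepath ?b ?c) Q"
      using contour_integral_reverse_linepath[of ?a ?c Q] continuous_on_subset[OF cont sub[OF S(1,3)]]
      by (simp add: add_eq_0_iff2)
    have real: "contour_integral (linepath ?a ?b) Q = integral {0..R} (\<lambda>x. Q (of_real x))"
      using R by (subst contour_integral_linepath_Reals_eq) auto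
    have hyp: "norm (contour_integral (linepath ?b ?c) Q) \<le> 4 * C / R"
    proof -
      have "norm (contour_integral (linepath ?b ?c) Q) \<le> (2 * C / R\<^sup>2) * norm (?c - ?b)"
      proof (rule contour_integral_bound_linepath)
        fix z assume z: "z \<in> closed_segment ?b ?c"
        then obtain u where u: "0 \<le> u" "u \<le> 1" "z = (1 - u) *\<^sub>R ?b + u *\<^sub>R ?c"
          by (auto simp: closed_segment_def)
        have zz: "Re z = (1 - u) * R" "Im z = u * R" using u by auto
        have q: "0 \<le> Re z" "0 \<le> Im z" using zz u R by auto
        have "R\<^sup>2 / 2 \<le> (Re z)\<^sup>2 + (Im z)\<^sup>2"
        proof -
          have "R\<^sup>2 / 2 + 2 * ((u - 1 / 2) * R)\<^sup>2 = (Re z)\<^sup>2 + (Im z)\<^sup>2"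
            unfolding zz by (simp add: power2_eq_square field_simps)
          then show ?thesis by (metis le_add_same_cancel1 zero_le_power2 mult_nonneg_nonneg zero_le_numeral)
        qed
        also have "\<dots> \<le> (norm (z + \<i>))\<^sup>2"
          unfolding cmod_power2 using q by (auto intro!: power_mono)
        finally have n: "R\<^sup>2 / 2 \<le> (norm (z + \<i>))\<^sup>2" .
        have "norm (Q z) \<le> C / (norm (z + \<i>))\<^sup>2" by (rule bound[OF q])
        also have "\<dots> \<le> C / (R\<^sup>2 / 2)"
          using n R C0 by (intro divide_left_mono mult_pos_pos) (auto intro: less_le_trans[of _ "R\<^sup>2 / 2"])
        finally show "norm (Q z) \<le> 2 * C / R\<^sup>2" by (simp add: mult.commute)
      qed (use ci S R C0 in auto)
      also have "\<dots> \<le> (2 * C / R\<^sup>2) * (2 * R)"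
        using norm_triangle_ineq4[of ?c ?b] R C0 by (intro mult_left_mono) (auto simp: norm_mult)
      also have "\<dots> = 4 * C / R" using R by (simp add: power2_eq_square)
      finally show ?thesis .
    qed
    have "norm (contour_integral (linepath ?a ?c) Q) \<le> B"
    proof -
      have "contour_integral (linepath ?a ?c) Q = integral {0..1} (\<lambda>t. Q (linepath ?a ?c t) * ?c)"
        unfolding contour_integral_integral by (simp add: vector_derivative_linepath_at)
      also have "norm \<dots> \<le> integral {0..1} (\<lambda>t. B * R / (1 + R * t)\<^sup>2)"
      proof (rule integral_norm_bound_integral)
        have "1 + R * t > 0" if "t \<in> {0..1}" for t using that R by (auto intro: add_pos_nonneg)
        then show "(\<lambda>t. B * R / (1 + R * t)\<^sup>2) integrable_on {0..1}"
          by (intro integrable_continuous_real continuous_intros) force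
        show "(\<lambda>t. Q (linepath ?a ?c t) * ?c) integrable_on {0..1}"
          using R by (intro integrable_continuous_real continuous_intros continuous_on_compose2[OF cont])
             (auto simp: linepath_def)
        fix t :: real assume "t \<in> {0..1}"
        then have "norm (Q (\<i> * of_real (R * t))) \<le> B / (1 + R * t)\<^sup>2"
          using R by (intro axis) auto
        then have "norm (Q (\<i> * of_real (R * t))) * R \<le> B / (1 + R * t)\<^sup>2 * R"
          using R by (intro mult_right_mono) auto
        moreover have "linepath ?a ?c t = \<i> * of_real (R * t)"
          by (simp add: linepath_def scaleR_conv_of_real mult_ac)
        ultimately show "norm (Q (linepath ?a ?c t) * ?c) \<le> B * R / (1 + R * t)\<^sup>2"
          using R by (simp add: norm_mult)
      qed
      also have "\<dots> = - B / (1 + R) - - B / (1 + R * 0)"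
      proof -
        have "((\<lambda>t. B * R / (1 + R * t)\<^sup>2) has_integral - B / (1 + R * 1) - - B / (1 + R * 0)) {0..1}"
        proof (rule fundamental_theorem_of_calculus)
          fix t :: real assume "t \<in> {0..1}"
          then have "1 + R * t > 0" using R by (auto intro: add_pos_nonneg)
          then have "((\<lambda>t. - B / (1 + R * t)) has_real_derivative B * R / (1 + R * t)\<^sup>2) (at t within {0..1})"
            by (auto intro!: derivative_eq_intros simp: power2_eq_square)
          then show "((\<lambda>t. - B / (1 + R * t)) has_vector_derivative B * R / (1 + R * t)\<^sup>2) (at t within {0..1})"
            by (simp add: has_real_derivative_iff_has_vector_derivative)
        qed auto
        then show ?thesis by (simp add: integral_unique)
      qed
      also have "\<dots> \<le> B" using B0 R by simp
      finally show ?thesis .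
    qed
    then show ?thesis using real eq hyp norm_triangle_ineq4[of "contour_integral (linepath ?a ?c) Q"] by (smt (verit))
  qed
  have contQ: "continuous_on {0..} (\<lambda>x. Q (of_real x))"
    by (intro continuous_on_compose2[OF cont]) (auto intro!: continuous_intros)
  have setint: "set_integrable lborel {0..} (\<lambda>x. Q (of_real x))"
    unfolding set_integrable_def
  proof (rule Bochner_Integration.integrable_bound)
    show "integrable lborel (\<lambda>x::real. C * inverse (1 + x\<^sup>2))"
      using integrable_inverse_1_plus_square by (simp add: set_integrable_def einterval_def)
    show "(\<lambda>x. indicat_real {0..} x *\<^sub>R Q (of_real x)) \<in> borel_measurable lborel"
      using borel_measurable_continuous_on_indicator[OF _ contQ] by simp
    have "norm (Q (of_real x)) \<le> C * inverse (1 + x\<^sup>2)" if "0 \<le> x" for x :: real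
      using bound[of "of_real x"] that by (simp add: cmod_power2 divide_inverse add.commute)
    then show "AE x in lborel. norm (indicat_real {0..} x *\<^sub>R Q (of_real x)) \<le> norm (C * inverse (1 + x\<^sup>2))"
      using C0 by (intro AE_I2) (auto simp: indicator_def)
  qed
  have "(\<lambda>n. LBINT x:{0..real n}. Q (of_real x)) \<longlonglongrightarrow> (LBINT x:{0..}. Q (of_real x))"
    by (rule set_integral_Icc_tendsto[OF setint])
  then have "(\<lambda>n. norm (LBINT x:{0..real n}. Q (of_real x))) \<longlonglongrightarrow> norm (LBINT x:{0..}. Q (of_real x))"
    by (rule tendsto_norm)
  moreover have "(\<lambda>n. B + 4 * C / real n) \<longlonglongrightarrow> B" by real_asymp
  moreover have "norm (LBINT x:{0..real n}. Q (of_real x)) \<le> B + 4 * C / real n" if "n > 0" for n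
    using fin[of "real n"] that set_borel_integral_eq_integral(2)[OF set_integrable_subset[OF setint, of "{0..real n}"]]
    by simp
  ultimately show ?thesis
    by (intro LIMSEQ_le[of _ _ _ B]) (auto intro!: exI[of _ 1])
qed

section \<open>Density points and divergent integrals\<close>

text \<open>A minimum point of \<open>x \<mapsto> |E \<inter> [a, x]| - c x\<close> with a small slope \<open>c\<close> is a point of
  positive lower density from the right; no density theorem is needed.\<close>

lemma one_sided_density_point:
  fixes E :: "real set"
  assumes E [measurable]: "E \<in> sets borel" and pos: "0 < emeasure lborel E"
  shows "\<exists>x c \<delta>. 0 < c \<and> 0 < \<delta> \<and>
    (\<forall>y\<in>{0..\<delta>}. c * y \<le> measure lborel (E \<inter> {x..x + y}))"
proof -
  have "\<exists>n::nat. 0 < emeasure lborel (E \<inter> {- real n..real n})"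
  proof (rule ccontr)
    assume "\<not> ?thesis"
    then have "\<And>n::nat. E \<inter> {- real n..real n} \<in> null_sets lborel" by (auto simp: null_sets_def)
    then have "(\<Union>n::nat. E \<inter> {- real n..real n}) \<in> null_sets lborel" by (rule null_sets_UN)
    moreover have "(\<Union>n::nat. E \<inter> {- real n..real n}) = E"
    proof -
      have "\<exists>n::nat. - real n \<le> x \<and> x \<le> real n" for x
        using real_arch_simple[of "\<bar>x\<bar>"] by (auto simp: abs_le_iff minus_le_iff)
      then show ?thesis by (intro set_eqI) (auto simp only: UN_iff Int_iff atLeastAtMost_iff)
    qed
    ultimately show False using pos by (simp add: null_sets_def)
  qed
  then obtain n :: nat where n: "0 < emeasure lborel (E \<inter> {- real n..real n})" by blast
  define a b where "a = - real n" and "b = real n"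
  have fin: "E \<inter> {u..w} \<in> fmeasurable lborel" for u w
  proof (rule fmeasurableI2)
    show "{u..w} \<in> fmeasurable lborel"
      by (rule fmeasurableI, simp, cases "u \<le> w") auto
  qed auto
  have split: "measure lborel (E \<inter> {u..w}) = measure lborel (E \<inter> {u..v}) + measure lborel (E \<inter> {v..w})"
    if "u \<le> v" "v \<le> w" for u v w
  proof -
    have "AE x in lborel. x \<notin> E \<inter> {u..v} \<or> x \<notin> E \<inter> {v..w}"
      using AE_lborel_singleton[of v] by eventually_elim auto
    then have "measure lborel (E \<inter> {u..v} \<union> E \<inter> {v..w}) = measure lborel (E \<inter> {u..v}) + measure lborel (E \<inter> {v..w})"
      by (intro measure_Un_AE fin)
    moreover have "E \<inter> {u..v} \<union> E \<inter> {v..w} = E \<inter> {u..w}" using that by auto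
    ultimately show ?thesis by simp
  qed
  have le: "measure lborel (E \<inter> {u..w}) \<le> w - u" if "u \<le> w" for u w
  proof -
    have "measure lborel (E \<inter> {u..w}) \<le> measure lborel {u..w}"
      using that by (intro measure_mono_fmeasurable fmeasurableI) auto
    then show ?thesis using that by simp
  qed
  define m where "m = (\<lambda>x. measure lborel (E \<inter> {a..x}))"
  have mb: "m b > 0"
    using n fin[of a b] unfolding m_def a_def b_def by (simp add: measure_def enn2real_positive_iff fmeasurable_def)
  have ab: "a < b"
  proof (rule ccontr)
    assume "\<not> a < b"
    then have "m b = 0" using le[of a b] by (cases "a = b") (auto simp: m_def order_antisym)
    then show False using mb by simp
  qed
  \<comment> \<open>Half the mean density of \<open>E\<close> on \<open>[a, b]\<close>. With this
    slope \<open>m x - c * x\<close> is larger at \<open>b\<close> than at \<open>a\<close>, so a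
    minimum point lies strictly left of \<open>b\<close> and leaves room to its right.\<close>
  define c where "c = m b / (2 * (b - a))"
  have c: "c > 0" using mb ab by (simp add: c_def)
  have lip: "\<bar>m x - m y\<bar> \<le> \<bar>x - y\<bar>" if "a \<le> x" "a \<le> y" for x y
    using that
  proof (induction x y rule: linorder_wlog)
    case (le x y)
    then show ?case using split[of a x y] \<open>\<And>u w. u \<le> w \<Longrightarrow> measure lborel (E \<inter> {u..w}) \<le> w - u\<close>[of x y]
      by (simp add: m_def)
  qed (simp add: abs_minus_commute)
  have "continuous_on {a..b} m"
  proof (rule continuous_onI)
    fix x e :: real assume "x \<in> {a..b}" "e > 0"
    then show "\<exists>d>0. \<forall>x'\<in>{a..b}. dist x' x < d \<longrightarrow> dist (m x') (m x) \<le> e"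
      using lip by (intro exI[of _ e]) (fastforce simp: dist_real_def)
  qed
  then have "continuous_on {a..b} (\<lambda>x. m x - c * x)" by (intro continuous_intros)
  then obtain x where x: "x \<in> {a..b}" "\<And>y. y \<in> {a..b} \<Longrightarrow> m x - c * x \<le> m y - c * y"
    using continuous_attains_inf[of "{a..b}" "\<lambda>x. m x - c * x"] ab by auto
  have ma: "m a = 0" using le[of a a] by (simp add: m_def order_antisym)
  have "x \<noteq> b"
  proof
    assume "x = b"
    then have "m b \<le> c * (b - a)" using x(2)[of a] ab ma by (simp add: algebra_simps)
    also have "\<dots> = m b / 2" using ab by (simp add: c_def field_simps)
    finally show False using mb by simp
  qed
  then have "0 < b - x" using x(1) by simp
  moreover have "c * y \<le> measure lborel (E \<inter> {x..x + y})" if "0 \<le> y" "y \<le> b - x" for y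
    using x(2)[of "x + y"] x(1) that split[of a x "x + y"] by (simp add: m_def algebra_simps)
  ultimately show ?thesis using c by (intro exI[of _ x] exI[of _ c] exI[of _ "b - x"]) auto
qed

lemma nn_integral_half_line_SUP:
  fixes f :: "real \<Rightarrow> ennreal"
  assumes [measurable]: "f \<in> borel_measurable borel"
  shows "(\<integral>\<^sup>+x\<in>{0..}. f x \<partial>lborel) = (SUP n. \<integral>\<^sup>+x\<in>{0..real n}. f x \<partial>lborel)"
proof -
  have "f x * indicator {0..} x = (SUP n. f x * indicator {0..real n} x)" for x
  proof (cases "0 \<le> x")
    case True
    obtain N where "x \<le> real N" using real_arch_simple by blast
    with True have "f x * indicator {0..} x \<le> (SUP n. f x * indicator {0..real n} x)"
      by (intro SUP_upper2[of N]) (auto simp: indicator_def)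
    moreover have "(SUP n. f x * indicator {0..real n} x) \<le> f x * indicator {0..} x"
      by (intro SUP_least) (auto simp: indicator_def)
    ultimately show ?thesis by (rule antisym)
  qed (simp add: indicator_def)
  then have "(\<integral>\<^sup>+x\<in>{0..}. f x \<partial>lborel) = (\<integral>\<^sup>+x. (SUP n. f x * indicator {0..real n} x) \<partial>lborel)"
    by simp
  also have "\<dots> = (SUP n. \<integral>\<^sup>+x\<in>{0..real n}. f x \<partial>lborel)"
    by (intro nn_integral_monotone_convergence_SUP) (auto simp: incseq_def le_fun_def indicator_def)
  finally show ?thesis .
qed

text \<open>If \<open>\<psi> x \<le> x\<close> eventually, only a bounded interval is affected, and
  it contributes a finite amount. Otherwise \<open>\<psi> x > x\<close> for arbitrarily large
  \<open>x\<close>, and by monotonicity the minimum is at least \<open>x\<close> on all of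
  \<open>[x, 2 * x]\<close>; infinitely many such blocks of fixed mass contradict
  convergence.\<close>

lemma divergent_min_id:
  fixes \<psi> :: "real \<Rightarrow> real"
  assumes mono: "mono \<psi>" and nonneg: "\<And>x. 0 \<le> \<psi> x"
    and div: "(\<integral>\<^sup>+x\<in>{0..}. ennreal (\<psi> x / (1 + x\<^sup>2)) \<partial>lborel) = \<infinity>"
  shows "(\<integral>\<^sup>+x\<in>{0..}. ennreal (min (\<psi> x) x / (1 + x\<^sup>2)) \<partial>lborel) = \<infinity>"
proof -
  have [measurable]: "\<psi> \<in> borel_measurable borel" using mono by (rule borel_measurable_mono)
  let ?I = "\<lambda>S. \<integral>\<^sup>+x\<in>S. ennreal (min (\<psi> x) x / (1 + x\<^sup>2)) \<partial>lborel"
  show ?thesis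
  proof (cases "\<exists>t0. \<forall>x\<ge>t0. \<psi> x \<le> x")
    case True
    then obtain t0 where t0: "\<And>x. x \<ge> t0 \<Longrightarrow> \<psi> x \<le> x" by blast
    have "(\<integral>\<^sup>+x\<in>{0..}. ennreal (\<psi> x / (1 + x\<^sup>2)) \<partial>lborel)
        \<le> (\<integral>\<^sup>+x. ennreal (\<psi> t0) * indicator {0..t0} x + ennreal (min (\<psi> x) x / (1 + x\<^sup>2)) * indicator {0..} x \<partial>lborel)"
    proof (rule nn_integral_mono)
      fix x :: real
      show "ennreal (\<psi> x / (1 + x\<^sup>2)) * indicator {0..} x
        \<le> ennreal (\<psi> t0) * indicator {0..t0} x + ennreal (min (\<psi> x) x / (1 + x\<^sup>2)) * indicator {0..} x"
      proof (cases "0 \<le> x \<and> x \<le> t0")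
        case True
        have "\<psi> x / (1 + x\<^sup>2) \<le> \<psi> x / 1"
          using nonneg[of x] by (intro divide_left_mono) (auto intro: add_pos_nonneg)
        also have "\<dots> \<le> \<psi> t0" using True monoD[OF mono, of x t0] by simp
        finally have "ennreal (\<psi> x / (1 + x\<^sup>2)) \<le> ennreal (\<psi> t0)" by (rule ennreal_leI)
        then show ?thesis using True by (simp add: indicator_def add_increasing2)
      next
        case False
        then show ?thesis using t0[of x] by (cases "0 \<le> x") (auto simp: indicator_def min_absorb1)
      qed
    qed
    also have "\<dots> = ennreal (\<psi> t0) * emeasure lborel {0..t0} + ?I {0..}"
      by (subst nn_integral_add) (auto simp: nn_integral_cmult)
    finally have "ennreal (\<psi> t0) * emeasure lborel {0..t0} + ?I {0..} = \<infinity>"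
      using div by (simp add: top_unique)
    moreover have "emeasure lborel {0..t0} < \<infinity>" by (cases "0 \<le> t0") auto
    ultimately show ?thesis by (auto simp: ennreal_mult_less_top less_top[symmetric] ennreal_add_eq_top ennreal_mult_eq_top_iff)
  next
    case False
    show ?thesis
    proof (rule ccontr)
      assume fin: "?I {0..} \<noteq> \<infinity>"
      have "?I {0..} = (SUP n. ?I {0..real n})" by (rule nn_integral_half_line_SUP) measurable
      \<comment> \<open>A block \<open>[x, 2 * x]\<close> with \<open>x \<ge> 1\<close> carries at
        least \<open>x * x / (x^2 + (2 * x)^2) = 1 / 5\<close>, so the tail is chosen below
        that.\<close>
      then obtain n where n: "?I {0..} < ?I {0..real n} + ennreal (1 / 5)"
        using fin SUP_approx_ennreal[of "1/5" UNIV "?I {0..}" "\<lambda>n. ?I {0..real n}"] by (auto simp: top_unique)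
      obtain x where x: "x \<ge> real n + 1" "\<psi> x > x" using False by (meson not_le)
      have "ennreal (1 / 5) \<le> (\<integral>\<^sup>+s. ennreal (1 / (5 * x)) * indicator {x..2 * x} s \<partial>lborel)"
        using x(1) by (simp add: nn_integral_cmult flip: ennreal_mult)
      also have "\<dots> \<le> ?I {x..2 * x}"
      proof (rule nn_integral_mono)
        fix s
        have "1 / (5 * x) \<le> min (\<psi> s) s / (1 + s\<^sup>2)" if s: "x \<le> s" "s \<le> 2 * x"
        proof -
          have "1 + s\<^sup>2 \<le> x\<^sup>2 + (2 * x)\<^sup>2" using s x(1) by (intro add_mono power_mono one_le_power) auto
          then have "x / (5 * x\<^sup>2) \<le> x / (1 + s\<^sup>2)"
            using x(1) by (intro divide_left_mono) (auto intro!: mult_pos_pos add_pos_nonneg simp: power_mult_distrib)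
          also have "\<dots> \<le> min (\<psi> s) s / (1 + s\<^sup>2)"
            using s x monoD[OF mono, of x s] by (intro divide_right_mono) auto
          finally show ?thesis using x(1) by (simp add: power2_eq_square)
        qed
        then show "ennreal (1 / (5 * x)) * indicator {x..2 * x} s
            \<le> ennreal (min (\<psi> s) s / (1 + s\<^sup>2)) * indicator {x..2 * x} s"
          by (auto simp: indicator_def intro: ennreal_leI)
      qed
      finally have "?I {0..real n} + ennreal (1 / 5) \<le> ?I {0..real n} + ?I {x..2 * x}" by (rule add_left_mono)
      also have "\<dots> = (\<integral>\<^sup>+s. ennreal (min (\<psi> s) s / (1 + s\<^sup>2)) * indicator {0..real n} s
           + ennreal (min (\<psi> s) s / (1 + s\<^sup>2)) * indicator {x..2 * x} s \<partial>lborel)"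
        by (subst nn_integral_add) auto
      also have "\<dots> \<le> ?I {0..}"
        using x(1) by (intro nn_integral_mono) (auto simp: indicator_def)
      finally show False using n by simp
    qed
  qed
qed

text \<open>The Poisson kernel at \<open>\<i> * y\<close> is comparable with
  \<open>1 / (1 + (t / 2)^2)\<close>, and the substitution \<open>t = 2 * x\<close> removes the
  halving of the argument. Hence divergence passes to the Poisson integral, and a finite cut-off
  \<open>K\<close> already exceeds any given bound.\<close>

lemma divergent_poisson_integral:
  fixes \<phi> :: "real \<Rightarrow> real" and c y B :: real
  assumes mono: "mono \<phi>" and nonneg: "\<And>x. 0 \<le> x \<Longrightarrow> 0 \<le> \<phi> x"
    and div: "(\<integral>\<^sup>+x\<in>{0..}. ennreal (\<phi> x / (1 + x\<^sup>2)) \<partial>lborel) = \<infinity>"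
    and c: "c > 0" and y: "y > 0"
  obtains K where "0 \<le> K" "B < (LBINT t:{0..K}. c * \<phi> (t / 2) * (y / (y\<^sup>2 + t\<^sup>2)))"
proof -
  have [measurable]: "\<phi> \<in> borel_measurable borel" using mono by (rule borel_measurable_mono)
  \<comment> \<open>From \<open>y^2 + t^2 \<le> max (y^2) 4 * (1 + (t / 2)^2)\<close>, where the 4
    comes from \<open>t^2 = 4 * (t / 2)^2\<close>. The substitution contributes the further factor 2
    below.\<close>
  define k where "k = c * (y / max (y\<^sup>2) 4)"
  have k: "k > 0" using c y by (simp add: k_def less_max_iff_disj)
  let ?f = "\<lambda>t. c * \<phi> (t / 2) * (y / (y\<^sup>2 + t\<^sup>2))"
  have "\<infinity> = ennreal (2 * k) * (\<integral>\<^sup>+x\<in>{0..}. ennreal (\<phi> x / (1 + x\<^sup>2)) \<partial>lborel)"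
    using div k by (simp add: ennreal_mult_top)
  also have "\<dots> = ennreal k * (\<integral>\<^sup>+t. ennreal (\<phi> (t / 2) / (1 + (t / 2)\<^sup>2)) * indicator {0..} (t / 2) \<partial>lborel)"
  proof -
    let ?g = "\<lambda>t::real. ennreal (\<phi> (t / 2) / (1 + (t / 2)\<^sup>2)) * indicator {0..} (t / 2)"
    have "(\<integral>\<^sup>+t. ?g t \<partial>lborel) = ennreal 2 * (\<integral>\<^sup>+x. ?g (2 * x) \<partial>lborel)"
      using nn_integral_real_affine[of ?g 2 0] by simp
    moreover have "?g (2 * x) = ennreal (\<phi> x / (1 + x\<^sup>2)) * indicator {0..} x" for x by simp
    moreover have "ennreal (2 * k) = ennreal k * ennreal 2"
      using k by (subst mult.commute) (rule ennreal_mult; simp)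
    ultimately show ?thesis by (simp only: mult.assoc)
  qed
  also have "\<dots> = (\<integral>\<^sup>+t. ennreal k * (ennreal (\<phi> (t / 2) / (1 + (t / 2)\<^sup>2)) * indicator {0..} (t / 2)) \<partial>lborel)"
    by (subst nn_integral_cmult) auto
  also have "\<dots> \<le> (\<integral>\<^sup>+t\<in>{0..}. ennreal (?f t) \<partial>lborel)"
  proof (rule nn_integral_mono)
    fix t :: real
    have "k * (\<phi> (t / 2) / (1 + (t / 2)\<^sup>2)) \<le> ?f t" if t: "0 \<le> t"
    proof -
      have "y\<^sup>2 + t\<^sup>2 \<le> max (y\<^sup>2) 4 * 1 + max (y\<^sup>2) 4 * (t / 2)\<^sup>2"
        using mult_right_mono[of 4 "max (y\<^sup>2) 4" "(t / 2)\<^sup>2"] by (intro add_mono) (auto simp: power_divide)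
      then have "y / (max (y\<^sup>2) 4 * (1 + (t / 2)\<^sup>2)) \<le> y / (y\<^sup>2 + t\<^sup>2)"
        using y zero_le_power2[of "t / 2"]
        by (intro divide_left_mono mult_pos_pos add_pos_nonneg)
           (auto intro: add_pos_nonneg simp: algebra_simps less_max_iff_disj)
      then have "c * \<phi> (t / 2) * (y / (max (y\<^sup>2) 4 * (1 + (t / 2)\<^sup>2))) \<le> ?f t"
        using c nonneg[of "t / 2"] t by (intro mult_left_mono) auto
      then show ?thesis by (simp add: k_def mult_ac)
    qed
    then show "ennreal k * (ennreal (\<phi> (t / 2) / (1 + (t / 2)\<^sup>2)) * indicator {0..} (t / 2)) \<le> ennreal (?f t) * indicator {0..} t"
      using k by (auto simp: indicator_def simp flip: ennreal_mult' intro!: ennreal_leI)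
  qed
  also have "\<dots> = (SUP n. \<integral>\<^sup>+t\<in>{0..real n}. ennreal (?f t) \<partial>lborel)"
    by (rule nn_integral_half_line_SUP) measurable
  finally have eq: "(SUP n. \<integral>\<^sup>+t\<in>{0..real n}. ennreal (?f t) \<partial>lborel) = \<infinity>"
    unfolding infinity_ennreal_def by (rule top_le)
  \<comment> \<open>\<open>ennreal\<close> sends negative numbers to 0, so a comparison transferred
    back to the reals needs a nonnegative left side.\<close>
  have "ennreal (max B 0) < (SUP n. \<integral>\<^sup>+t\<in>{0..real n}. ennreal (?f t) \<partial>lborel)"
    by (subst eq) simp
  then obtain n where n: "ennreal (max B 0) < (\<integral>\<^sup>+t\<in>{0..real n}. ennreal (?f t) \<partial>lborel)"
    by (auto simp: less_SUP_iff)
  have f0: "0 \<le> ?f t" if "0 \<le> t" for t using nonneg[of "t / 2"] that c y by simp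
  have "set_integrable lborel {0..real n} ?f"
    unfolding set_integrable_def
  proof (rule integrableI_bounded_set_indicator[where B = "c * \<phi> (real n / 2) * (1 / y)"])
    have "norm (?f t) \<le> c * \<phi> (real n / 2) * (1 / y)" if t: "t \<in> {0..real n}" for t
    proof -
      have "y / (y\<^sup>2 + t\<^sup>2) \<le> y / y\<^sup>2"
        using y by (intro divide_left_mono) (auto intro!: mult_pos_pos add_pos_nonneg)
      then have "y / (y\<^sup>2 + t\<^sup>2) \<le> 1 / y" using y by (simp add: power2_eq_square)
      moreover have "\<phi> (t / 2) \<le> \<phi> (real n / 2)" using t by (intro monoD[OF mono]) auto
      ultimately have "?f t \<le> c * \<phi> (real n / 2) * (1 / y)"
        using c y t nonneg[of "t / 2"] nonneg[of "real n / 2"] by (intro mult_mono) auto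
      then show ?thesis using f0[of t] t by simp
    qed
    then show "AE t\<in>{0..real n} in lborel. norm (?f t) \<le> c * \<phi> (real n / 2) * (1 / y)" by auto
  qed auto
  then have "(\<integral>\<^sup>+t. ennreal (indicator {0..real n} t *\<^sub>R ?f t) \<partial>lborel) = ennreal (LBINT t:{0..real n}. ?f t)"
    unfolding set_integrable_def set_lebesgue_integral_def using f0
    by (intro nn_integral_eq_integral) (auto simp: indicator_def)
  moreover have "(\<integral>\<^sup>+t. ennreal (indicator {0..real n} t *\<^sub>R ?f t) \<partial>lborel) = (\<integral>\<^sup>+t\<in>{0..real n}. ennreal (?f t) \<partial>lborel)"
    by (intro nn_integral_cong) (auto simp: indicator_def)
  ultimately have "ennreal (max B 0) < ennreal (LBINT t:{0..real n}. ?f t)" using n by simp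
  then have "B < (LBINT t:{0..real n}. ?f t)"
    by (subst (asm) ennreal_less_iff) (simp, simp only: max_less_iff_conj)
  then show thesis using that[of "real n"] by simp
qed

section \<open>Quasianalyticity in one variable\<close>

lemma norm_integral_le_integral:
  fixes f :: "'a \<Rightarrow> 'b::{banach, second_countable_topology}"
  assumes "integrable M f" "integrable M g" "\<And>x. x \<in> space M \<Longrightarrow> norm (f x) \<le> g x"
  shows "norm (\<integral>x. f x \<partial>M) \<le> (\<integral>x. g x \<partial>M)"
  using assms by (intro order_trans[OF integral_norm_bound integral_mono]) auto

text \<open>The uniqueness argument in normal position: the density point is 0 and the zero set is
  used to the right of it. Translation and reflection reduce the general case to this one. The
  conclusion concerns \<open>t \<ge> 0\<close> because \<open>\<Phi>\<close> sees only the values of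
  \<open>F\<close> there.\<close>

lemma quasianalytic_half_line:
  fixes H :: "'a \<Rightarrow> complex" and X :: "'a \<Rightarrow> real" and \<phi> :: "real \<Rightarrow> real" and E :: "real set" and c \<delta> :: real
  assumes H: "integrable M H" and X [measurable]: "X \<in> borel_measurable M"
    and mono: "mono \<phi>" and \<phi>: "\<And>x. 0 \<le> x \<Longrightarrow> 0 \<le> \<phi> x \<and> \<phi> x \<le> x"
    and div: "(\<integral>\<^sup>+x\<in>{0..}. ennreal (\<phi> x / (1 + x\<^sup>2)) \<partial>lborel) = \<infinity>"
    and wint: "integrable M (\<lambda>x. exp (\<phi> \<bar>X x\<bar>) * norm (H x))"
    and E [measurable]: "E \<in> sets borel" and c: "0 < c" and \<delta>: "0 < \<delta>"
    and density: "\<And>y. 0 \<le> y \<Longrightarrow> y \<le> \<delta> \<Longrightarrow> c * y \<le> measure lborel (E \<inter> {0..y})"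
    and zero: "\<And>t. t \<in> E \<Longrightarrow> (\<integral>x. exp (\<i> * complex_of_real t * X x) * H x \<partial>M) = 0"
    and t: "0 \<le> t"
  shows "(\<integral>x. exp (\<i> * complex_of_real t * X x) * H x \<partial>M) = 0"
proof -
  define F where "F = (\<lambda>t::real. \<integral>x. exp (\<i> * t * X x) * H x \<partial>M)"
  \<comment> \<open>The summand 1 makes \<open>D\<close> positive even if \<open>H\<close> vanishes
    almost everywhere; Jensen's inequality asks for a positive bound.\<close>
  define D where "D = (\<integral>x. exp (\<phi> \<bar>X x\<bar>) * norm (H x) \<partial>M) + 1"
  have H_meas [measurable]: "H \<in> borel_measurable M" using H by auto
  have \<phi>_meas [measurable]: "\<phi> \<in> borel_measurable borel" using mono by (rule borel_measurable_mono)
  have D0: "D > 0" unfolding D_def by (intro add_nonneg_pos integral_nonneg) auto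
  have HD: "(\<integral>x. norm (H x) \<partial>M) \<le> D"
  proof -
    have "(\<integral>x. norm (H x) \<partial>M) \<le> (\<integral>x. exp (\<phi> \<bar>X x\<bar>) * norm (H x) \<partial>M)"
    proof (intro integral_mono wint)
      show "norm (H x) \<le> exp (\<phi> \<bar>X x\<bar>) * norm (H x)" for x
        using mult_right_mono[of 1 "exp (\<phi> \<bar>X x\<bar>)" "norm (H x)"] \<phi>[of "\<bar>X x\<bar>"] by simp
    qed (use H in auto)
    then show ?thesis by (simp add: D_def)
  qed
  have F_cont: "continuous_on UNIV F"
    unfolding F_def by (rule fourier_integral_continuous[OF H X])
  have F_bound: "norm (F s) \<le> D" for s
    unfolding F_def by (rule order_trans[OF integral_norm_bound]) (use HD in \<open>simp add: norm_mult\<close>)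

  \<comment> \<open>Cut-off transforms and their distance from \<open>F\<close>\<close>
  define HT where "HT = (\<lambda>T x. indicator {-T..T} (X x) * H x)"
  \<comment> \<open>Shifting by \<open>T\<close> moves the window into \<open>[0, 2 * T]\<close> and
    multiplies the cut-off transform by \<open>exp (\<i> * z * T)\<close>, which makes it bounded in
    the upper half-plane. The maximum with 0 serves the sign condition of the locale; it alters
    \<open>X + T\<close> only where \<open>HT T\<close> vanishes.\<close>
  define G where "G = (\<lambda>T. half_plane_transform.G M (\<lambda>x. max (X x + T) 0) (HT T))"
  have HT_le: "norm (HT T x) \<le> norm (H x)" for T x by (simp add: HT_def norm_mult indicator_def)
  have HT_int: "integrable M (HT T)" for T
    by (rule Bochner_Integration.integrable_bound[OF H]) (use HT_le in \<open>auto simp: HT_def\<close>)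
  have transform: "half_plane_transform M (\<lambda>x. max (X x + T) 0) (HT T)" for T
    by standard (use HT_int in auto)
  have G_eq: "G T z = (\<integral>x. exp (\<i> * z * (X x + T)) * HT T x \<partial>M)" for T z
    unfolding G_def half_plane_transform.G_def[OF transform]
  proof (intro Bochner_Integration.integral_cong refl)
    fix x
    show "exp (\<i> * z * of_real (max (X x + T) 0)) * HT T x = exp (\<i> * z * (X x + T)) * HT T x"
      by (cases "X x \<in> {-T..T}") (simp_all add: HT_def max_absorb1)
  qed
  have G_bound: "norm (G T z) \<le> D" if "0 \<le> Im z" for T z
  proof -
    have "norm (G T z) \<le> (\<integral>x. norm (HT T x) \<partial>M)"
      unfolding G_def by (rule half_plane_transform.norm_G[OF transform that])
    also have "\<dots> \<le> (\<integral>x. norm (H x) \<partial>M)" using HT_le HT_int H by (intro integral_mono) auto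
    finally show ?thesis using HD by simp
  qed
  have G_cont: "continuous_on {z. 0 \<le> Im z} (G T)" and G_hol: "G T holomorphic_on {z. 0 < Im z}" for T
    unfolding G_def by (rule half_plane_transform.continuous_G[OF transform] half_plane_transform.holomorphic_G[OF transform])+
  have approx: "norm (F s - exp (- (\<i> * s * T)) * G T s) \<le> D * exp (- \<phi> T)" if T: "0 \<le> T" for s T :: real
  proof -
    have GF: "exp (- (\<i> * s * T)) * G T s = (\<integral>x. exp (\<i> * s * X x) * HT T x \<partial>M)"
      unfolding G_eq integral_mult_right_zero[symmetric]
      by (intro Bochner_Integration.integral_cong refl) (simp add: ring_distribs exp_add exp_minus)
    have I: "integrable M (\<lambda>x. exp (\<i> * s * X x) * h x)" if "integrable M h" for h
      using that by (rule Bochner_Integration.integrable_bound) (use that in \<open>auto simp: norm_mult\<close>)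
    have "F s - exp (- (\<i> * s * T)) * G T s = (\<integral>x. exp (\<i> * s * X x) * (H x - HT T x) \<partial>M)"
      unfolding GF F_def using I[OF H] I[OF HT_int] by (simp add: right_diff_distrib)
    also have "norm \<dots> \<le> (\<integral>x. exp (- \<phi> T) * (exp (\<phi> \<bar>X x\<bar>) * norm (H x)) \<partial>M)"
    proof (rule norm_integral_le_integral)
      show "integrable M (\<lambda>x. exp (\<i> * s * X x) * (H x - HT T x))"
        using H HT_int by (intro I) auto
      fix x
      show "norm (exp (\<i> * s * X x) * (H x - HT T x)) \<le> exp (- \<phi> T) * (exp (\<phi> \<bar>X x\<bar>) * norm (H x))"
      proof (cases "X x \<in> {-T..T}")
        case False
        then have "\<phi> T \<le> \<phi> \<bar>X x\<bar>" using T by (intro monoD[OF mono]) auto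
        then have "1 \<le> exp (- \<phi> T) * exp (\<phi> \<bar>X x\<bar>)" by (simp flip: exp_add)
        then have "1 * norm (H x) \<le> exp (- \<phi> T) * exp (\<phi> \<bar>X x\<bar>) * norm (H x)"
          by (rule mult_right_mono) simp
        with False show ?thesis by (simp add: HT_def norm_mult mult.assoc)
      qed (simp add: HT_def)
    qed (use wint in auto)
    also have "\<dots> = exp (- \<phi> T) * (\<integral>x. exp (\<phi> \<bar>X x\<bar>) * norm (H x) \<partial>M)" by simp
    also have "\<dots> \<le> D * exp (- \<phi> T)" by (simp add: D_def ring_distribs mult.commute)
    finally show ?thesis .
  qed
  have G_on_E: "norm (G T s) \<le> D * exp (- \<phi> T)" if "s \<in> E" "0 \<le> T" for s T :: real
    using approx[OF that(2), of s] zero[OF that(1)] by (simp add: F_def norm_mult)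

  \<comment> \<open>Smallness on the imaginary axis near 0\<close>
  define c0 where "c0 = min (min (c / (2 * pi)) \<delta>) 1"
  \<comment> \<open>Three uses: \<open>c / (2 * pi)\<close> is the density \<open>c\<close> times
    the minimum \<open>1 / (2 * y)\<close> of the Poisson kernel on \<open>[0, y]\<close>, times
    \<open>y / pi\<close>; the bound \<open>\<delta>\<close> handles heights above
    \<open>\<delta>\<close>; and the bound 1 lets the truncation error
    \<open>exp (- \<phi> T)\<close> be absorbed.\<close>
  have c0: "0 < c0" "c0 \<le> c / (2 * pi)" "c0 \<le> \<delta>" "c0 \<le> 1" using c \<delta> by (auto simp: c0_def)
  have G_axis_pos: "norm (G T (\<i> * of_real y)) \<le> D * exp (- (c0 * \<phi> T))"
    if T: "0 \<le> T" and y: "0 < y" "y \<le> \<delta>" for T y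
  proof -
    have m: "E \<inter> {0..y} \<in> fmeasurable lborel"
      by (rule fmeasurableI2[of "{0..y}"]) (use y in \<open>auto intro: fmeasurableI\<close>)
    \<comment> \<open>Jensen's inequality with \<open>v\<close> equal to \<open>\<phi> T\<close> on
      \<open>E\<close> and 0 off \<open>E\<close>, where only the global bound \<open>D\<close> is
      known. Cutting at \<open>K = y\<close> restricts to the range on which the kernel is of order
      \<open>1 / y\<close>.\<close>
    have "norm (G T (\<i> * of_real y)) \<le> D * exp (- (LBINT s:{0..y}. (\<phi> T * indicator E s) * (y / (y\<^sup>2 + s\<^sup>2))) / pi)"
      by (rule jensen_inequality_half_plane[where N = "\<phi> T", OF G_hol G_cont G_bound])
        (use D0 \<phi>[OF T] y G_on_E[OF _ T] G_bound in \<open>auto simp: indicator_def\<close>)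
    also have "\<dots> \<le> D * exp (- (c0 * \<phi> T))"
    proof -
      have "c0 * \<phi> T \<le> c / (2 * pi) * \<phi> T" using c0 \<phi>[OF T] by (intro mult_right_mono) auto
      also have "\<dots> = (\<phi> T / (2 * y)) * (c * y) / pi" using y by simp
      also have "\<dots> \<le> (\<phi> T / (2 * y)) * measure lborel (E \<inter> {0..y}) / pi"
        using density[of y] y \<phi>[OF T] by (intro divide_right_mono mult_left_mono) auto
      also have "(\<phi> T / (2 * y)) * measure lborel (E \<inter> {0..y})
          = (LBINT s. (\<phi> T / (2 * y)) * indicator (E \<inter> {0..y}) s)" by simp
      also have "\<dots> \<le> (LBINT s:{0..y}. (\<phi> T * indicator E s) * (y / (y\<^sup>2 + s\<^sup>2)))"
        unfolding set_lebesgue_integral_def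
      proof (rule integral_mono)
        show "integrable lborel (\<lambda>s. \<phi> T / (2 * y) * indicator (E \<inter> {0..y}) s)"
          using m by (intro integrable_mult_right integrable_real_indicator) (auto simp: fmeasurable_def)
        have le1: "y / (y\<^sup>2 + s\<^sup>2) \<le> 1 / y" for s
        proof -
          have "y / (y\<^sup>2 + s\<^sup>2) \<le> y / y\<^sup>2"
            using y by (intro divide_left_mono) (auto intro!: mult_pos_pos add_pos_nonneg)
          then show ?thesis using y by (simp add: power2_eq_square)
        qed
        show "integrable lborel (\<lambda>s. indicator {0..y} s *\<^sub>R (\<phi> T * indicator E s * (y / (y\<^sup>2 + s\<^sup>2))))"
        proof (rule integrableI_bounded_set_indicator[where B = "\<phi> T * (1 / y)"])
          show "emeasure lborel {0..y} < \<infinity>" using y by simp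
          show "AE s\<in>{0..y} in lborel. norm (\<phi> T * indicator E s * (y / (y\<^sup>2 + s\<^sup>2))) \<le> \<phi> T * (1 / y)"
            using mult_left_mono[OF le1, of "\<phi> T"] \<phi>[OF T] y by (intro AE_I2) (auto simp: indicator_def)
        qed auto
        fix s
        show "\<phi> T / (2 * y) * indicator (E \<inter> {0..y}) s \<le> indicator {0..y} s *\<^sub>R (\<phi> T * indicator E s * (y / (y\<^sup>2 + s\<^sup>2)))"
        proof (cases "s \<in> E \<inter> {0..y}")
          case True
          then have "y\<^sup>2 + s\<^sup>2 \<le> 2 * y\<^sup>2" using power_mono[of s y 2] by auto
          then have "y / (2 * y\<^sup>2) \<le> y / (y\<^sup>2 + s\<^sup>2)"
            using y by (intro divide_left_mono) (auto intro!: mult_pos_pos add_pos_nonneg)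
          then have "1 / (2 * y) \<le> y / (y\<^sup>2 + s\<^sup>2)" using y by (simp add: power2_eq_square)
          then have "\<phi> T * (1 / (2 * y)) \<le> \<phi> T * (y / (y\<^sup>2 + s\<^sup>2))"
            using \<phi>[OF T] by (intro mult_left_mono) auto
          with True show ?thesis by simp
        qed (use \<phi>[OF T] y in \<open>auto simp: indicator_def\<close>)
      qed
      finally have "c0 * \<phi> T \<le> (LBINT s:{0..y}. (\<phi> T * indicator E s) * (y / (y\<^sup>2 + s\<^sup>2))) / pi"
        by (simp add: divide_right_mono)
      then show ?thesis using D0 by simp
    qed
    finally show ?thesis .
  qed
  \<comment> \<open>Jensen's inequality needs a point inside the half-plane, so the endpoint
    \<open>y = 0\<close> is reached by continuity.\<close>
  have G_axis: "norm (G T (\<i> * of_real y)) \<le> D * exp (- (c0 * \<phi> T))"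
    if T: "0 \<le> T" and y: "0 \<le> y" "y \<le> \<delta>" for T y
  proof (cases "y = 0")
    case True
    have "(\<lambda>n. G T (\<i> * of_real (\<delta> / Suc n))) \<longlonglongrightarrow> G T (\<i> * of_real 0)"
    proof (rule continuous_on_tendsto_compose[OF G_cont])
      have "(\<lambda>n. \<delta> / Suc n) \<longlonglongrightarrow> 0" by real_asymp
      then show "(\<lambda>n. \<i> * complex_of_real (\<delta> / Suc n)) \<longlonglongrightarrow> \<i> * complex_of_real 0"
        by (intro tendsto_intros)
    qed (use \<delta> in auto)
    then have "(\<lambda>n. norm (G T (\<i> * of_real (\<delta> / Suc n)))) \<longlonglongrightarrow> norm (G T (\<i> * of_real y))"
      using True by (auto intro: tendsto_norm)
    moreover have "norm (G T (\<i> * of_real (\<delta> / Suc n))) \<le> D * exp (- (c0 * \<phi> T))" for n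
      using \<delta> by (intro G_axis_pos[OF T]) (auto simp: field_simps)
    ultimately show ?thesis by (intro LIMSEQ_le_const2) auto
  qed (use G_axis_pos that in auto)

  \<comment> \<open>The damped transform over the positive half-line and its decay\<close>
  define k where "k = (\<lambda>x. indicator {0..} x * F x / (of_real x + \<i>)\<^sup>2)"
  have norm_xi: "(norm (of_real x + \<i>))\<^sup>2 = 1 + x\<^sup>2" for x :: real by (simp add: cmod_power2 add.commute)
  have F_meas [measurable]: "F \<in> borel_measurable borel"
    using F_cont by (rule borel_measurable_continuous_onI)
  have k_meas [measurable]: "k \<in> borel_measurable borel" unfolding k_def by measurable
  have arctan_int: "integrable lborel (\<lambda>x::real. inverse (1 + x\<^sup>2))" "(LBINT x::real. inverse (1 + x\<^sup>2)) = pi"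
    using integrable_inverse_1_plus_square LBINT_inverse_1_plus_square
    by (simp_all add: set_integrable_def einterval_def interval_lebesgue_integral_def set_lebesgue_integral_def)
  have k_bound: "norm (k x) \<le> D * inverse (1 + x\<^sup>2)" for x
  proof (cases "0 \<le> x")
    case True
    have "norm (k x) = norm (F x) / (1 + x\<^sup>2)"
      using True by (simp add: k_def norm_divide norm_power norm_xi)
    also have "\<dots> \<le> D / (1 + x\<^sup>2)" using F_bound[of x] by (intro divide_right_mono) auto
    finally show ?thesis by (simp only: divide_inverse)
  qed (use D0 in \<open>simp add: k_def\<close>)
  have k_int: "integrable lborel k"
    by (rule Bochner_Integration.integrable_bound[where f = "\<lambda>x. D * inverse (1 + x\<^sup>2)"])
       (use k_bound arctan_int D0 in \<open>auto simp: abs_of_pos\<close>)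
  have transform\<Phi>: "half_plane_transform lborel (\<lambda>x. max x 0) k"
    by standard (use k_int in auto)
  define \<Phi> where "\<Phi> = half_plane_transform.G lborel (\<lambda>x. max x 0) k"
  have \<Phi>_eq: "\<Phi> z = (LBINT x. exp (\<i> * z * x) * k x)" for z
    unfolding \<Phi>_def half_plane_transform.G_def[OF transform\<Phi>]
    by (intro Bochner_Integration.integral_cong) (auto simp: k_def indicator_def max_def)
  note \<Phi>_cont = half_plane_transform.continuous_G[OF transform\<Phi>, folded \<Phi>_def]
    and \<Phi>_hol = half_plane_transform.holomorphic_G[OF transform\<Phi>, folded \<Phi>_def]
  have \<Phi>_bound: "norm (\<Phi> z) \<le> D * pi" if "0 \<le> Im z" for z
  proof -
    have "norm (\<Phi> z) \<le> (LBINT x. norm (k x))"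
      unfolding \<Phi>_def by (rule half_plane_transform.norm_G[OF transform\<Phi> that])
    also have "\<dots> \<le> (LBINT x::real. D * inverse (1 + x\<^sup>2))"
      using k_int arctan_int k_bound by (intro integral_mono) auto
    finally show ?thesis using arctan_int by simp
  qed
  have \<Phi>_decay: "norm (\<Phi> (of_real (2 * T))) \<le> D * (pi + 1) * exp (- (c0 * \<phi> T))" if T: "0 \<le> T" for T :: real
  proof -
    \<comment> \<open>At frequency \<open>2 * T\<close> the phase
      \<open>exp (2 * \<i> * T * x)\<close> meets the factor \<open>exp (- (\<i> * T * x))\<close>
      of the approximation of \<open>F\<close> by \<open>G T\<close>. The remaining
      \<open>exp (\<i> * T * z)\<close> becomes \<open>exp (- (T * y))\<close> on the imaginary
      axis.\<close>
    define Q where "Q = (\<lambda>z. exp (\<i> * T * z) * G T z / (z + \<i>)\<^sup>2)"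
    have zi: "z + \<i> \<noteq> 0" if "0 \<le> Im z" for z
    proof
      assume "z + \<i> = 0"
      then have "Im (z + \<i>) = 0" by simp
      then show False using that by simp
    qed
    have Q_bound: "norm (Q z) \<le> D / (norm (z + \<i>))\<^sup>2" if "0 \<le> Im z" for z
    proof -
      have "norm (exp (\<i> * T * z)) * norm (G T z) \<le> 1 * D"
        using that T G_bound[OF that, of T] by (intro mult_mono) auto
      then show ?thesis by (simp add: Q_def norm_mult norm_divide norm_power divide_right_mono)
    qed
    have Q_cont: "continuous_on {z. 0 \<le> Im z} Q"
      unfolding Q_def using zi by (intro continuous_intros G_cont) auto
    have main: "norm (LBINT x:{0..}. Q (of_real x)) \<le> D * exp (- (c0 * \<phi> T))"
    proof (rule quadrant_rotation_bound)
      show "continuous_on {z. 0 \<le> Re z \<and> 0 \<le> Im z} Q"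
        by (rule continuous_on_subset[OF Q_cont]) auto
      have "Q holomorphic_on {z. 0 < Im z}"
        unfolding Q_def using zi by (intro holomorphic_intros G_hol) auto
      then show "Q holomorphic_on {z. 0 < Re z \<and> 0 < Im z}"
        by (rule holomorphic_on_subset) auto
      show "norm (Q z) \<le> D / (norm (z + \<i>))\<^sup>2" if "0 \<le> Im z" for z
        by (rule Q_bound[OF that])
      fix y :: real assume y: "0 \<le> y"
      have "\<i> * of_real y + \<i> = \<i> * of_real (1 + y)" by (simp add: algebra_simps)
      then have n: "norm (\<i> * of_real y + \<i>) = 1 + y" using y by (simp only: norm_mult norm_of_real) simp
      \<comment> \<open>Near 0 the smallness of \<open>G T\<close> suffices; above height
        \<open>\<delta>\<close> the exponential does, by
        \<open>c0 * \<phi> T \<le> \<delta> * T \<le> T * y\<close>.\<close>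
      have "exp (- (T * y)) * norm (G T (\<i> * of_real y)) \<le> D * exp (- (c0 * \<phi> T))"
      proof (cases "y \<le> \<delta>")
        case True
        have "exp (- (T * y)) * norm (G T (\<i> * of_real y)) \<le> 1 * norm (G T (\<i> * of_real y))"
          using T y by (intro mult_right_mono) auto
        then show ?thesis using G_axis[OF T y True] by simp
      next
        case False
        have "c0 * \<phi> T \<le> \<delta> * T" using c0 \<phi>[OF T] T by (intro mult_mono) auto
        also have "\<dots> \<le> T * y" using False T by (simp add: mult.commute mult_left_mono)
        finally have "exp (- (T * y)) * norm (G T (\<i> * of_real y)) \<le> exp (- (c0 * \<phi> T)) * D"
          using y by (intro mult_mono G_bound) auto
        then show ?thesis by (simp add: mult.commute)
      qed
      moreover have "norm (Q (\<i> * of_real y)) = exp (- (T * y)) * norm (G T (\<i> * of_real y)) / (1 + y)\<^sup>2"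
        by (simp add: Q_def norm_mult norm_divide norm_power n)
      ultimately show "norm (Q (\<i> * of_real y)) \<le> D * exp (- (c0 * \<phi> T)) / (1 + y)\<^sup>2"
        by (simp add: divide_right_mono)
    qed
    let ?r = "\<lambda>x::real. exp (\<i> * of_real (2 * T) * x) * k x - indicator {0..} x *\<^sub>R Q (of_real x)"
    have Q_meas: "(\<lambda>x. indicator {0..} x *\<^sub>R Q (complex_of_real x)) \<in> borel_measurable borel"
      by (rule borel_measurable_continuous_on_indicator)
         (auto intro!: continuous_on_compose2[OF Q_cont] continuous_intros)
    have Q_int: "integrable lborel (\<lambda>x. indicator {0..} x *\<^sub>R Q (complex_of_real x))"
    proof (rule Bochner_Integration.integrable_bound)
      show "integrable lborel (\<lambda>x::real. D * inverse (1 + x\<^sup>2))" using arctan_int by simp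
      have "norm (Q (of_real x)) \<le> D * inverse (1 + x\<^sup>2)" for x :: real
        using Q_bound[of "of_real x"] by (simp add: norm_xi divide_inverse)
      then have "norm (indicat_real {0..} x *\<^sub>R Q (of_real x)) \<le> D * inverse (1 + x\<^sup>2)" for x :: real
        using D0 by (cases "0 \<le> x") auto
      then show "AE x in lborel. norm (indicat_real {0..} x *\<^sub>R Q (of_real x)) \<le> norm (D * inverse (1 + x\<^sup>2))"
        using D0 by (intro AE_I2) (simp add: abs_of_pos)
      show "(\<lambda>x. indicat_real {0..} x *\<^sub>R Q (of_real x)) \<in> borel_measurable lborel"
        using Q_meas by simp
    qed
    have k'_int: "integrable lborel (\<lambda>x. exp (\<i> * of_real (2 * T) * x) * k x)"
      by (rule Bochner_Integration.integrable_bound[OF k_int]) (auto simp: norm_mult)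
    \<comment> \<open>The cost of replacing \<open>F\<close> by the cut-off transform. The integral
      of \<open>1 / (1 + x^2)\<close> over the line gives the \<open>pi\<close> in the constant
      \<open>pi + 1\<close>; the 1 comes from the rotated integral.\<close>
    have "norm (LBINT x. ?r x) \<le> (LBINT x::real. D * exp (- \<phi> T) * inverse (1 + x\<^sup>2))"
    proof (rule norm_integral_le_integral)
      fix x :: real
      show "norm (?r x) \<le> D * exp (- \<phi> T) * inverse (1 + x\<^sup>2)"
      proof (cases "0 \<le> x")
        case True
        then have "?r x = exp (\<i> * of_real (2 * T) * x) * (F x - exp (- (\<i> * x * T)) * G T x) / (of_real x + \<i>)\<^sup>2"
          by (simp add: k_def Q_def diff_divide_distrib right_diff_distrib mult_ac flip: exp_add)
        then have "norm (?r x) = norm (F x - exp (- (\<i> * x * T)) * G T x) * inverse (1 + x\<^sup>2)"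
          by (simp add: norm_mult norm_divide norm_power norm_xi flip: divide_inverse)
        also have "\<dots> \<le> D * exp (- \<phi> T) * inverse (1 + x\<^sup>2)"
          by (intro mult_right_mono approx[OF T]) auto
        finally show ?thesis .
      qed (use D0 in \<open>simp add: k_def\<close>)
    qed (use k'_int Q_int arctan_int in auto)
    also have "\<dots> = D * pi * exp (- \<phi> T)" using arctan_int by simp
    also have "\<dots> \<le> D * pi * exp (- (c0 * \<phi> T))"
      using D0 c0 \<phi>[OF T] by (intro mult_left_mono) (auto simp: mult_le_cancel_right1 mult_left_le_one_le)
    finally have rest: "norm (LBINT x. ?r x) \<le> D * pi * exp (- (c0 * \<phi> T))" .
    have "\<Phi> (of_real (2 * T)) = (LBINT x. ?r x) + (LBINT x:{0..}. Q (of_real x))"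
      unfolding \<Phi>_eq set_lebesgue_integral_def using k'_int Q_int by simp
    then have "norm (\<Phi> (of_real (2 * T))) \<le> D * pi * exp (- (c0 * \<phi> T)) + D * exp (- (c0 * \<phi> T))"
      using main rest norm_triangle_ineq[of "LBINT x. ?r x" "LBINT x:{0..}. Q (of_real x)"] by simp
    then show ?thesis by (simp add: algebra_simps)
  qed

  \<comment> \<open>Vanishing of \<open>\<Phi>\<close>, and of \<open>F\<close> on the
    half-line\<close>
  have \<Phi>_axis: "\<Phi> (\<i> * of_real y) = 0" if y: "0 < y" for y :: real
  proof (rule ccontr)
    assume ne: "\<Phi> (\<i> * of_real y) \<noteq> 0"
    define C where "C = D * (pi + 1)"
    have C: "C > 0" using D0 pi_gt_zero by (simp add: C_def add_pos_pos)
    \<comment> \<open>The threshold is the value at which the bound from Jensen's inequality equals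
      the modulus of \<open>\<Phi>\<close> itself; exceeding it strictly is a contradiction.\<close>
    obtain K where K: "0 \<le> K"
      "pi * ln (C / norm (\<Phi> (\<i> * of_real y))) < (LBINT t:{0..K}. c0 * \<phi> (t / 2) * (y / (y\<^sup>2 + t\<^sup>2)))"
      using divergent_poisson_integral[OF mono _ div c0(1) y] \<phi> by blast
    have "norm (\<Phi> (\<i> * of_real y)) \<le> C * exp (- (LBINT t:{0..K}. c0 * \<phi> (t / 2) * (y / (y\<^sup>2 + t\<^sup>2))) / pi)"
    proof (rule jensen_inequality_half_plane[where N = "c0 * \<phi> (K / 2)", OF \<Phi>_hol \<Phi>_cont _ C _ _ _ y K(1)])
      show "norm (\<Phi> z) \<le> C" if "0 \<le> Im z" for z
        using \<Phi>_bound[OF that] D0 by (simp add: C_def algebra_simps)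
      show "0 \<le> c0 * \<phi> (t / 2) \<and> c0 * \<phi> (t / 2) \<le> c0 * \<phi> (K / 2)" if "0 \<le> t" "t \<le> K" for t
        using \<phi>[of "t / 2"] c0 that monoD[OF mono, of "t / 2" "K / 2"] by simp
      show "norm (\<Phi> (of_real t)) \<le> C * exp (- (c0 * \<phi> (t / 2)))" if "0 \<le> t" for t
        using \<Phi>_decay[of "t / 2"] that by (simp add: C_def)
    qed measurable
    also have "\<dots> < C * exp (- (pi * ln (C / norm (\<Phi> (\<i> * of_real y)))) / pi)"
      using divide_strict_right_mono[OF K(2) pi_gt_zero] C by simp
    also have "\<dots> = norm (\<Phi> (\<i> * of_real y))"
      using C ne by (simp add: ln_div exp_diff)
    finally show False by simp
  qed
  have \<Phi>_upper: "\<Phi> z = 0" if "0 < Im z" for z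
  proof (rule analytic_continuation[OF \<Phi>_hol, where U = "(\<lambda>y::real. \<i> * of_real y) ` {0<..}" and \<xi> = \<i>])
    show "open {z. 0 < Im z}" by (rule open_halfspace_Im_gt)
    show "connected {z. 0 < Im z}" by (intro convex_connected convex_halfspace_Im_gt)
    show "\<i> islimpt (\<lambda>y::real. \<i> * of_real y) ` {0<..}"
      unfolding islimpt_approachable
    proof (intro allI impI)
      fix e :: real assume e: "e > 0"
      show "\<exists>x'\<in>(\<lambda>y::real. \<i> * of_real y) ` {0<..}. x' \<noteq> \<i> \<and> dist x' \<i> < e"
      proof (intro bexI[of _ "\<i> * of_real (1 + e / 2)"] conjI)
        have "\<i> * complex_of_real (1 + e / 2) - \<i> = \<i> * of_real (e / 2)" by (simp add: algebra_simps)
        then show "dist (\<i> * complex_of_real (1 + e / 2)) \<i> < e" using e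
          by (simp only: dist_norm norm_mult norm_of_real) simp
        show "\<i> * complex_of_real (1 + e / 2) \<noteq> \<i>" using e by (simp add: complex_eq_iff)
        show "\<i> * complex_of_real (1 + e / 2) \<in> (\<lambda>y. \<i> * of_real y) ` {0<..}"
          using e by (intro imageI) simp
      qed
    qed
  qed (use that \<Phi>_axis in auto)
  have \<Phi>_real: "\<Phi> (of_real s) = 0" for s :: real
  proof -
    have "(\<lambda>n. \<Phi> (of_real s + \<i> / Suc n)) \<longlonglongrightarrow> \<Phi> (of_real s)"
    proof (rule continuous_on_tendsto_compose[OF \<Phi>_cont])
      have "(\<lambda>n. of_real s + \<i> * complex_of_real (1 / Suc n)) \<longlonglongrightarrow> of_real s + \<i> * complex_of_real 0"
        by (intro tendsto_intros) real_asymp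
      then show "(\<lambda>n. of_real s + \<i> / Suc n) \<longlonglongrightarrow> complex_of_real s" by simp
    qed (auto simp: Im_divide_of_nat)
    moreover have "\<Phi> (of_real s + \<i> / Suc n) = 0" for n
      by (rule \<Phi>_upper) (simp add: Im_divide_of_nat del: of_nat_Suc)
    ultimately show ?thesis by (simp add: LIMSEQ_const_iff)
  qed
  \<comment> \<open>On the real line \<open>\<Phi>\<close> is the full Fourier transform of
    \<open>k\<close>, so Fourier uniqueness applies to \<open>k\<close>.\<close>
  have "(LBINT x. indicator A x * k x) = 0" if "A \<in> sets lborel" for A
    using fourier_uniqueness[OF k_int, of "\<lambda>x. x" A] \<Phi>_real that by (simp add: \<Phi>_eq)
  then have "AE x in lborel. k x = 0" by (rule AE_zero_of_set_integrals[OF k_int])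
  then have "AE x in lborel. 0 \<le> x \<longrightarrow> F x = 0"
  proof eventually_elim
    fix x assume "k x = 0"
    moreover have "of_real x + \<i> \<noteq> 0" by (simp add: complex_eq_iff)
    ultimately show "0 \<le> x \<longrightarrow> F x = 0" by (auto simp: k_def)
  qed
  then show ?thesis
    using continuous_eq_0_AE_half_line[OF F_cont _ t] unfolding F_def by blast
qed

text \<open>The half-line result is used twice: rightwards from a density point \<open>x0\<close> of
  \<open>E\<close>, then leftwards from \<open>x0 + 1\<close>, where the interval just gained has
  full density. Together they cover the line, and Fourier uniqueness turns a vanishing transform
  into vanishing integrals over preimages.\<close>

lemma beurling_uniqueness:
  fixes H :: "'a \<Rightarrow> complex" and X :: "'a \<Rightarrow> real" and \<psi> :: "real \<Rightarrow> real" and E :: "real set"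
  assumes H: "integrable M H" and X [measurable]: "X \<in> borel_measurable M"
    and mono: "mono \<psi>" and nonneg: "\<And>x. 0 \<le> \<psi> x"
    and div: "(\<integral>\<^sup>+x\<in>{0..}. ennreal (\<psi> x / (1 + x\<^sup>2)) \<partial>lborel) = \<infinity>"
    and wint: "integrable M (\<lambda>x. exp (\<psi> \<bar>X x\<bar>) * norm (H x))"
    and E [measurable]: "E \<in> sets borel" and pos: "0 < emeasure lborel E"
    and zero: "\<And>t. t \<in> E \<Longrightarrow> (\<integral>x. exp (\<i> * complex_of_real t * X x) * H x \<partial>M) = 0"
    and A: "A \<in> sets borel"
  shows "(\<integral>x. indicator A (X x) * H x \<partial>M) = 0"
proof -
  have [measurable]: "H \<in> borel_measurable M" using H by auto
  have [measurable]: "\<psi> \<in> borel_measurable borel" using mono by (rule borel_measurable_mono)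
  define \<phi> where "\<phi> = (\<lambda>x. min (\<psi> x) x)"
  have \<phi>: "mono \<phi>" "\<And>x. 0 \<le> x \<Longrightarrow> 0 \<le> \<phi> x \<and> \<phi> x \<le> x"
    "(\<integral>\<^sup>+x\<in>{0..}. ennreal (\<phi> x / (1 + x\<^sup>2)) \<partial>lborel) = \<infinity>"
    unfolding \<phi>_def using mono nonneg divergent_min_id[OF mono nonneg div]
    by (auto simp: mono_def min_le_iff_disj)
  have \<phi>_meas [measurable]: "\<phi> \<in> borel_measurable borel" unfolding \<phi>_def by measurable
  have wint': "integrable M (\<lambda>x. exp (\<phi> \<bar>X x\<bar>) * norm (H x))"
    by (rule Bochner_Integration.integrable_bound[OF wint]) (auto simp: \<phi>_def mult_right_mono)
  define F where "F = (\<lambda>t::real. \<integral>x. exp (\<i> * t * X x) * H x \<partial>M)"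
  \<comment> \<open>Modulating \<open>H\<close> by \<open>exp (\<i> * u * X x)\<close> translates
    the transform, and replacing \<open>X\<close> by \<open>\<sigma> * X\<close> reflects it;
    neither changes the weighted integrability.\<close>
  have half: "F (u + \<sigma> * t) = 0"
    if \<sigma>: "\<bar>\<sigma>\<bar> = 1" and S [measurable]: "S \<in> sets borel" and c: "0 < c" and \<delta>: "0 < \<delta>"
      and density: "\<And>y. 0 \<le> y \<Longrightarrow> y \<le> \<delta> \<Longrightarrow> c * y \<le> measure lborel (S \<inter> {0..y})"
      and S0: "\<And>s. s \<in> S \<Longrightarrow> F (u + \<sigma> * s) = 0" and t: "0 \<le> t"
    for u \<sigma> c \<delta> t :: real and S
  proof -
    have F_eq: "(\<integral>x. exp (\<i> * complex_of_real s * complex_of_real (\<sigma> * X x)) * (exp (\<i> * u * X x) * H x) \<partial>M)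
        = F (u + \<sigma> * s)" for s
      unfolding F_def by (intro Bochner_Integration.integral_cong refl) (simp add: algebra_simps flip: exp_add)
    have "(\<integral>x. exp (\<i> * complex_of_real t * complex_of_real (\<sigma> * X x)) * (exp (\<i> * u * X x) * H x) \<partial>M) = 0"
    proof (rule quasianalytic_half_line[where \<phi> = \<phi> and E = S and c = c and \<delta> = \<delta>, OF _ _ \<phi> _ S c \<delta> density _ t])
      fix s assume "s \<in> S"
      then show "(\<integral>x. exp (\<i> * complex_of_real s * complex_of_real (\<sigma> * X x)) * (exp (\<i> * u * X x) * H x) \<partial>M) = 0"
        by (simp only: F_eq S0)
    next
      show "integrable M (\<lambda>x. exp (\<i> * u * X x) * H x)"
        by (rule Bochner_Integration.integrable_bound[OF H]) (auto simp: norm_mult)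
      show "integrable M (\<lambda>x. exp (\<phi> \<bar>\<sigma> * X x\<bar>) * norm (exp (\<i> * u * X x) * H x))"
        using wint' \<sigma> by (simp add: abs_mult norm_mult)
      show "(\<lambda>x. \<sigma> * X x) \<in> borel_measurable M" by measurable
    qed
    then show ?thesis by (simp only: F_eq)
  qed
  obtain x0 c \<delta> where d: "0 < c" "0 < \<delta>"
    "\<forall>y\<in>{0..\<delta>}. c * y \<le> measure lborel (E \<inter> {x0..x0 + y})"
    using one_sided_density_point[OF E pos] by blast
  have right: "F (x0 + t) = 0" if "0 \<le> t" for t
  proof -
    have "F (x0 + 1 * t) = 0"
    proof (rule half[OF _ _ d(1,2) _ _ that])
      show "(+) x0 -` E \<in> sets borel" by (rule measurable_sets_borel[OF _ E]) auto
      show "c * y \<le> measure lborel ((+) x0 -` E \<inter> {0..y})" if "0 \<le> y" "y \<le> \<delta>" for y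
      proof -
        have "c * y \<le> measure lborel (E \<inter> {x0..x0 + y})" using d(3) that by auto
        also have "\<dots> = measure (distr lborel borel ((+) x0)) (E \<inter> {x0..x0 + y})"
          by (simp add: lborel_distr_plus)
        also have "\<dots> = measure lborel ((+) x0 -` (E \<inter> {x0..x0 + y}) \<inter> space lborel)"
          by (rule measure_distr) auto
        also have "(+) x0 -` (E \<inter> {x0..x0 + y}) \<inter> space lborel = (+) x0 -` E \<inter> {0..y}" by auto
        finally show ?thesis .
      qed
      show "F (x0 + 1 * s) = 0" if "s \<in> (+) x0 -` E" for s
        unfolding F_def using that by (intro zero) simp
    qed simp
    then show ?thesis by simp
  qed
  have left: "F (x0 + 1 - t) = 0" if "0 \<le> t" for t
  proof -
    have "F ((x0 + 1) + (- 1) * t) = 0"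
    proof (rule half[of _ "{0..1}" 1 1, OF _ _ _ _ _ _ that])
      show "1 * y \<le> measure lborel ({0..1} \<inter> {0..y})" if "0 \<le> y" "y \<le> 1" for y :: real
        using that by (simp add: Int_absorb1)
      show "F ((x0 + 1) + (- 1) * s) = 0" if "s \<in> {0..1}" for s
        using right[of "1 - s"] that by (simp add: algebra_simps)
    qed auto
    then show ?thesis by simp
  qed
  have "F t = 0" for t
    using right[of "t - x0"] left[of "x0 + 1 - t"] by (cases "x0 \<le> t") auto
  then show ?thesis
    using fourier_uniqueness[OF H X _ A] by (simp add: F_def)
qed

section \<open>Approximation in even powers\<close>

lemma power_add_le_two_power:
  fixes a b :: real
  assumes "0 \<le> a" "0 \<le> b"
  shows "(a + b) ^ n \<le> 2 ^ n * (a ^ n + b ^ n)"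
proof -
  have "(a + b) ^ n \<le> (2 * max a b) ^ n" using assms by (intro power_mono) auto
  also have "\<dots> = 2 ^ n * max a b ^ n" by (rule power_mult_distrib)
  also have "max a b ^ n \<le> a ^ n + b ^ n" using assms by (auto simp: max_def)
  finally show ?thesis by simp
qed

text \<open>Convexity of the power, by induction: multiplying the tangent inequality by
  \<open>u\<close> gives the next one plus the nonnegative term
  \<open>m * v ^ (m - 1) * (u - v)^2\<close>.\<close>

lemma power_above_tangent:
  fixes u v :: real
  assumes "0 \<le> u" "0 \<le> v"
  shows "v ^ m + m * v ^ (m - 1) * (u - v) \<le> u ^ m"
proof (induction m)
  case (Suc m)
  show ?case
  proof (cases m)
    case (Suc l)
    have "v ^ Suc m + Suc m * v ^ m * (u - v) + m * v ^ l * (u - v)\<^sup>2 = u * (v ^ m + m * v ^ (m - 1) * (u - v))"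
      unfolding Suc by (simp add: algebra_simps power2_eq_square)
    also have "\<dots> \<le> u * u ^ m" using Suc.IH assms by (intro mult_left_mono) auto
    finally have "v ^ Suc m + Suc m * v ^ m * (u - v) + m * v ^ l * (u - v)\<^sup>2 \<le> u ^ Suc m" by simp
    moreover have "0 \<le> m * v ^ l * (u - v)\<^sup>2" using assms by simp
    ultimately show ?thesis by simp
  qed simp
qed simp

text \<open>By the parallelogram law the squared moduli on the left add up to the mean
  \<open>v\<close> of those of \<open>a\<close> and \<open>b\<close>. Their \<open>m\<close>-th
  powers then add up to at most \<open>v ^ m\<close>, and convexity bounds \<open>v ^ m\<close> by
  the mean of the \<open>m\<close>-th powers.\<close>

lemma clarkson_even:
  fixes a b :: complex
  assumes m: "m \<ge> 1"
  shows "norm ((a - b) / 2) ^ (2 * m) + norm ((a + b) / 2) ^ (2 * m) \<le> (norm a ^ (2 * m) + norm b ^ (2 * m)) / 2"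
proof -
  define \<alpha> \<beta> where "\<alpha> = (norm ((a - b) / 2))\<^sup>2" and "\<beta> = (norm ((a + b) / 2))\<^sup>2"
  define v where "v = ((norm a)\<^sup>2 + (norm b)\<^sup>2) / 2"
  have nn: "0 \<le> \<alpha>" "0 \<le> \<beta>" "0 \<le> v" by (auto simp: \<alpha>_def \<beta>_def v_def)
  have sum: "\<alpha> + \<beta> = v"
    unfolding \<alpha>_def \<beta>_def v_def by (simp add: norm_divide power_divide cmod_power2 field_simps) (simp add: power2_eq_square algebra_simps)
  have "\<alpha> ^ m + \<beta> ^ m = \<alpha> * \<alpha> ^ (m - 1) + \<beta> * \<beta> ^ (m - 1)"
    using m by (cases m) auto
  also have "\<dots> \<le> \<alpha> * v ^ (m - 1) + \<beta> * v ^ (m - 1)"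
    using nn sum by (intro add_mono mult_left_mono power_mono) auto
  also have "\<dots> = v ^ m" using m sum by (cases m) (auto simp flip: distrib_right)
  also have "v ^ m \<le> (((norm a)\<^sup>2) ^ m + ((norm b)\<^sup>2) ^ m) / 2"
  proof -
    have "m * v ^ (m - 1) * ((norm a)\<^sup>2 - v) + m * v ^ (m - 1) * ((norm b)\<^sup>2 - v)
        = m * v ^ (m - 1) * (((norm a)\<^sup>2 - v) + ((norm b)\<^sup>2 - v))"
      by (rule distrib_left[symmetric])
    also have "((norm a)\<^sup>2 - v) + ((norm b)\<^sup>2 - v) = 0" by (simp add: v_def field_simps)
    finally show ?thesis
      using power_above_tangent[of "(norm a)\<^sup>2" v m] power_above_tangent[of "(norm b)\<^sup>2" v m] nn by simp
  qed
  finally show ?thesis by (simp add: \<alpha>_def \<beta>_def flip: power_mult)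
qed

text \<open>The completeness argument of Riesz and Fischer, with the majorant \<open>W\<close> kept:
  dominated convergence is later applied to \<open>norm (h k x + s x) ^ n\<close> for fixed
  \<open>s\<close>.\<close>

lemma dominated_limit_of_fast_cauchy:
  fixes h :: "nat \<Rightarrow> 'a \<Rightarrow> complex"
  assumes n: "n > 0" and meas [measurable]: "\<And>k. h k \<in> borel_measurable M"
    and int: "\<And>k. integrable M (\<lambda>x. norm (h k x) ^ n)"
    and fast: "\<And>k. (\<integral>x. norm (h (Suc k) x - h k x) ^ n \<partial>M) \<le> (1 / 2 ^ Suc n) ^ k"
  obtains l W where "l \<in> borel_measurable M" "integrable M W"
    "AE x in M. (\<lambda>k. h k x) \<longlonglongrightarrow> l x" "AE x in M. \<forall>k. norm (h k x) ^ n \<le> W x"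
proof -
  \<comment> \<open>The assumed rate beats the weight \<open>(2 ^ k) ^ n\<close> and leaves
    \<open>(1 / 2) ^ k\<close>. Since each term is at most the sum \<open>A\<close>, the increments
    are at most \<open>root n (A x) / 2 ^ k\<close>, which bounds the telescoping series by a
    geometric one.\<close>
  define a where "a = (\<lambda>k x. (2 ^ k * norm (h (Suc k) x - h k x)) ^ n)"
  have a0: "0 \<le> a k x" for k x by (simp add: a_def)
  have a_meas [measurable]: "a k \<in> borel_measurable M" for k unfolding a_def by measurable
  have diff_int: "integrable M (\<lambda>x. norm (h (Suc k) x - h k x) ^ n)" for k
  proof (rule Bochner_Integration.integrable_bound)
    show "integrable M (\<lambda>x. 2 ^ n * (norm (h (Suc k) x) ^ n + norm (h k x) ^ n))" using int by auto
    have "norm (h (Suc k) x - h k x) ^ n \<le> 2 ^ n * (norm (h (Suc k) x) ^ n + norm (h k x) ^ n)" for x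
      by (rule order_trans[OF power_mono[OF norm_triangle_ineq4] power_add_le_two_power]) auto
    then show "AE x in M. norm (norm (h (Suc k) x - h k x) ^ n) \<le> norm (2 ^ n * (norm (h (Suc k) x) ^ n + norm (h k x) ^ n))"
      by (intro AE_I2) simp
  qed measurable
  have a_int: "integrable M (a k)" for k
    unfolding a_def power_mult_distrib using diff_int by auto
  have a_le: "(\<integral>x. a k x \<partial>M) \<le> (1 / 2) ^ k" for k
  proof -
    have "(\<integral>x. a k x \<partial>M) = (2 ^ k) ^ n * (\<integral>x. norm (h (Suc k) x - h k x) ^ n \<partial>M)"
      unfolding a_def power_mult_distrib by simp
    also have "\<dots> \<le> (2 ^ k) ^ n * (1 / 2 ^ Suc n) ^ k" by (intro mult_left_mono fast) simp
    also have "\<dots> = (1 / 2) ^ k"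
      by (simp add: power_divide power_mult_distrib mult.commute flip: power_mult)
    finally show ?thesis .
  qed
  have summable_int: "summable (\<lambda>k. \<integral>x. norm (a k x) \<partial>M)"
    by (rule summable_comparison_test'[OF summable_geometric[of "1 / 2 :: real"], of 0])
       (use a_le a0 in auto)
  have ae: "AE x in M. summable (\<lambda>k. a k x)"
  proof -
    have "(\<integral>\<^sup>+x. (\<Sum>k. ennreal (a k x)) \<partial>M) = (\<Sum>k. \<integral>\<^sup>+x. ennreal (a k x) \<partial>M)"
      by (rule nn_integral_suminf) simp
    also have "\<dots> = (\<Sum>k. ennreal (\<integral>x. a k x \<partial>M))"
      using a_int a0 by (intro suminf_cong nn_integral_eq_integral) auto
    also have "\<dots> < \<infinity>"
      using summable_int a0 by (subst suminf_ennreal2) (auto simp: less_top)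
    finally have "AE x in M. (\<Sum>k. ennreal (a k x)) \<noteq> \<infinity>"
      by (intro nn_integral_noteq_infinite) auto
    then show ?thesis
      by eventually_elim (use a0 in \<open>auto intro!: summable_suminf_not_top\<close>)
  qed
  define A where "A = (\<lambda>x. \<Sum>k. a k x)"
  have A_int: "integrable M A"
    unfolding A_def using ae a0 summable_int a_int by (intro integrable_suminf) auto
  define l where "l = (\<lambda>x. lim (\<lambda>k. h k x))"
  define W where "W = (\<lambda>x. 2 ^ n * (norm (h 0 x) ^ n + 2 ^ n * A x))"
  have pw: "(\<lambda>k. h k x) \<longlonglongrightarrow> l x \<and> (\<forall>k. norm (h k x) ^ n \<le> W x)" if s: "summable (\<lambda>k. a k x)" for x
  proof -
    define R where "R = root n (A x)"
    have A0: "0 \<le> A x" unfolding A_def using a0 s by (intro suminf_nonneg) auto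
    have R: "0 \<le> R" "R ^ n = A x" using A0 n by (auto simp: R_def)
    have step: "norm (h (Suc k) x - h k x) \<le> R * (1 / 2) ^ k" for k
    proof -
      have "a k x \<le> A x"
        unfolding A_def using sum_le_suminf[OF s, of "{k}"] a0 by simp
      then have "2 ^ k * norm (h (Suc k) x - h k x) \<le> R"
        using R n by (auto simp: a_def intro: power_le_imp_le_base[of _ "n - 1"])
      then show ?thesis by (simp add: power_divide field_simps)
    qed
    have sg: "summable (\<lambda>k. R * (1 / 2) ^ k)" by (intro summable_mult summable_geometric) simp
    have sd: "summable (\<lambda>k. norm (h (Suc k) x - h k x))"
      by (rule summable_comparison_test'[OF sg, of 0]) (use step in auto)
    have tel: "(\<Sum>j<k. h (Suc j) x - h j x) = h k x - h 0 x" for k by (rule sum_lessThan_telescope)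
    have "convergent (\<lambda>k. \<Sum>j<k. h (Suc j) x - h j x)"
      using summable_norm_cancel[OF sd] by (simp add: summable_iff_convergent)
    then have "convergent (\<lambda>k. h k x - h 0 x + h 0 x)"
      unfolding tel by (intro convergent_add convergent_const)
    then have conv: "(\<lambda>k. h k x) \<longlonglongrightarrow> l x" unfolding l_def by (simp add: convergent_LIMSEQ_iff)
    have "norm (h k x) ^ n \<le> W x" for k
    proof -
      have "norm (h k x - h 0 x) \<le> (\<Sum>j<k. norm (h (Suc j) x - h j x))"
        unfolding tel[symmetric] by (rule norm_sum)
      also have "\<dots> \<le> (\<Sum>j<k. R * (1 / 2) ^ j)" by (intro sum_mono step)
      also have "\<dots> \<le> (\<Sum>j. R * (1 / 2) ^ j)" using R by (intro sum_le_suminf sg) auto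
      also have "\<dots> = 2 * R" by (subst suminf_mult) (auto simp: suminf_geometric)
      finally have "norm (h k x) \<le> norm (h 0 x) + 2 * R"
        using norm_triangle_sub[of "h k x" "h 0 x"] by simp
      then have "norm (h k x) ^ n \<le> (norm (h 0 x) + 2 * R) ^ n" by (intro power_mono) auto
      also have "\<dots> \<le> 2 ^ n * (norm (h 0 x) ^ n + (2 * R) ^ n)"
        using R by (intro power_add_le_two_power) auto
      also have "\<dots> = W x" by (simp add: W_def power_mult_distrib R)
      finally show ?thesis .
    qed
    with conv show ?thesis by blast
  qed
  show thesis
  proof
    show "l \<in> borel_measurable M" unfolding l_def by measurable
    show "integrable M W" unfolding W_def using int A_int by auto
    show "AE x in M. (\<lambda>k. h k x) \<longlonglongrightarrow> l x" "AE x in M. \<forall>k. norm (h k x) ^ n \<le> W x"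
      using ae by (eventually_elim, use pw in blast)+
  qed
qed

text \<open>Boundedness on a finite measure space places \<open>S\<close> in every Lebesgue space at
  once, so the exponent can vary while \<open>S\<close> is fixed.\<close>

locale bounded_function_space = finite_measure M for M :: "'a measure" +
  fixes S :: "('a \<Rightarrow> complex) set"
  assumes S_measurable: "\<And>s. s \<in> S \<Longrightarrow> s \<in> borel_measurable M"
    and S_bounded: "\<And>s. s \<in> S \<Longrightarrow> \<exists>B. \<forall>x. norm (s x) \<le> B"
    and S_zero: "(\<lambda>_. 0) \<in> S"
    and S_add_scale: "\<And>f g c. f \<in> S \<Longrightarrow> g \<in> S \<Longrightarrow> (\<lambda>x. f x + c * g x) \<in> S"
begin

lemma S_scale: "s \<in> S \<Longrightarrow> (\<lambda>x. c * s x) \<in> S"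
  using S_add_scale[OF S_zero, of s c] by simp

lemma S_power_integrable:
  assumes "s \<in> S"
  shows "integrable M (\<lambda>x. norm (s x) ^ n)"
proof -
  obtain B where B: "\<And>x. norm (s x) \<le> B" using S_bounded[OF assms] by blast
  have [measurable]: "s \<in> borel_measurable M" by (rule S_measurable[OF assms])
  show ?thesis
    by (rule integrable_const_bound[where B = "B ^ n"]) (use B in \<open>auto intro!: power_mono AE_I2\<close>)
qed

lemma power_add_integrable:
  fixes f g :: "'a \<Rightarrow> complex"
  assumes [measurable]: "f \<in> borel_measurable M" "g \<in> borel_measurable M"
    and f: "integrable M (\<lambda>x. norm (f x) ^ n)" and g: "integrable M (\<lambda>x. norm (g x) ^ n)"
  shows "integrable M (\<lambda>x. norm (f x + g x) ^ n)"
proof (rule Bochner_Integration.integrable_bound)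
  show "integrable M (\<lambda>x. 2 ^ n * (norm (f x) ^ n + norm (g x) ^ n))" using f g by auto
  have "norm (f x + g x) ^ n \<le> 2 ^ n * (norm (f x) ^ n + norm (g x) ^ n)" for x
    by (rule order_trans[OF power_mono[OF norm_triangle_ineq] power_add_le_two_power]) auto
  then show "AE x in M. norm (norm (f x + g x) ^ n) \<le> norm (2 ^ n * (norm (f x) ^ n + norm (g x) ^ n))"
    by (intro AE_I2) simp
qed measurable

text \<open>A minimising sequence is Cauchy: midpoints stay in \<open>S\<close>, so by Clarkson's
  inequality nearly minimal distances force small differences. The nearest point may lie only in the
  closure of \<open>S\<close>; hence the residual \<open>h\<close> is produced directly and is
  minimal under shifts by \<open>S\<close>.\<close>

lemma nearest_point_exists:
  fixes f :: "'a \<Rightarrow> complex"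
  assumes m: "m \<ge> 1" and f [measurable]: "f \<in> borel_measurable M"
    and fint: "integrable M (\<lambda>x. norm (f x) ^ (2 * m))"
  obtains h where "h \<in> borel_measurable M" "integrable M (\<lambda>x. norm (h x) ^ (2 * m))"
    "\<And>s. s \<in> S \<Longrightarrow> (\<integral>x. norm (h x) ^ (2 * m) \<partial>M) \<le> (\<integral>x. norm (h x + s x) ^ (2 * m) \<partial>M)"
    "\<And>\<epsilon>. \<epsilon> > 0 \<Longrightarrow> \<exists>g\<in>S. (\<integral>x. norm (f x - g x) ^ (2 * m) \<partial>M) < (\<integral>x. norm (h x) ^ (2 * m) \<partial>M) + \<epsilon>"
proof -
  let ?n = "2 * m"
  define J where "J = (\<lambda>g. \<integral>x. norm (f x - g x) ^ ?n \<partial>M)"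
  define d where "d = Inf (J ` S)"
  have J0: "0 \<le> J g" for g unfolding J_def by (intro Bochner_Integration.integral_nonneg) auto
  have bdd: "bdd_below (J ` S)" using J0 by (intro bdd_belowI[of _ 0]) auto
  have d_le: "d \<le> J g" if "g \<in> S" for g unfolding d_def using that bdd by (intro cInf_lower) auto
  have J_close: "\<exists>g\<in>S. J g < d + \<epsilon>" if "\<epsilon> > 0" for \<epsilon>
    using cInf_lessD[of "J ` S" "d + \<epsilon>"] S_zero that unfolding d_def by auto
  \<comment> \<open>The power of \<open>1 / 2 ^ Suc ?n\<close> is the rate required for a fast
    Cauchy sequence; the division by \<open>2 ^ ?n\<close> pays for the halved difference in
    Clarkson's inequality.\<close>
  define \<epsilon> :: "nat \<Rightarrow> real" where "\<epsilon> = (\<lambda>k. (1 / 2 ^ Suc ?n) ^ k / 2 ^ ?n)"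
  have \<epsilon>: "\<epsilon> k > 0" "\<epsilon> (Suc k) \<le> \<epsilon> k" for k
  proof -
    show "\<epsilon> k > 0" by (simp add: \<epsilon>_def)
    have "(1 / 2 :: real) ^ Suc ?n \<le> 1" by (rule power_le_one) auto
    then have "(1 / 2 ^ Suc ?n :: real) \<le> 1" by (simp only: power_one_over)
    then show "\<epsilon> (Suc k) \<le> \<epsilon> k"
      unfolding \<epsilon>_def by (intro divide_right_mono power_decreasing) (simp_all del: power_Suc)
  qed
  have "\<forall>k. \<exists>g\<in>S. J g < d + \<epsilon> k" using J_close \<epsilon> by blast
  then obtain g where g: "\<And>k. g k \<in> S" "\<And>k. J (g k) < d + \<epsilon> k" by metis
  define h where "h = (\<lambda>k x. f x - g k x)"
  have [measurable]: "g k \<in> borel_measurable M" for k using g S_measurable by blast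
  have h_meas [measurable]: "h k \<in> borel_measurable M" for k unfolding h_def by measurable
  have fg_int: "integrable M (\<lambda>x. norm (f x - s x) ^ ?n)" if "s \<in> S" for s
    using power_add_integrable[OF f S_measurable[OF S_scale[OF that, of "-1"]] fint S_power_integrable[OF S_scale[OF that, of "-1"]]]
    by simp
  have h_int: "integrable M (\<lambda>x. norm (h k x) ^ ?n)" for k unfolding h_def by (rule fg_int[OF g(1)])
  have fast: "(\<integral>x. norm (h (Suc k) x - h k x) ^ ?n \<partial>M) \<le> (1 / 2 ^ Suc ?n) ^ k" for k
  proof -
    define mid where "mid = (\<lambda>x. (1/2) * g (Suc k) x + (1/2) * g k x)"
    have mid: "mid \<in> S" unfolding mid_def by (intro S_add_scale S_scale g)
    have mid_eq: "(h (Suc k) x + h k x) / 2 = f x - mid x" for x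
      by (simp add: h_def mid_def field_simps)
    have dint: "integrable M (\<lambda>x. norm (h (Suc k) x - h k x) ^ ?n)"
      using S_power_integrable[OF S_add_scale[OF g(1)[of k] g(1)[of "Suc k"], of "-1"]] by (simp add: h_def)
    have dint2: "integrable M (\<lambda>x. norm ((h (Suc k) x - h k x) / 2) ^ ?n)"
      using dint by (simp add: norm_divide power_divide)
    have "(\<integral>x. norm ((h (Suc k) x - h k x) / 2) ^ ?n \<partial>M) + J mid
        = (\<integral>x. norm ((h (Suc k) x - h k x) / 2) ^ ?n + norm ((h (Suc k) x + h k x) / 2) ^ ?n \<partial>M)"
      unfolding mid_eq J_def using dint2 fg_int[OF mid] by (subst Bochner_Integration.integral_add) auto
    also have "\<dots> \<le> (\<integral>x. (norm (h (Suc k) x) ^ ?n + norm (h k x) ^ ?n) / 2 \<partial>M)"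
    proof (rule integral_mono)
      show "integrable M (\<lambda>x. norm ((h (Suc k) x - h k x) / 2) ^ ?n + norm ((h (Suc k) x + h k x) / 2) ^ ?n)"
        unfolding mid_eq using dint2 fg_int[OF mid] by (rule Bochner_Integration.integrable_add)
    qed (use clarkson_even[OF m] h_int in auto)
    also have "\<dots> = (J (g (Suc k)) + J (g k)) / 2"
      unfolding J_def using h_int by (simp add: h_def)
    also have "\<dots> \<le> ((d + \<epsilon> k) + (d + \<epsilon> k)) / 2"
    proof (intro divide_right_mono add_mono)
      show "J (g (Suc k)) \<le> d + \<epsilon> k"
        using less_imp_le[OF g(2)[of "Suc k"]] add_left_mono[OF \<epsilon>(2)[of k]] by (rule order_trans)
    qed (use less_imp_le[OF g(2)[of k]] in auto)
    also have "\<dots> = d + \<epsilon> k" by simp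
    finally have "(\<integral>x. norm ((h (Suc k) x - h k x) / 2) ^ ?n \<partial>M) \<le> \<epsilon> k" using d_le[OF mid] by simp
    then show ?thesis by (simp add: norm_divide power_divide \<epsilon>_def field_simps)
  qed
  obtain l W where l [measurable]: "l \<in> borel_measurable M" and W: "integrable M W"
    and lim: "AE x in M. (\<lambda>k. h k x) \<longlonglongrightarrow> l x" and dom: "AE x in M. \<forall>k. norm (h k x) ^ ?n \<le> W x"
    using dominated_limit_of_fast_cauchy[of ?n h M, OF _ h_meas h_int fast] m by auto
  have lim_s: "integrable M (\<lambda>x. norm (l x + s x) ^ ?n)"
    "(\<lambda>k. \<integral>x. norm (h k x + s x) ^ ?n \<partial>M) \<longlonglongrightarrow> (\<integral>x. norm (l x + s x) ^ ?n \<partial>M)" if s: "s \<in> S" for s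
  proof -
    have [measurable]: "s \<in> borel_measurable M" by (rule S_measurable[OF s])
    have 1: "integrable M (\<lambda>x. 2 ^ ?n * (W x + norm (s x) ^ ?n))" using W S_power_integrable[OF s] by auto
    have 2: "AE x in M. (\<lambda>k. norm (h k x + s x) ^ ?n) \<longlonglongrightarrow> norm (l x + s x) ^ ?n"
      using lim by eventually_elim (intro tendsto_intros)
    have 3: "AE x in M. norm (norm (h k x + s x) ^ ?n) \<le> 2 ^ ?n * (W x + norm (s x) ^ ?n)" for k
      using dom
    proof eventually_elim
      fix x assume "\<forall>k. norm (h k x) ^ ?n \<le> W x"
      then have "2 ^ ?n * (norm (h k x) ^ ?n + norm (s x) ^ ?n) \<le> 2 ^ ?n * (W x + norm (s x) ^ ?n)"
        by (intro mult_left_mono add_right_mono) auto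
      moreover have "norm (h k x + s x) ^ ?n \<le> 2 ^ ?n * (norm (h k x) ^ ?n + norm (s x) ^ ?n)"
        by (rule order_trans[OF power_mono[OF norm_triangle_ineq] power_add_le_two_power]) auto
      ultimately have "norm (h k x + s x) ^ ?n \<le> 2 ^ ?n * (W x + norm (s x) ^ ?n)" by (rule order_trans[rotated])
      then show "norm (norm (h k x + s x) ^ ?n) \<le> 2 ^ ?n * (W x + norm (s x) ^ ?n)" by simp
    qed
    show "integrable M (\<lambda>x. norm (l x + s x) ^ ?n)"
      by (rule integrable_dominated_convergence[OF _ _ 1 2 3]) measurable
    show "(\<lambda>k. \<integral>x. norm (h k x + s x) ^ ?n \<partial>M) \<longlonglongrightarrow> (\<integral>x. norm (l x + s x) ^ ?n \<partial>M)"
      by (rule integral_dominated_convergence[OF _ _ 1 2 3]) measurable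
  qed
  have "(\<lambda>k. J (g k)) \<longlonglongrightarrow> d"
  proof (rule tendsto_sandwich)
    show "\<forall>\<^sub>F k in sequentially. d \<le> J (g k)" using d_le g(1) by auto
    show "\<forall>\<^sub>F k in sequentially. J (g k) \<le> d + \<epsilon> k" using g(2) by (auto intro!: always_eventually less_imp_le)
    have "(1 / 2 :: real) ^ Suc ?n < 1" by (rule power_Suc_less_one) auto
    then have "norm (1 / 2 ^ Suc ?n :: real) < 1" by (simp only: power_one_over) simp
    then have "(\<lambda>k. (1 / 2 ^ Suc ?n :: real) ^ k) \<longlonglongrightarrow> 0" by (rule LIMSEQ_power_zero)
    then have "(\<lambda>k. d + (1 / 2 ^ Suc ?n) ^ k / 2 ^ ?n) \<longlonglongrightarrow> d + 0 / 2 ^ ?n"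
      by (intro tendsto_add tendsto_const tendsto_divide) auto
    then show "(\<lambda>k. d + \<epsilon> k) \<longlonglongrightarrow> d" by (simp add: \<epsilon>_def del: power_Suc)
  qed auto
  moreover have "(\<lambda>k. J (g k)) \<longlonglongrightarrow> (\<integral>x. norm (l x) ^ ?n \<partial>M)"
    using lim_s(2)[OF S_zero] by (simp add: J_def h_def)
  ultimately have l_d: "(\<integral>x. norm (l x) ^ ?n \<partial>M) = d" using LIMSEQ_unique by blast
  show thesis
  proof
    show "integrable M (\<lambda>x. norm (l x) ^ ?n)" using lim_s(1)[OF S_zero] by simp
    show "\<exists>g\<in>S. (\<integral>x. norm (f x - g x) ^ ?n \<partial>M) < (\<integral>x. norm (l x) ^ ?n \<partial>M) + e" if "e > 0" for e
      using J_close[OF that] by (simp add: l_d J_def)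
    fix s assume s: "s \<in> S"
    have "d \<le> (\<integral>x. norm (h k x + s x) ^ ?n \<partial>M)" for k
      using d_le[OF S_add_scale[OF g(1)[of k] s, of "-1"]] by (simp add: J_def h_def algebra_simps)
    then show "(\<integral>x. norm (l x) ^ ?n \<partial>M) \<le> (\<integral>x. norm (l x + s x) ^ ?n \<partial>M)"
      unfolding l_d by (intro LIMSEQ_le_const[OF lim_s(2)[OF s]]) auto
  qed (rule l)
qed

text \<open>The first variation in direction \<open>s\<close> is one-sided: letting \<open>t\<close>
  decrease to 0 gives a nonnegative real part. Complex multiples of \<open>s\<close> then force the
  integral itself to vanish.\<close>

lemma nearest_point_orthogonal:
  fixes h :: "'a \<Rightarrow> complex"
  assumes m: "m \<ge> 1" and h [measurable]: "h \<in> borel_measurable M"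
    and hint: "integrable M (\<lambda>x. norm (h x) ^ (2 * m))"
    and min: "\<And>s. s \<in> S \<Longrightarrow> (\<integral>x. norm (h x) ^ (2 * m) \<partial>M) \<le> (\<integral>x. norm (h x + s x) ^ (2 * m) \<partial>M)"
    and s: "s \<in> S"
  shows "(\<integral>x. s x * (of_real (norm (h x) ^ (2 * m - 2)) * cnj (h x)) \<partial>M) = 0"
proof -
  define H where "H = (\<lambda>x. complex_of_real (norm (h x) ^ (2 * m - 2)) * cnj (h x))"
  have [measurable]: "(\<lambda>x. cnj (h x)) \<in> borel_measurable M"
    by (rule measurable_compose[OF h]) (intro borel_measurable_continuous_onI continuous_intros)
  have [measurable]: "H \<in> borel_measurable M" unfolding H_def by measurable
  have main: "integrable M (\<lambda>x. s x * H x) \<and> 0 \<le> Re (\<integral>x. s x * H x \<partial>M)" if s: "s \<in> S" for s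
  proof -
    obtain B0 where B0: "\<And>x. norm (s x) \<le> B0" using S_bounded[OF s] by blast
    define B where "B = max B0 0"
    have B: "\<And>x. norm (s x) \<le> B" "0 \<le> B" using B0 by (auto simp: B_def intro: max.coboundedI1)
    have [measurable]: "s \<in> borel_measurable M" by (rule S_measurable[OF s])
    define w where "w = (\<lambda>x. (norm (h x) + B) ^ (2 * m))"
    have w_int: "integrable M w"
    proof -
      have "integrable M (\<lambda>x. norm (of_real (norm (h x)) + of_real B :: complex) ^ (2 * m))"
        using hint by (intro power_add_integrable) auto
      moreover have "norm (of_real (norm (h x)) + of_real B :: complex) = norm (h x) + B" for x
        using B(2) by (simp flip: of_real_add)
      ultimately show ?thesis by (simp add: w_def)
    qed
    have hB: "norm (h x) \<le> norm (h x) + B" "0 \<le> norm (h x) + B" for x using B(2) by auto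
    \<comment> \<open>The tangent to \<open>u ^ m\<close> is taken at the perturbed point, so that
      \<open>m * t * q t x\<close> bounds the increment from above. Continuity of \<open>q\<close>
      in \<open>t\<close> and a majorant then replace differentiation under the integral.\<close>
    define q where "q = (\<lambda>(t::real) x. norm (h x + of_real t * s x) ^ (2 * (m - 1))
      * (2 * Re (cnj (h x) * s x) + t * (norm (s x))\<^sup>2))"
    have [measurable]: "q t \<in> borel_measurable M" for t unfolding q_def by measurable
    have norm_sq: "(norm (h x + of_real t * s x))\<^sup>2 = (norm (h x))\<^sup>2 + t * (2 * Re (cnj (h x) * s x) + t * (norm (s x))\<^sup>2)"
      for t x
      unfolding cmod_power2 by (simp add: algebra_simps power2_eq_square)
    have w_eq: "(norm (h x) + B) ^ (2 * (m - 1)) * (norm (h x) + B)\<^sup>2 = w x" for x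
      using m by (cases m) (simp_all add: w_def power2_eq_square)
    have q_bound: "\<bar>q t x\<bar> \<le> 2 * w x" if t: "0 \<le> t" "t \<le> 1" for t x
    proof -
      have ts: "norm (of_real t * s x) \<le> B"
        using mult_mono[OF t(2) B(1)[of x]] t by (simp add: norm_mult)
      have n1: "norm (h x + of_real t * s x) \<le> norm (h x) + B"
        using norm_triangle_ineq[of "h x" "of_real t * s x"] ts by linarith
      have "\<bar>Re (cnj (h x) * s x)\<bar> \<le> norm (h x) * norm (s x)"
        using abs_Re_le_cmod[of "cnj (h x) * s x"] by (simp add: norm_mult)
      also have "\<dots> \<le> norm (h x) * B" by (intro mult_left_mono B) auto
      finally have r: "\<bar>Re (cnj (h x) * s x)\<bar> \<le> norm (h x) * B" .
      have "t * (norm (s x))\<^sup>2 \<le> 1 * B\<^sup>2" using t B by (intro mult_mono power_mono) auto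
      moreover have "0 \<le> t * (norm (s x))\<^sup>2" using t by simp
      ultimately have "\<bar>2 * Re (cnj (h x) * s x) + t * (norm (s x))\<^sup>2\<bar> \<le> 2 * (norm (h x) * B) + B\<^sup>2"
        using r by (auto simp: abs_le_iff)
      also have "\<dots> \<le> 2 * (norm (h x) + B)\<^sup>2"
        using B(2) by (simp add: power2_sum)
      finally have "\<bar>q t x\<bar> \<le> (norm (h x) + B) ^ (2 * (m - 1)) * (2 * (norm (h x) + B)\<^sup>2)"
        unfolding q_def abs_mult using n1 B(2) by (intro mult_mono) (auto intro!: power_mono)
      then show ?thesis using w_eq[of x] by simp
    qed
    have q_int: "integrable M (q t)" if "0 \<le> t" "t \<le> 1" for t
    proof (rule Bochner_Integration.integrable_bound)
      show "integrable M (\<lambda>x. 2 * w x)" using w_int by simp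
      show "AE x in M. norm (q t x) \<le> norm (2 * w x)"
        using q_bound[OF that] by (intro AE_I2) (auto intro: order_trans[OF _ abs_ge_self])
    qed measurable
    have q_nonneg: "0 \<le> (\<integral>x. q t x \<partial>M)" if t: "0 < t" "t \<le> 1" for t
    proof -
      have ts: "(\<lambda>x. of_real t * s x) \<in> S" by (rule S_scale[OF s])
      have hts: "integrable M (\<lambda>x. norm (h x + of_real t * s x) ^ (2 * m))"
        by (rule power_add_integrable[OF h S_measurable[OF ts] hint S_power_integrable[OF ts]])
      have le: "norm (h x + of_real t * s x) ^ (2 * m) - norm (h x) ^ (2 * m) \<le> m * t * q t x" for x
      proof -
        define u v where "u = (norm (h x))\<^sup>2" and "v = (norm (h x + of_real t * s x))\<^sup>2"
        have "v ^ m - u ^ m \<le> m * v ^ (m - 1) * (v - u)"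
          using power_above_tangent[of u v m] by (simp add: u_def v_def algebra_simps)
        also have "v - u = t * (2 * Re (cnj (h x) * s x) + t * (norm (s x))\<^sup>2)"
          unfolding u_def v_def norm_sq by simp
        also have "m * v ^ (m - 1) * (t * (2 * Re (cnj (h x) * s x) + t * (norm (s x))\<^sup>2)) = m * t * q t x"
          by (simp add: q_def v_def mult_ac flip: power_mult)
        finally show ?thesis by (simp add: u_def v_def flip: power_mult)
      qed
      have "0 \<le> (\<integral>x. norm (h x + of_real t * s x) ^ (2 * m) - norm (h x) ^ (2 * m) \<partial>M)"
        using min[OF ts] hts hint by simp
      also have "\<dots> \<le> (\<integral>x. m * t * q t x \<partial>M)"
        using le hts hint q_int[of t] t by (intro integral_mono) auto
      finally have "0 \<le> (m * t) * (\<integral>x. q t x \<partial>M)" by simp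
      moreover have "0 < m * t" using m t by simp
      ultimately show ?thesis by (simp only: zero_le_mult_iff) linarith
    qed
    have "(\<lambda>k. \<integral>x. q (1 / Suc k) x \<partial>M) \<longlonglongrightarrow> (\<integral>x. q 0 x \<partial>M)"
    proof (rule integral_dominated_convergence[where w = "\<lambda>x. 2 * w x"])
      show "integrable M (\<lambda>x. 2 * w x)" using w_int by simp
      show "AE x in M. norm (q (1 / Suc k) x) \<le> 2 * w x" for k
        using q_bound[of "1 / Suc k"] by (intro AE_I2) auto
      have "(\<lambda>k. 1 / real (Suc k)) \<longlonglongrightarrow> 0" by real_asymp
      then show "AE x in M. (\<lambda>k. q (1 / Suc k) x) \<longlonglongrightarrow> q 0 x"
        unfolding q_def by (intro AE_I2 tendsto_intros)
    qed measurable
    then have q0_nonneg: "0 \<le> (\<integral>x. q 0 x \<partial>M)"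
      using q_nonneg by (intro LIMSEQ_le_const) auto
    have q0: "q 0 x = 2 * Re (s x * H x)" for x
    proof -
      have "2 * m - 2 = 2 * (m - 1)" by simp
      then have "s x * H x = of_real (norm (h x) ^ (2 * (m - 1))) * (cnj (h x) * s x)"
        by (simp only: H_def mult_ac)
      then have "Re (s x * H x) = norm (h x) ^ (2 * (m - 1)) * Re (cnj (h x) * s x)"
        by (simp only: Re_complex_of_real Im_complex_of_real times_complex.sel)
      then show ?thesis by (simp add: q_def)
    qed
    have sH: "integrable M (\<lambda>x. s x * H x)"
    proof (rule Bochner_Integration.integrable_bound[OF w_int])
      have "norm (s x * H x) \<le> w x" for x
      proof -
        have "norm (s x * H x) = norm (h x) ^ (2 * (m - 1)) * (norm (h x) * norm (s x))"
          by (simp add: H_def norm_mult norm_power diff_mult_distrib2 mult_ac)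
        also have "\<dots> \<le> (norm (h x) + B) ^ (2 * (m - 1)) * ((norm (h x) + B) * (norm (h x) + B))"
          using B hB by (intro mult_mono power_mono) (auto intro: add_increasing)
        finally show ?thesis using w_eq[of x] by (simp add: power2_eq_square)
      qed
      then show "AE x in M. norm (s x * H x) \<le> norm (w x)"
        by (intro AE_I2) (auto intro: order_trans[OF _ abs_ge_self])
    qed measurable
    have "(\<integral>x. q 0 x \<partial>M) = 2 * Re (\<integral>x. s x * H x \<partial>M)"
      unfolding q0 integral_Re[OF sH, symmetric] by (rule integral_mult_right_zero)
    with q0_nonneg sH show ?thesis by simp
  qed
  define z where "z = (\<integral>x. s x * H x \<partial>M)"
  \<comment> \<open>The factor \<open>- cnj z\<close> turns the integral into
    \<open>- |z|^2\<close>.\<close>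
  have "0 \<le> Re (\<integral>x. (- cnj z * s x) * H x \<partial>M)" using main[OF S_scale[OF s]] by blast
  also have "(\<integral>x. (- cnj z * s x) * H x \<partial>M) = - cnj z * z"
    unfolding z_def mult.assoc by (rule integral_mult_right_zero)
  also have "Re (- cnj z * z) = - (norm z)\<^sup>2"
    unfolding cmod_power2 by (simp add: power2_eq_square)
  finally have "z = 0" by simp
  then show ?thesis by (simp add: z_def H_def)
qed

text \<open>The residual \<open>h\<close> gives an annihilator \<open>H\<close> with
  \<open>|H| = |h|^(2 m - 1)\<close>. A crude Young inequality makes \<open>w * |H|\<close>
  integrable from the \<open>2 m\<close>-th powers of \<open>w\<close> and \<open>h\<close>, so
  \<open>unique\<close> applies; then \<open>h = 0\<close> almost everywhere and the distance is
  0.\<close>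

lemma even_power_approximation:
  fixes f :: "'a \<Rightarrow> complex" and w :: "'a \<Rightarrow> real"
  assumes m: "m \<ge> 1" and w [measurable]: "w \<in> borel_measurable M"
    and w_nonneg: "\<And>x. 0 \<le> w x" and w_int: "integrable M (\<lambda>x. w x ^ (2 * m))"
    and unique: "\<And>H. integrable M H \<Longrightarrow> integrable M (\<lambda>x. w x * norm (H x)) \<Longrightarrow>
      (\<And>s. s \<in> S \<Longrightarrow> (\<integral>x. s x * H x \<partial>M) = 0) \<Longrightarrow> AE x in M. H x = 0"
    and f: "f \<in> borel_measurable M" and fint: "integrable M (\<lambda>x. norm (f x) ^ (2 * m))" and e: "e > 0"
  shows "\<exists>g\<in>S. (\<integral>x. norm (f x - g x) ^ (2 * m) \<partial>M) < e"
proof -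
  obtain h where h [measurable]: "h \<in> borel_measurable M" and hint: "integrable M (\<lambda>x. norm (h x) ^ (2 * m))"
    and min: "\<And>s. s \<in> S \<Longrightarrow> (\<integral>x. norm (h x) ^ (2 * m) \<partial>M) \<le> (\<integral>x. norm (h x + s x) ^ (2 * m) \<partial>M)"
    and close: "\<And>\<epsilon>. \<epsilon> > 0 \<Longrightarrow> \<exists>g\<in>S. (\<integral>x. norm (f x - g x) ^ (2 * m) \<partial>M) < (\<integral>x. norm (h x) ^ (2 * m) \<partial>M) + \<epsilon>"
    using nearest_point_exists[OF m f fint] by blast
  define H where "H = (\<lambda>x. complex_of_real (norm (h x) ^ (2 * m - 2)) * cnj (h x))"
  have [measurable]: "(\<lambda>x. cnj (h x)) \<in> borel_measurable M"
    by (rule measurable_compose[OF h]) (intro borel_measurable_continuous_onI continuous_intros)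
  have H_meas [measurable]: "H \<in> borel_measurable M" unfolding H_def by measurable
  have norm_H: "norm (H x) = norm (h x) ^ (2 * m - 1)" for x
    using m by (cases m) (simp_all add: H_def norm_mult norm_power)
  have young: "a * b ^ (2 * m - 1) \<le> a ^ (2 * m) + b ^ (2 * m)" if "0 \<le> a" "0 \<le> b" for a b :: real
  proof -
    have "a * b ^ (2 * m - 1) \<le> max a b * max a b ^ (2 * m - 1)"
      using that by (intro mult_mono power_mono) auto
    also have "\<dots> = max a b ^ (2 * m)" using m by (cases m) auto
    also have "\<dots> \<le> a ^ (2 * m) + b ^ (2 * m)" using that by (auto simp: max_def)
    finally show ?thesis .
  qed
  have wH: "integrable M (\<lambda>x. v x * norm (H x))"
    if [measurable]: "v \<in> borel_measurable M" and v: "\<And>x. 0 \<le> v x" "integrable M (\<lambda>x. v x ^ (2 * m))" for v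
  proof (rule Bochner_Integration.integrable_bound)
    show "integrable M (\<lambda>x. v x ^ (2 * m) + norm (h x) ^ (2 * m))" using v hint by auto
    show "AE x in M. norm (v x * norm (H x)) \<le> norm (v x ^ (2 * m) + norm (h x) ^ (2 * m))"
      using young[OF v(1) norm_ge_zero] v(1) by (intro AE_I2) (simp add: norm_H abs_mult)
  qed measurable
  have "AE x in M. H x = 0"
  proof (rule unique)
    have "integrable M (\<lambda>x. 1 * norm (H x))" by (rule wH) auto
    then show "integrable M H" by (simp add: integrable_norm_iff)
    show "integrable M (\<lambda>x. w x * norm (H x))" using w w_nonneg w_int by (rule wH)
    show "(\<integral>x. s x * H x \<partial>M) = 0" if "s \<in> S" for s
      unfolding H_def by (rule nearest_point_orthogonal[OF m h hint min that])
  qed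
  then have "AE x in M. norm (h x) ^ (2 * m) = 0"
    by eventually_elim (use m in \<open>auto simp: H_def\<close>)
  then have "(\<integral>x. norm (h x) ^ (2 * m) \<partial>M) = 0"
    by (subst integral_cong_AE[where g = "\<lambda>_. 0"]) auto
  then show ?thesis using close[OF e] by simp
qed

end

lemma powr_add_le_two_powr:
  fixes a b p :: real
  assumes "0 \<le> a" "0 \<le> b" "0 < p"
  shows "(a + b) powr p \<le> 2 powr p * (a powr p + b powr p)"
proof -
  have "(a + b) powr p \<le> (2 * max a b) powr p" using assms by (intro powr_mono2) auto
  also have "\<dots> = 2 powr p * max a b powr p" using assms by (intro powr_mult)
  also have "max a b powr p \<le> a powr p + b powr p" using assms by (auto simp: max_def)
  finally show ?thesis by simp
qed

text \<open>Above the threshold, \<open>x powr p\<close> equals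
  \<open>(x powr p) powr (1 - n / p) * x ^ n\<close>, and the exponent \<open>1 - n / p\<close> is
  nonpositive. On a finite measure space this passes from exponent \<open>n\<close> down to
  \<open>p\<close>, the threshold costing \<open>\<eta>\<close> times the total mass.\<close>

lemma powr_le_threshold_plus_power:
  fixes x p \<eta> :: real
  assumes x: "0 \<le> x" and p: "0 < p" "p \<le> real n" and \<eta>: "0 < \<eta>"
  shows "x powr p \<le> \<eta> + \<eta> powr (1 - n / p) * x ^ n"
proof (cases "x powr p \<le> \<eta>")
  case True
  then show ?thesis using x \<eta> by (intro add_increasing2) auto
next
  case False
  then have x0: "x > 0" using x \<eta> p by (cases "x = 0") auto
  have n: "x ^ n = (x powr p) powr (n / p)" using x0 p by (simp add: powr_powr powr_realpow)
  have "(x powr p) powr (1 - n / p) \<le> \<eta> powr (1 - n / p)"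
    using False p \<eta> by (intro powr_mono2') (auto simp: field_simps)
  then have "(x powr p) powr (1 - n / p) * x ^ n \<le> \<eta> powr (1 - n / p) * x ^ n"
    using x by (intro mult_right_mono) auto
  moreover have "(x powr p) powr (1 - n / p) * x ^ n = x powr p"
    using x0 unfolding n by (simp flip: powr_add)
  ultimately show ?thesis using \<eta> by simp
qed

context bounded_function_space
begin

lemma S_subset_Lp_space: "0 < p \<Longrightarrow> S \<subseteq> Lp_space p M"
proof
  fix s assume p: "0 < p" and s: "s \<in> S"
  obtain B where B: "\<And>x. norm (s x) \<le> B" using S_bounded[OF s] by blast
  have [measurable]: "s \<in> borel_measurable M" by (rule S_measurable[OF s])
  have "integrable M (\<lambda>x. norm (s x) powr p)"
    by (rule integrable_const_bound[where B = "B powr p"]) (use B p in \<open>auto intro!: powr_mono2 AE_I2\<close>)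
  then show "s \<in> Lp_space p M" by (simp add: Lp_space_def)
qed

lemma dense_in_LpI:
  fixes w :: "'a \<Rightarrow> real"
  assumes m: "m \<ge> 1" and p: "0 < p" "p \<le> real (2 * m)" and w: "w \<in> borel_measurable M"
    and w_nonneg: "\<And>x. 0 \<le> w x" and w_int: "integrable M (\<lambda>x. w x ^ (2 * m))"
    and unique: "\<And>H. integrable M H \<Longrightarrow> integrable M (\<lambda>x. w x * norm (H x)) \<Longrightarrow>
      (\<And>s. s \<in> S \<Longrightarrow> (\<integral>x. s x * H x \<partial>M) = 0) \<Longrightarrow> AE x in M. H x = 0"
  shows "dense_in_Lp p M S"
  unfolding dense_in_Lp_def
proof (intro conjI ballI allI impI S_subset_Lp_space p(1))
  fix f and \<epsilon> :: real
  assume "f \<in> Lp_space p M" and \<epsilon>: "0 < \<epsilon>"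
  then have f [measurable]: "f \<in> borel_measurable M" and fp: "integrable M (\<lambda>x. norm (f x) powr p)"
    by (auto simp: Lp_space_def)
  \<comment> \<open>The denominator is the constant of \<open>powr_add_le_two_powr\<close>;
    truncation and approximation each get \<open>c / 2\<close>.\<close>
  define c where "c = \<epsilon> powr p / 2 powr p"
  have c: "c > 0" using \<epsilon> by (simp add: c_def)
  define fN where "fN = (\<lambda>N x. if norm (f x) \<le> real N then f x else 0)"
  have [measurable]: "fN N \<in> borel_measurable M" for N unfolding fN_def by measurable
  have fN_le: "norm (f x - fN N x) \<le> norm (f x)" "norm (fN N x) \<le> real N" for N x
    by (auto simp: fN_def)
  have diff_int: "integrable M (\<lambda>x. norm (f x - fN N x) powr p)" for N
    by (rule Bochner_Integration.integrable_bound[OF fp]) (use fN_le p in \<open>auto intro!: powr_mono2\<close>)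
  have "(\<lambda>N. \<integral>x. norm (f x - fN N x) powr p \<partial>M) \<longlonglongrightarrow> (\<integral>x. 0 \<partial>M)"
  proof (rule integral_dominated_convergence[OF _ _ fp])
    show "AE x in M. (\<lambda>N. norm (f x - fN N x) powr p) \<longlonglongrightarrow> 0"
    proof (rule AE_I2)
      fix x
      obtain N0 where "norm (f x) \<le> real N0" using real_arch_simple by blast
      then have "\<forall>N\<ge>N0. norm (f x - fN N x) powr p = 0" using p by (auto simp: fN_def)
      then show "(\<lambda>N. norm (f x - fN N x) powr p) \<longlonglongrightarrow> 0"
        by (intro tendsto_eventually) (auto simp: eventually_sequentially)
    qed
    show "AE x in M. norm (norm (f x - fN N x) powr p) \<le> norm (f x) powr p" for N
      using fN_le p by (intro AE_I2) (auto intro!: powr_mono2)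
  qed measurable
  then have "\<forall>\<^sub>F N in sequentially. (\<integral>x. norm (f x - fN N x) powr p \<partial>M) < c / 2"
    using c by (intro order_tendstoD(2)[of _ 0]) auto
  then obtain N where N: "(\<integral>x. norm (f x - fN N x) powr p \<partial>M) < c / 2"
    by (auto simp: eventually_sequentially)
  define \<mu> where "\<mu> = measure M (space M)"
  \<comment> \<open>Below the threshold the error is at most
    \<open>\<eta> * \<mu> \<le> c / 4\<close>, and the \<open>2 m\<close>-th moment supplies the
    other quarter. Adding 1 avoids dividing by 0 for the null measure.\<close>
  define \<eta> where "\<eta> = c / (4 * (\<mu> + 1))"
  have \<mu>: "0 \<le> \<mu>" by (simp add: \<mu>_def)
  have \<eta>: "0 < \<eta>" "\<eta> * \<mu> \<le> c / 4"
  proof -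
    show "0 < \<eta>" using c \<mu> by (simp add: \<eta>_def)
    then have "\<eta> * \<mu> \<le> \<eta> * (\<mu> + 1)" by (intro mult_left_mono) auto
    also have "\<dots> = c / 4" using \<mu> by (simp add: \<eta>_def field_simps)
    finally show "\<eta> * \<mu> \<le> c / 4" .
  qed
  define K where "K = \<eta> powr (1 - real (2 * m) / p)"
  have K: "K > 0" using \<eta> by (simp add: K_def)
  have fN_int: "integrable M (\<lambda>x. norm (fN N x) ^ (2 * m))"
    by (rule integrable_const_bound[where B = "real N ^ (2 * m)"]) (use fN_le in \<open>auto intro!: power_mono AE_I2\<close>)
  have "\<exists>g\<in>S. (\<integral>x. norm (fN N x - g x) ^ (2 * m) \<partial>M) < c / (4 * K)"
  proof (rule even_power_approximation[OF m w w_nonneg w_int _ _ fN_int])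
    show "AE x in M. H x = 0" if "integrable M H" "integrable M (\<lambda>x. w x * norm (H x))"
      "\<And>s. s \<in> S \<Longrightarrow> (\<integral>x. s x * H x \<partial>M) = 0" for H
      using that by (rule unique)
  qed (use c K in auto)
  then obtain g where g: "g \<in> S" and close: "(\<integral>x. norm (fN N x - g x) ^ (2 * m) \<partial>M) < c / (4 * K)"
    by blast
  have [measurable]: "g \<in> borel_measurable M" by (rule S_measurable[OF g])
  have power_int: "integrable M (\<lambda>x. norm (fN N x - g x) ^ (2 * m))"
    using power_add_integrable[of "fN N" "\<lambda>x. - 1 * g x" "2 * m"] fN_int S_power_integrable[OF S_scale[OF g, of "- 1"]]
    by simp
  have majorant_int: "integrable M (\<lambda>x. \<eta> + K * norm (fN N x - g x) ^ (2 * m))"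
    using power_int by simp
  have le1: "norm (fN N x - g x) powr p \<le> \<eta> + K * norm (fN N x - g x) ^ (2 * m)" for x
    unfolding K_def by (rule powr_le_threshold_plus_power) (use p \<eta> in auto)
  have p_int: "integrable M (\<lambda>x. norm (fN N x - g x) powr p)"
    by (rule Bochner_Integration.integrable_bound[OF majorant_int])
       (use le1 in \<open>auto intro!: AE_I2 order_trans[OF _ abs_ge_self]\<close>)
  have "(\<integral>x. norm (fN N x - g x) powr p \<partial>M) \<le> (\<integral>x. \<eta> + K * norm (fN N x - g x) ^ (2 * m) \<partial>M)"
    by (intro integral_mono p_int majorant_int le1)
  also have "\<dots> = \<eta> * \<mu> + K * (\<integral>x. norm (fN N x - g x) ^ (2 * m) \<partial>M)"
    using power_int by (simp add: \<mu>_def mult.commute)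
  also have "\<dots> < c / 4 + K * (c / (4 * K))"
    using \<eta>(2) close K by (intro add_le_less_mono mult_strict_left_mono)
  also have "\<dots> = c / 2" using K by simp
  finally have less: "(\<integral>x. norm (fN N x - g x) powr p \<partial>M) < c / 2" .
  have "(\<integral>x. norm (f x - g x) powr p \<partial>M)
      \<le> (\<integral>x. 2 powr p * (norm (f x - fN N x) powr p + norm (fN N x - g x) powr p) \<partial>M)"
  proof (rule integral_mono')
    show "integrable M (\<lambda>x. 2 powr p * (norm (f x - fN N x) powr p + norm (fN N x - g x) powr p))"
      using diff_int p_int by simp
    fix x
    have "norm (f x - g x) powr p \<le> (norm (f x - fN N x) + norm (fN N x - g x)) powr p"
      using p norm_triangle_ineq[of "f x - fN N x" "fN N x - g x"] by (intro powr_mono2) auto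
    also have "\<dots> \<le> 2 powr p * (norm (f x - fN N x) powr p + norm (fN N x - g x) powr p)"
      using p by (intro powr_add_le_two_powr) auto
    finally show "norm (f x - g x) powr p \<le> 2 powr p * (norm (f x - fN N x) powr p + norm (fN N x - g x) powr p)" .
  qed auto
  also have "\<dots> = 2 powr p * ((\<integral>x. norm (f x - fN N x) powr p \<partial>M) + (\<integral>x. norm (fN N x - g x) powr p \<partial>M))"
    using diff_int p_int by simp
  also have "\<dots> < 2 powr p * c" using N less by (intro mult_strict_left_mono) auto
  also have "\<dots> = \<epsilon> powr p" by (simp add: c_def)
  finally have "(\<integral>x. norm (f x - g x) powr p \<partial>M) powr (1 / p) < (\<epsilon> powr p) powr (1 / p)"
    using p by (intro powr_less_mono2 Bochner_Integration.integral_nonneg) auto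
  then have "Lp_norm p M (\<lambda>x. f x - g x) < \<epsilon>"
    using \<epsilon> p by (simp add: Lp_norm_def powr_powr)
  with g show "\<exists>g\<in>S. Lp_norm p M (\<lambda>x. f x - g x) < \<epsilon>" by blast
qed

end

section \<open>Exponential sums\<close>

text \<open>Open boxes form an intersection-stable generator, and the sets with zero integral form a
  Dynkin system; taking every factor to be \<open>UNIV\<close> gives integral 0 for the whole space,
  hence for complements.\<close>

lemma set_integrals_zero_of_boxes:
  fixes H :: "real ^ 'n \<Rightarrow> complex"
  assumes sets: "sets M = sets borel" and H: "integrable M H"
    and box: "\<And>A :: 'n \<Rightarrow> real set. (\<And>j. A j \<in> sets borel) \<Longrightarrow>
      (\<integral>x. (\<Prod>j\<in>UNIV. indicator (A j) (x $ j)) * H x \<partial>M) = 0"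
    and B: "B \<in> sets M"
  shows "(\<integral>x. indicator B x * H x \<partial>M) = 0"
proof -
  have space: "space M = UNIV" using sets_eq_imp_space_eq[OF sets] by simp
  let ?G = "range (\<lambda>(a :: real ^ 'n, b). box a b)"
  have int: "integrable M (\<lambda>x. indicator A x * H x)" if [measurable]: "A \<in> sets M" for A
    using H by (rule Bochner_Integration.integrable_bound)
      (use H in \<open>auto simp: norm_mult indicator_def\<close>)
  have set_int: "(\<integral>x. indicator A x * H x \<partial>M) = (LINT x:A|M. H x)" for A
    unfolding set_lebesgue_integral_def
    by (intro Bochner_Integration.integral_cong refl) (simp add: indicator_def)
  have gen: "sets M = sigma_sets UNIV ?G"
    unfolding sets borel_eq_box by simp
  have stable: "Int_stable ?G"
  proof -
    have "box u v \<in> ?G" for u v :: "real ^ 'n" by (rule range_eqI[of _ _ "(u, v)"]) simp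
    then show ?thesis unfolding Int_stable_def by (auto simp: box_Int_box simp del: image_iff)
  qed
  have "?G \<subseteq> Pow UNIV" "B \<in> sigma_sets UNIV ?G" using B gen by simp_all
  with stable show ?thesis
  proof (induction rule: sigma_sets_induct_disjoint)
    case (basic A)
    then obtain a b where A: "A = box a b" by auto
    have "indicator A x = (\<Prod>j\<in>UNIV. indicator {a $ j<..<b $ j} (x $ j) :: complex)" for x
    proof (cases "x \<in> A")
      case False
      then obtain j where "\<not> (a $ j < x $ j \<and> x $ j < b $ j)" unfolding A mem_box_cart by blast
      then have "indicator {a $ j<..<b $ j} (x $ j) = (0 :: complex)" by simp
      then have "(\<Prod>j\<in>UNIV. indicator {a $ j<..<b $ j} (x $ j) :: complex) = 0"
        by (intro prod_zero) auto
      with False show ?thesis by simp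
    qed (simp add: A mem_box_cart)
    then show ?case using box[of "\<lambda>j. {a $ j<..<b $ j}"] by simp
  next
    case (compl A)
    have "(\<integral>x. H x \<partial>M) = 0" using box[of "\<lambda>_. UNIV"] by simp
    moreover have "A \<in> sets M" using compl.hyps gen by simp
    moreover have "indicator (UNIV - A) x * H x = H x - indicator A x * H x" for x
      by (simp add: indicator_def)
    ultimately show ?case using int[of A] H compl.IH by simp
  next
    case (union A)
    have A: "A i \<in> sets M" for i using union.hyps gen by auto
    have "set_integrable M (\<Union>i. A i) H"
      unfolding set_integrable_def
      by (rule Bochner_Integration.integrable_bound[OF H]) (use H A in \<open>auto simp: indicator_def\<close>)
    then have "(LINT x:(\<Union>i. A i)|M. H x) = (\<Sum>i. LINT x:A i|M. H x)"
      using A union.hyps by (intro lebesgue_integral_countable_add) (auto simp: disjoint_family_on_def)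
    then show ?case using union.IH by (simp add: set_int)
  qed (auto)
qed

text \<open>Induction on the set \<open>J\<close> of coordinates already treated. To add
  \<open>k\<close>, all other factors are absorbed into \<open>H'\<close>; as frequencies are
  arbitrary in the induction, the transform of \<open>H'\<close> in coordinate \<open>k\<close>
  vanishes on \<open>\<Lambda> k\<close>. The weight survives because a coordinate is at most the
  norm in modulus.\<close>

lemma exponential_annihilator_zero:
  fixes H :: "real ^ 'n \<Rightarrow> complex" and \<psi> :: "real \<Rightarrow> real" and \<Lambda> :: "'n \<Rightarrow> real set"
  assumes sets: "sets M = sets borel" and H: "integrable M H"
    and mono: "mono \<psi>" and nonneg: "\<And>x. 0 \<le> \<psi> x"
    and div: "(\<integral>\<^sup>+x\<in>{0..}. ennreal (\<psi> x / (1 + x\<^sup>2)) \<partial>lborel) = \<infinity>"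
    and wint: "integrable M (\<lambda>x. exp (\<psi> (norm x)) * norm (H x))"
    and \<Lambda>: "\<And>j. \<Lambda> j \<in> sets borel" "\<And>j. 0 < emeasure lborel (\<Lambda> j)"
    and zero: "\<And>l. (\<And>j. l $ j \<in> \<Lambda> j) \<Longrightarrow> (\<integral>x. expo l x * H x \<partial>M) = 0"
  shows "AE x in M. H x = 0"
proof -
  note [measurable_cong] = sets
  have [measurable]: "H \<in> borel_measurable M" using H by auto
  have [measurable]: "\<psi> \<in> borel_measurable borel" using mono by (rule borel_measurable_mono)
  have comp [measurable]: "(\<lambda>x :: real ^ 'n. x $ j) \<in> borel_measurable M" for j
    using borel_measurable_continuous_onI[of "\<lambda>x :: real ^ 'n. x $ j"] measurable_cong_sets[OF sets refl]
    by (auto intro!: continuous_intros)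
  have main: "(\<integral>x. (\<Prod>j\<in>J. indicator (A j) (x $ j)) * (\<Prod>j\<in>-J. exp (- (\<i> * complex_of_real (l j * x $ j)))) * H x \<partial>M) = 0"
    if "finite J" "\<And>j. A j \<in> sets borel" "\<And>j. l j \<in> \<Lambda> j" for J l and A :: "'n \<Rightarrow> real set"
    using that
  proof (induction J arbitrary: l rule: finite_induct)
    case empty
    have "expo (\<chi> j. l j) x = (\<Prod>j\<in>UNIV. exp (- (\<i> * complex_of_real (l j * x $ j))))" for x
      by (simp add: expo_def inner_vec_def exp_sum sum_negf sum_distrib_left flip: exp_sum)
    then show ?case using zero[of "\<chi> j. l j"] empty by simp
  next
    case (insert k J)
    note [measurable] = insert.prems(1)
    define H' where "H' = (\<lambda>x. (\<Prod>j\<in>J. indicator (A j) (x $ j))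
      * (\<Prod>j\<in>-insert k J. exp (- (\<i> * complex_of_real (l j * x $ j)))) * H x)"
    have H'_le: "norm (H' x) \<le> norm (H x)" for x
    proof -
      have "norm (\<Prod>j\<in>J. (indicator (A j) (x $ j) :: complex)) \<le> 1"
        unfolding prod_norm[symmetric] by (intro prod_le_1) (auto simp: indicator_def)
      moreover have "norm (\<Prod>j\<in>-insert k J. exp (- (\<i> * complex_of_real (l j * x $ j)))) = 1"
        unfolding prod_norm[symmetric] by (intro prod.neutral) auto
      ultimately show ?thesis by (simp add: H'_def norm_mult mult_left_le_one_le)
    qed
    have [measurable]: "H' \<in> borel_measurable M" unfolding H'_def by measurable
    have H'_int: "integrable M H'"
      by (rule Bochner_Integration.integrable_bound[OF H]) (use H'_le in auto)
    \<comment> \<open>\<open>expo\<close> carries the opposite sign in the exponent, so the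
      one-variable result is applied to \<open>- x $ k\<close> and the reflected set.\<close>
    have "(\<integral>x. indicator (uminus -` A k) (- x $ k) * H' x \<partial>M) = 0"
    proof (rule beurling_uniqueness[OF H'_int _ mono nonneg div _ \<Lambda>[of k]])
      show "integrable M (\<lambda>x. exp (\<psi> \<bar>- x $ k\<bar>) * norm (H' x))"
      proof (rule Bochner_Integration.integrable_bound[OF wint])
        have "exp (\<psi> \<bar>- x $ k\<bar>) * norm (H' x) \<le> exp (\<psi> (norm x)) * norm (H x)" for x
          using monoD[OF mono, of "\<bar>- x $ k\<bar>" "norm x"] component_le_norm_cart[of x k]
          by (intro mult_mono H'_le) auto
        then show "AE x in M. norm (exp (\<psi> \<bar>- x $ k\<bar>) * norm (H' x)) \<le> norm (exp (\<psi> (norm x)) * norm (H x))"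
          by (intro AE_I2) simp
      qed measurable
      show "uminus -` A k \<in> sets borel"
        by (rule measurable_sets_borel[OF _ insert.prems(1)]) simp
      fix t assume t: "t \<in> \<Lambda> k"
      have "(\<integral>x. exp (\<i> * complex_of_real t * complex_of_real (- x $ k)) * H' x \<partial>M)
          = (\<integral>x. (\<Prod>j\<in>J. indicator (A j) (x $ j))
              * (\<Prod>j\<in>-J. exp (- (\<i> * complex_of_real ((l(k := t)) j * x $ j)))) * H x \<partial>M)"
      proof (intro Bochner_Integration.integral_cong refl)
        fix x
        have J: "- J = insert k (- insert k J)" using insert.hyps by auto
        have "(\<Prod>j\<in>-J. exp (- (\<i> * complex_of_real ((l(k := t)) j * x $ j))))
            = exp (- (\<i> * complex_of_real (t * x $ k))) * (\<Prod>j\<in>-insert k J. exp (- (\<i> * complex_of_real ((l(k := t)) j * x $ j))))"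
          unfolding J by (subst prod.insert) auto
        also have "(\<Prod>j\<in>-insert k J. exp (- (\<i> * complex_of_real ((l(k := t)) j * x $ j))))
            = (\<Prod>j\<in>-insert k J. exp (- (\<i> * complex_of_real (l j * x $ j))))"
          by (intro prod.cong) auto
        finally show "exp (\<i> * complex_of_real t * complex_of_real (- x $ k)) * H' x
          = (\<Prod>j\<in>J. indicator (A j) (x $ j))
              * (\<Prod>j\<in>-J. exp (- (\<i> * complex_of_real ((l(k := t)) j * x $ j)))) * H x"
          by (simp add: H'_def mult_ac)
      qed
      also have "\<dots> = 0" by (rule insert.IH) (use insert.prems t in auto)
      finally show "(\<integral>x. exp (\<i> * complex_of_real t * complex_of_real (- x $ k)) * H' x \<partial>M) = 0" .
    qed measurable
    also have "(\<lambda>x. indicator (uminus -` A k) (- x $ k) * H' x)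
        = (\<lambda>x. (\<Prod>j\<in>insert k J. indicator (A j) (x $ j)) * (\<Prod>j\<in>-insert k J. exp (- (\<i> * complex_of_real (l j * x $ j)))) * H x)"
      using insert.hyps by (auto simp: H'_def fun_eq_iff indicator_def)
    finally show ?case .
  qed
  \<comment> \<open>For \<open>J = UNIV\<close> no exponential is left, but instantiating the
    induction still asks for a frequency in each \<open>\<Lambda> j\<close>.\<close>
  have "\<exists>t. t \<in> \<Lambda> j" for j
  proof (rule ccontr)
    assume "\<nexists>t. t \<in> \<Lambda> j"
    then have "\<Lambda> j = {}" by blast
    with \<Lambda>(2)[of j] show False by simp
  qed
  then obtain l where "\<And>j. l j \<in> \<Lambda> j" by metis
  then have boxes: "(\<integral>x. (\<Prod>j\<in>UNIV. indicator (A j) (x $ j)) * H x \<partial>M) = 0" if "\<And>j. A j \<in> sets borel" for A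
    using main[of UNIV A l] that by simp
  show ?thesis
    by (rule AE_zero_of_set_integrals[OF H], rule set_integrals_zero_of_boxes[OF sets H boxes])
qed

lemma exp_space_induct [consumes 1, case_names base zero add]:
  assumes "f \<in> exp_space L" and "\<And>l. l \<in> L \<Longrightarrow> P (expo l)" and "P (\<lambda>_. 0)"
    and "\<And>f g c. P f \<Longrightarrow> P g \<Longrightarrow> P (\<lambda>x. f x + c * g x)"
  shows "P f"
proof -
  interpret module "\<lambda>(c::complex) (f :: real ^ 'n \<Rightarrow> complex) x. c * f x" by (rule module_complex_fun)
  show ?thesis
    using assms(1) unfolding exp_space_def
  proof (induction rule: span_induct_alt)
    case base
    then show ?case using assms(3) by (simp add: zero_fun_def)
  next
    case (step c g h)
    then obtain l where "l \<in> L" "g = expo l" by auto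
    with step show ?case using assms(4)[of h g c] assms(2)[of l]
      by (simp add: plus_fun_def add.commute)
  qed
qed

lemma bounded_function_space_exp_space:
  fixes M :: "(real ^ 'n) measure"
  assumes "finite_measure M" and sets: "sets M = sets borel"
  shows "bounded_function_space M (exp_space L)"
proof -
  interpret finite_measure M by fact
  interpret module "\<lambda>(c::complex) (f :: real ^ 'n \<Rightarrow> complex) x. c * f x" by (rule module_complex_fun)
  note [measurable_cong] = sets
  show ?thesis
  proof
    show "s \<in> borel_measurable M" if "s \<in> exp_space L" for s
      using that
    proof (induction rule: exp_space_induct)
      case (base l)
      have "continuous_on UNIV (expo l)" unfolding expo_def by (intro continuous_intros)
      then have "expo l \<in> borel_measurable borel" by (rule borel_measurable_continuous_onI)
      then show ?case by measurable
    qed auto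
    show "\<exists>B. \<forall>x. norm (s x) \<le> B" if "s \<in> exp_space L" for s
      using that
    proof (induction rule: exp_space_induct)
      case (base l)
      then show ?case by (intro exI[of _ 1]) (simp add: expo_def)
    next
      case (add f g c)
      then obtain B C where "\<And>x. norm (f x) \<le> B" "\<And>x. norm (g x) \<le> C" by blast
      then have "norm (f x + c * g x) \<le> B + norm c * C" for x
        by (intro order_trans[OF norm_triangle_ineq] add_mono) (auto simp: norm_mult mult_left_mono)
      then show ?case by blast
    qed auto
    show "(\<lambda>_. 0) \<in> exp_space L"
      using span_zero by (simp add: exp_space_def zero_fun_def)
    show "(\<lambda>x. f x + c * g x) \<in> exp_space L" if "f \<in> exp_space L" "g \<in> exp_space L" for f g c
      using span_add[OF that(1)[unfolded exp_space_def] span_scale[OF that(2)[unfolded exp_space_def], of c]]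
      by (simp add: exp_space_def plus_fun_def)
  qed
qed

lemma expo_in_exp_space: "l \<in> L \<Longrightarrow> expo l \<in> exp_space L"
proof -
  interpret module "\<lambda>(c::complex) (f :: real ^ 'n \<Rightarrow> complex) x. c * f x" by (rule module_complex_fun)
  assume "l \<in> L"
  then show ?thesis unfolding exp_space_def by (intro span_base) auto
qed

theorem theorem2p3:
  fixes \<psi> :: "real \<Rightarrow> real"
    and \<mu> :: "(real ^ 'n) set \<Rightarrow> complex"
    and \<Lambda> :: "'n \<Rightarrow> real set"
    and p :: real
  assumes psi_nonneg: "\<And>x. 0 \<le> x \<Longrightarrow> 0 \<le> \<psi> x"
    and psi_mono: "mono_on {0..} \<psi>"
    and psi_div: "(\<integral>\<^sup>+ x\<in>{0..}. ennreal (\<psi> x / (1 + x\<^sup>2)) \<partial>lborel) = \<infinity>"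
    and mu: "complex_measure borel \<mu>"
    and mu_fin: "(\<integral>\<^sup>+ x. ennreal (exp (\<psi> (norm x))) \<partial>(total_variation borel \<mu>)) < \<infinity>"
    and Lam_closed: "\<And>j. closed (\<Lambda> j)"
    and Lam_pos: "\<And>j. 0 < emeasure lborel (\<Lambda> j)"
    and p: "1 \<le> p"
  shows "dense_in_Lp p (total_variation borel \<mu>) (exp_space {l. \<forall>j. l $ j \<in> \<Lambda> j})"
proof -
  define M where "M = total_variation borel \<mu>"
  have sets: "sets M = sets borel" by (simp add: M_def)
  note [measurable_cong] = sets
  \<comment> \<open>The values of \<open>\<psi>\<close> on negative numbers are unconstrained;
    extending by \<open>\<psi> 0\<close> gives a globally monotone and nonnegative function.\<close>
  define \<phi> where "\<phi> = (\<lambda>x. \<psi> (max x 0))"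
  have mono: "mono \<phi>" and nonneg: "0 \<le> \<phi> x" for x
    using psi_mono psi_nonneg by (auto simp: \<phi>_def mono_def mono_on_def)
  have [measurable]: "\<phi> \<in> borel_measurable borel" using mono by (rule borel_measurable_mono)
  have norm_meas [measurable]: "(\<lambda>x :: real ^ 'n. norm x) \<in> borel_measurable M"
    by measurable
  have div: "(\<integral>\<^sup>+x\<in>{0..}. ennreal (\<phi> x / (1 + x\<^sup>2)) \<partial>lborel) = \<infinity>"
    using psi_div by (subst nn_integral_cong[where v = "\<lambda>x. ennreal (\<psi> x / (1 + x\<^sup>2)) * indicator {0..} x"])
      (auto simp: \<phi>_def indicator_def)
  have exp_fin: "(\<integral>\<^sup>+x. ennreal (exp (\<phi> (norm x))) \<partial>M) < \<infinity>"
    using mu_fin by (simp add: \<phi>_def M_def)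
  have fin: "finite_measure M"
  proof
    have "emeasure M (space M) = (\<integral>\<^sup>+x. 1 \<partial>M)" by simp
    also have "\<dots> \<le> (\<integral>\<^sup>+x. ennreal (exp (\<phi> (norm x))) \<partial>M)"
      using nonneg by (intro nn_integral_mono) simp
    finally show "emeasure M (space M) \<noteq> \<infinity>" using exp_fin by auto
  qed
  have exp_int: "integrable M (\<lambda>x. exp (\<phi> (norm x)))"
    using exp_fin by (intro integrableI_nonneg) auto
  interpret bounded_function_space M "exp_space {l. \<forall>j. l $ j \<in> \<Lambda> j}"
    by (rule bounded_function_space_exp_space[OF fin sets])
  obtain k :: nat where k: "p \<le> real k" using real_arch_simple by blast
  define m where "m = max 1 k"
  have m: "m \<ge> 1" "p \<le> real (2 * m)" using k by (auto simp: m_def)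
  \<comment> \<open>Chosen so that the \<open>2 m\<close>-th power of the new weight is
    \<open>exp (\<phi> (norm x))\<close>, which is integrable, while the logarithmic integral
    changes only by a positive factor.\<close>
  define \<phi>m where "\<phi>m = (\<lambda>x. \<phi> x / (2 * m))"
  have mono': "mono \<phi>m" and nonneg': "0 \<le> \<phi>m x" for x
    using mono nonneg by (auto simp: \<phi>m_def mono_def divide_right_mono)
  have [measurable]: "\<phi>m \<in> borel_measurable borel" using mono' by (rule borel_measurable_mono)
  have div': "(\<integral>\<^sup>+x\<in>{0..}. ennreal (\<phi>m x / (1 + x\<^sup>2)) \<partial>lborel) = \<infinity>"
  proof -
    have "(\<integral>\<^sup>+x\<in>{0..}. ennreal (\<phi>m x / (1 + x\<^sup>2)) \<partial>lborel)
        = (\<integral>\<^sup>+x. ennreal (1 / (2 * m)) * (ennreal (\<phi> x / (1 + x\<^sup>2)) * indicator {0..} x) \<partial>lborel)"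
      using m nonneg by (intro nn_integral_cong) (auto simp: \<phi>m_def indicator_def simp flip: ennreal_mult')
    also have "\<dots> = ennreal (1 / (2 * m)) * \<infinity>" by (subst nn_integral_cmult) (auto simp: div)
    also have "\<dots> = \<infinity>" using m by (simp add: ennreal_mult_top)
    finally show ?thesis .
  qed
  have "dense_in_Lp p M (exp_space {l. \<forall>j. l $ j \<in> \<Lambda> j})"
  proof (rule dense_in_LpI[where m = m and w = "\<lambda>x. exp (\<phi>m (norm x))"])
    have "exp (\<phi>m (norm x)) ^ (2 * m) = exp (\<phi> (norm x))" for x :: "real ^ 'n"
      using m by (simp add: \<phi>m_def flip: exp_of_nat_mult)
    then show "integrable M (\<lambda>x. exp (\<phi>m (norm x)) ^ (2 * m))" using exp_int by simp
    fix H :: "real ^ 'n \<Rightarrow> complex"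
    assume H: "integrable M H" "integrable M (\<lambda>x. exp (\<phi>m (norm x)) * norm (H x))"
      and zero: "\<And>s. s \<in> exp_space {l. \<forall>j. l $ j \<in> \<Lambda> j} \<Longrightarrow> (\<integral>x. s x * H x \<partial>M) = 0"
    show "AE x in M. H x = 0"
    proof (rule exponential_annihilator_zero[OF sets H(1) mono' nonneg' div' H(2) _ Lam_pos])
      show "\<Lambda> j \<in> sets borel" for j using Lam_closed by (rule borel_closed)
      show "(\<integral>x. expo l x * H x \<partial>M) = 0" if "\<And>j. l $ j \<in> \<Lambda> j" for l
        using that by (intro zero expo_in_exp_space) auto
    qed
  qed (use m p in auto)
  then show ?thesis by (simp add: M_def)
qed

end
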